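(* Let $0<q<1$, $w\in\mathbb{C}\setminus\{0\}$, and let $(\mathcal{A}_q,\mathcal{H},\mathcal{D})$ be the $\mathcal{U}_q(\mathfrak{su}(2))$-equivariant real spectral triple on the standard Podleś sphere $S_q^2$. Its dimension spectrum, i.e. the set of all poles of the (meromorphically continued) functions $\zeta_{\mathcal{D}}^P(s)=\operatorname{Tr}(P|\mathcal{D}|^{-s})$ for $P\in\mathcal{B}:=\Psi(\mathcal{A}_q)\cap\mathrm{op}^0$, is $$\mathrm{Sd}(S_q^2)=-\mathbb{N}+i\,\frac{2\pi}{\log q}\,\mathbb{Z},$$ and the poles are at most of the second order.
   Context: $\mathbb{N}=\{0,1,2,\dots\}$ and $[n]:=\frac{q^{-n}-q^n}{q^{-1}-q}$. Spectral triple. $\mathcal{A}_q$ is the complex $*$-algebra generated by $A=A^*,B,B^*$ with $AB=q^2BA$, $AB^*=q^{-2}B^*A$, $BB^*=q^{-2}A(1-A)$, $B^*B=A(1-q^2A)$. $\mathcal{H}_{1/2}$ has orthonormal basis $|l,m\rangle$, $l\in\frac12+\mathbb{N}$, $m\in\{-l,\dots,l\}$; $\mathcal{H}=\mathcal{H}_+\oplus\mathcal{H}_-$ with $\mathcal{H}_\pm=\mathcal{H}_{1/2}$ and basis vectors $|l,m\rangle_\pm$. $\mathcal{A}_q$ acts by $\pi=\pi_+\oplus\pi_-$ (the symbol $\pi$ is omitted), where $\pi_\pm$ are the $*$-representations $$\pi_\pm(A)|l,m\rangle=A^+_{l,m}|l+1,m\rangle+A^0_{l,m}|l,m\rangle+A^-_{l,m}|l-1,m\rangle,$$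 $$\pi_\pm(B)|l,m\rangle=B^+_{l,m}|l+1,m+1\rangle+B^0_{l,m}|l,m+1\rangle+B^-_{l,m}|l-1,m+1\rangle,$$ with $A^+_{l,m}=-q^{m+l+1/2}\sqrt{[l-m+1][l+m+1]}\,\alpha_l^+$, $A^0_{l,m}=\frac{q^{-1/2}}{1+q^2}\big([l-m+1][l+m]-q^2[l-m][l+m+1]\big)\alpha^0_l+\frac1{1+q^2}$, $A^-_{l,m}=q^{m-l-1/2}\sqrt{[l-m][l+m]}\,\alpha^-_l$, $B^+_{l,m}=q^m\sqrt{[l+m+1][l+m+2]}\,\alpha^+_l$, $B^0_{l,m}=q^m\sqrt{[l+m+1][l-m]}\,\alpha^0_l$, $B^-_{l,m}=q^m\sqrt{[l-m][l-m-1]}\,\alpha_l^-$, where $\alpha^-_{l+1}=-q^{2l+2}\alpha^+_l$ and for $\pi_+$: $\alpha^0_l=q^{-1/2}\frac{(q-q^{-1})[l-\frac12][l+\frac32]+q}{[2l][2l+2]}$, $\alpha^+_l=\frac{q^{-l-2}}{\sqrt{[2l+2]([4l+4]+[2][2l+2])}}$; for $\pi_-$: $\alpha^0_l=q^{-1/2}\frac{(q-q^{-1})[l-\frac12][l+\frac32]-q^{-1}}{[2l][2l+2]}$, $\alpha^+_l=\frac{q^{-l-1}}{\sqrt{[2l+2]([4l+4]+[2][2l+2])}}$; and $\pi_\pm(B^* )=\pi_\pm(B)^*$. With $D|l,m\rangle=[l+\frac12]|l,m\rangle$, $\mathcal{D}=\begin{pmatrix}0&\bar wD\\ wD&0\end{pmatrix}$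 and $|\mathcal{D}|=|w|\,(D\oplus D)$. The real structure is the antiunitary $J|l,m\rangle_\pm=i^{2m}|l,-m\rangle_\mp$. Operator classes. $\delta(T)=[|\mathcal{D}|,T]$, with domain the bounded $T$ preserving $\operatorname{Dom}|\mathcal{D}|$ for which $[|\mathcal{D}|,T]$ extends to a bounded operator; $\mathrm{OP}^0=\bigcap_n\operatorname{Dom}\delta^n$ and $\mathrm{OP}^\alpha=\{T:|\mathcal{D}|^{-\alpha}T\in\mathrm{OP}^0\}$. $\mathcal{H}^s=\operatorname{Dom}(|\mathcal{D}|^s)$ with norm $\|\xi\|_s^2=\|\xi\|^2+\|(1+\mathcal{D}^2)^{s/2}\xi\|^2$, $\mathcal{H}^\infty=\bigcap_{s\ge0}\mathcal{H}^s$; $\mathrm{op}^r$ is the set of operators $T$ on $\mathcal{H}$ with $\operatorname{Dom}T\supset\mathcal{H}^\infty$ that map $(\mathcal{H}^\infty,\|\cdot\|_s)$ continuously into $(\mathcal{H}^\infty,\|\cdot\|_{s-r})$ for each $s\ge r$. Pseudodifferential operators. $D(\mathcal{A}_q)$ is the polynomial algebra generated by $\mathcal{A}_q$, $J\mathcal{A}_qJ^{-1}$, $\mathcal{D}$, $|\mathcal{D}|$. $\Psi(\mathcal{A}_q)$ is the set of operators $P$ such that for every $N\in\mathbb{N}$ there are $T\in D(\mathcal{A}_q)$, $R\in\mathrm{OP}^{-N}$, $p\in\mathbb{N}$ with $P=T|\mathcal{D}|^{-p}+R$. *)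

theory Defs
  imports "HOL-Complex_Analysis.Complex_Analysis"
begin

text \<open>
  The label \<open>(l, m, True)\<close> stands for \<open>|l,m\<rangle>\<^sub>+\<close> and \<open>(l, m, False)\<close> for \<open>|l,m\<rangle>\<^sub>-\<close>.  The half-integers
  \<open>l\<close> and \<open>m\<close> are real numbers, so that the coefficients below can be written as on paper.
\<close>

type_synonym label = "real \<times> real \<times> bool"

definition labels :: "label set" where
  "labels = {(l, m, e). l - 1/2 \<in> \<nat> \<and> l - m \<in> \<nat> \<and> l + m \<in> \<nat>}"

definition ell2 :: "(label \<Rightarrow> complex) \<Rightarrow> bool" where
  "ell2 x \<longleftrightarrow> (\<forall>i. i \<notin> labels \<longrightarrow> x i = 0) \<and> (\<lambda>i. (cmod (x i))\<^sup>2) summable_on labels"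

typedef hilb = "{x. ell2 x}"
  morphisms hcoeff hvec
  by (rule exI[of _ "\<lambda>_. 0"]) (simp add: ell2_def)

setup_lifting type_definition_hilb

lemma ell2_mult_summable:
  assumes "ell2 x" "ell2 y"
  shows "(\<lambda>i. cmod (x i * y i)) summable_on labels" "(\<lambda>i. cmod (cnj (x i) * y i)) summable_on labels"
proof -
  have s: "(\<lambda>i. (cmod (x i))\<^sup>2 + (cmod (y i))\<^sup>2) summable_on labels"
    using assms by (auto simp: ell2_def intro!: summable_on_add)
  have b: "a * b \<le> a\<^sup>2 + b\<^sup>2" if "a \<ge> 0" "b \<ge> 0" for a b :: real
    using sum_squares_bound[of a b] mult_nonneg_nonneg[OF that] by linarith
  show "(\<lambda>i. cmod (x i * y i)) summable_on labels"
    by (rule summable_on_comparison_test[OF s]) (simp_all add: norm_mult b)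
  show "(\<lambda>i. cmod (cnj (x i) * y i)) summable_on labels"
    by (rule summable_on_comparison_test[OF s]) (simp_all add: norm_mult b)
qed

lemma ell2_add:
  assumes "ell2 x" "ell2 y"
  shows "ell2 (\<lambda>i. x i + y i)"
proof -
  have s: "(\<lambda>i. 2 * (cmod (x i))\<^sup>2 + 2 * (cmod (y i))\<^sup>2) summable_on labels"
    using assms by (auto simp: ell2_def intro!: summable_on_add summable_on_cmult_right)
  have b: "(cmod (a + b))\<^sup>2 \<le> 2 * (cmod a)\<^sup>2 + 2 * (cmod b)\<^sup>2" for a b
  proof -
    have "(cmod (a + b))\<^sup>2 \<le> (cmod a + cmod b)\<^sup>2"
      by (simp add: norm_triangle_ineq power_mono)
    also have "\<dots> \<le> 2 * (cmod a)\<^sup>2 + 2 * (cmod b)\<^sup>2"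
      using sum_squares_bound[of "cmod a" "cmod b"] by (simp add: power2_sum)
    finally show ?thesis .
  qed
  have "(\<lambda>i. (cmod (x i + y i))\<^sup>2) summable_on labels"
    by (rule summable_on_comparison_test[OF s]) (simp_all add: b)
  with assms show ?thesis by (simp add: ell2_def)
qed

lemma ell2_scale: "ell2 x \<Longrightarrow> ell2 (\<lambda>i. c * x i)"
  by (auto simp: ell2_def norm_mult power_mult_distrib intro!: summable_on_cmult_right)

lift_definition cinner :: "hilb \<Rightarrow> hilb \<Rightarrow> complex" is
  "\<lambda>x y. \<Sum>\<^sub>\<infinity>i\<in>labels. cnj (x i) * y i" .

lift_definition scaleC :: "complex \<Rightarrow> hilb \<Rightarrow> hilb" (infixr "*\<^sub>C" 75) is
  "\<lambda>c x i. c * x i"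
  by (rule ell2_scale)

instantiation hilb :: real_vector
begin

lift_definition zero_hilb :: hilb is "\<lambda>_. 0"
  by (simp add: ell2_def)

lift_definition plus_hilb :: "hilb \<Rightarrow> hilb \<Rightarrow> hilb" is "\<lambda>x y i. x i + y i"
  by (rule ell2_add)

lift_definition uminus_hilb :: "hilb \<Rightarrow> hilb" is "\<lambda>x i. - x i"
  by (simp add: ell2_def)

lift_definition minus_hilb :: "hilb \<Rightarrow> hilb \<Rightarrow> hilb" is "\<lambda>x y i. x i - y i"
  using ell2_add[OF _ ell2_scale[of _ "-1"]] by fastforce

lift_definition scaleR_hilb :: "real \<Rightarrow> hilb \<Rightarrow> hilb" is "\<lambda>r x i. complex_of_real r * x i"
  by (rule ell2_scale)

instance
  by standard (transfer; simp add: fun_eq_iff algebra_simps)+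

end

lemma cinner_commute: "cinner x y = cnj (cinner y x)"
  by transfer (simp add: infsum_cnj[symmetric] mult.commute)

lemma cinner_add_left: "cinner (x + y) z = cinner x z + cinner y z"
proof transfer
  fix x y z assume "ell2 x" "ell2 y" "ell2 z"
  then show "(\<Sum>\<^sub>\<infinity>i\<in>labels. cnj (x i + y i) * z i) =
        (\<Sum>\<^sub>\<infinity>i\<in>labels. cnj (x i) * z i) + (\<Sum>\<^sub>\<infinity>i\<in>labels. cnj (y i) * z i)"
    by (simp add: distrib_right infsum_add abs_summable_summable ell2_mult_summable)
qed

lemma cinner_scaleR_left: "cinner (r *\<^sub>R x) y = complex_of_real r * cinner x y"
  by transfer (simp add: infsum_cmult_right' mult.assoc)

lemma cinner_self: "cinner x x = complex_of_real (\<Sum>\<^sub>\<infinity>i\<in>labels. (cmod (hcoeff x i))\<^sup>2)"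
proof -
  have "cinner x x = (\<Sum>\<^sub>\<infinity>i\<in>labels. complex_of_real ((cmod (hcoeff x i))\<^sup>2))"
    unfolding cinner.rep_eq
    by (rule infsum_cong) (metis complex_norm_square mult.commute of_real_power)
  moreover have "(\<lambda>i. (cmod (hcoeff x i))\<^sup>2) summable_on labels"
    using hcoeff[of x] by (simp add: ell2_def)
  then have "((\<lambda>i. complex_of_real ((cmod (hcoeff x i))\<^sup>2)) has_sum
      complex_of_real (\<Sum>\<^sub>\<infinity>i\<in>labels. (cmod (hcoeff x i))\<^sup>2)) labels"
    by (intro has_sum_of_real_iff[THEN iffD2] has_sum_infsum)
  ultimately show ?thesis
    by (simp add: infsumI)
qed

instantiation hilb :: real_inner
begin

definition inner_hilb :: "hilb \<Rightarrow> hilb \<Rightarrow> real" where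
  "inner_hilb x y = Re (cinner x y)"

definition norm_hilb :: "hilb \<Rightarrow> real" where
  "norm_hilb x = sqrt (inner x x)"

definition sgn_hilb :: "hilb \<Rightarrow> hilb" where
  "sgn_hilb x = x /\<^sub>R norm x"

definition dist_hilb :: "hilb \<Rightarrow> hilb \<Rightarrow> real" where
  "dist_hilb x y = norm (x - y)"

definition uniformity_hilb :: "(hilb \<times> hilb) filter" where
  "uniformity_hilb = (INF e\<in>{0<..}. principal {(x, y). dist x y < e})"

definition open_hilb :: "hilb set \<Rightarrow> bool" where
  "open_hilb U \<longleftrightarrow> (\<forall>x\<in>U. eventually (\<lambda>(x', y). x' = x \<longrightarrow> y \<in> U) uniformity)"

instance
proof
  fix x y z :: hilb and r :: real
  show "inner x y = inner y x"
    by (simp add: inner_hilb_def cinner_commute[of x y])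
  show "inner (x + y) z = inner x z + inner y z"
    by (simp add: inner_hilb_def cinner_add_left)
  show "inner (r *\<^sub>R x) y = r * inner x y"
    by (simp add: inner_hilb_def cinner_scaleR_left)
  show "0 \<le> inner x x"
    by (simp add: inner_hilb_def cinner_self infsum_nonneg)
  show "(inner x x = 0) = (x = 0)"
  proof
    assume "inner x x = 0"
    then have "(\<Sum>\<^sub>\<infinity>i\<in>labels. (cmod (hcoeff x i))\<^sup>2) = 0"
      by (simp add: inner_hilb_def cinner_self)
    moreover have el: "ell2 (hcoeff x)"
      using hcoeff by auto
    ultimately have "(cmod (hcoeff x i))\<^sup>2 = 0" if "i \<in> labels" for i
      using that by (intro nonneg_infsum_le_0D[of _ labels i]) (auto simp: ell2_def)
    with el have "hcoeff x i = 0" for i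
      unfolding ell2_def by (metis power_eq_0_iff norm_eq_zero)
    then show "x = 0"
      by (simp add: hcoeff_inject[symmetric] zero_hilb.rep_eq fun_eq_iff)
  next
    assume "x = 0"
    then show "inner x x = 0"
      by (simp add: inner_hilb_def cinner_self zero_hilb.rep_eq)
  qed
qed (simp_all add: norm_hilb_def sgn_hilb_def dist_hilb_def uniformity_hilb_def open_hilb_def)

end

text \<open>Junk labels, which occur below only with vanishing coefficients, give the zero vector.\<close>

definition ket :: "real \<Rightarrow> real \<Rightarrow> bool \<Rightarrow> hilb" where
  "ket l m e = (if (l, m, e) \<in> labels then hvec (\<lambda>i. if i = (l, m, e) then 1 else 0) else 0)"

definition hconj :: "hilb \<Rightarrow> hilb" where
  "hconj x = hvec (\<lambda>i. cnj (hcoeff x i))"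

text \<open>A possibly unbounded operator \<open>T\<close> is a partial function with domain \<^term>\<open>dom T\<close>;
  composition of operators is \<^term>\<open>(\<circ>\<^sub>m)\<close>.\<close>

type_synonym oper = "hilb \<Rightarrow> hilb option"

definition clinear_op :: "oper \<Rightarrow> bool" where
  "clinear_op T \<longleftrightarrow> T 0 = Some 0 \<and>
     (\<forall>x\<in>dom T. \<forall>y\<in>dom T. \<forall>a b.
        T (a *\<^sub>C x + b *\<^sub>C y) = Some (a *\<^sub>C the (T x) + b *\<^sub>C the (T y)))"

definition bounded_op :: "oper \<Rightarrow> bool" where
  "bounded_op T \<longleftrightarrow> clinear_op T \<and> dom T = UNIV \<and> (\<exists>C. \<forall>x. norm (the (T x)) \<le> C * norm x)"

definition op_add :: "oper \<Rightarrow> oper \<Rightarrow> oper" where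
  "op_add S T = (\<lambda>x. if x \<in> dom S \<inter> dom T then Some (the (S x) + the (T x)) else None)"

definition op_scale :: "complex \<Rightarrow> oper \<Rightarrow> oper" where
  "op_scale c T = (\<lambda>x. map_option ((*\<^sub>C) c) (T x))"

text \<open>Meaningful for densely defined \<open>T\<close>: the vector \<open>z\<close> is then unique if it exists.\<close>

definition op_adj :: "oper \<Rightarrow> oper" where
  "op_adj T = (\<lambda>y. if \<exists>z. \<forall>x\<in>dom T. cinner y (the (T x)) = cinner z x
                   then Some (THE z. \<forall>x\<in>dom T. cinner y (the (T x)) = cinner z x) else None)"

text \<open>The operator with prescribed action \<open>|l,m\<rangle>\<^sub>e \<mapsto> v (l, m, e)\<close> on the basis, on its maximal domain.
  If the action is bounded, this is its unique bounded linear extension; if it is diagonal,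
  this is the normal operator with the given eigenvalues.\<close>

definition basis_op :: "(label \<Rightarrow> hilb) \<Rightarrow> oper" where
  "basis_op v = (\<lambda>x.
     let y = (\<lambda>i. \<Sum>\<^sub>\<infinity>j\<in>labels. hcoeff x j * hcoeff (v j) i) in
     if (\<forall>i. (\<lambda>j. hcoeff x j * hcoeff (v j) i) summable_on labels) \<and> ell2 y
     then Some (hvec y) else None)"

inductive_set alg_gen :: "oper set \<Rightarrow> oper set" for G :: "oper set" where
  one: "Some \<in> alg_gen G"
| gen: "T \<in> G \<Longrightarrow> T \<in> alg_gen G"
| add: "S \<in> alg_gen G \<Longrightarrow> T \<in> alg_gen G \<Longrightarrow> op_add S T \<in> alg_gen G"
| scale: "T \<in> alg_gen G \<Longrightarrow> op_scale c T \<in> alg_gen G"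
| comp: "S \<in> alg_gen G \<Longrightarrow> T \<in> alg_gen G \<Longrightarrow> S \<circ>\<^sub>m T \<in> alg_gen G"

text \<open>Trace-class operators are the nuclear operators: norm-convergent sums of rank-one operators
  \<open>\<langle>f\<^sub>n, \<cdot>\<rangle> g\<^sub>n\<close> with \<open>\<Sum>\<^sub>n \<parallel>f\<^sub>n\<parallel> \<parallel>g\<^sub>n\<parallel> < \<infinity>\<close>.\<close>

definition trace_class :: "oper \<Rightarrow> bool" where
  "trace_class T \<longleftrightarrow> bounded_op T \<and>
     (\<exists>f g :: nat \<Rightarrow> hilb. summable (\<lambda>n. norm (f n) * norm (g n)) \<and>
        (\<forall>x. (\<lambda>n. cinner (f n) x *\<^sub>C g n) sums the (T x)))"

definition op_trace :: "oper \<Rightarrow> complex" where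
  "op_trace T = (\<Sum>\<^sub>\<infinity>(l, m, e)\<in>labels. cinner (ket l m e) (the (T (ket l m e))))"

definition qnum :: "real \<Rightarrow> real \<Rightarrow> real" where
  "qnum q x = (q powr (-x) - q powr x) / (1/q - q)"

definition alpha_zero :: "real \<Rightarrow> bool \<Rightarrow> real \<Rightarrow> real" where
  "alpha_zero q e l = q powr (-1/2) *
     ((q - 1/q) * qnum q (l - 1/2) * qnum q (l + 3/2) + (if e then q else - 1/q))
     / (qnum q (2*l) * qnum q (2*l + 2))"

definition alpha_plus :: "real \<Rightarrow> bool \<Rightarrow> real \<Rightarrow> real" where
  "alpha_plus q e l = q powr (if e then - l - 2 else - l - 1)
     / sqrt (qnum q (2*l + 2) * (qnum q (4*l + 4) + qnum q 2 * qnum q (2*l + 2)))"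

text \<open>This is \<open>\<alpha>\<^sup>-\<^sub>l\<^sub>+\<^sub>1 = - q\<^sup>2\<^sup>l\<^sup>+\<^sup>2 \<alpha>\<^sup>+\<^sub>l\<close> with \<open>l\<close> shifted by one.\<close>

definition alpha_minus :: "real \<Rightarrow> bool \<Rightarrow> real \<Rightarrow> real" where
  "alpha_minus q e l = - (q powr (2*l)) * alpha_plus q e (l - 1)"

definition A_plus :: "real \<Rightarrow> bool \<Rightarrow> real \<Rightarrow> real \<Rightarrow> real" where
  "A_plus q e l m =
     - (q powr (m + l + 1/2)) * sqrt (qnum q (l - m + 1) * qnum q (l + m + 1)) * alpha_plus q e l"

definition A_zero :: "real \<Rightarrow> bool \<Rightarrow> real \<Rightarrow> real \<Rightarrow> real" where
  "A_zero q e l m = q powr (-1/2) / (1 + q\<^sup>2) *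
     (qnum q (l - m + 1) * qnum q (l + m) - q\<^sup>2 * qnum q (l - m) * qnum q (l + m + 1))
     * alpha_zero q e l + 1 / (1 + q\<^sup>2)"

definition A_minus :: "real \<Rightarrow> bool \<Rightarrow> real \<Rightarrow> real \<Rightarrow> real" where
  "A_minus q e l m =
     q powr (m - l - 1/2) * sqrt (qnum q (l - m) * qnum q (l + m)) * alpha_minus q e l"

definition B_plus :: "real \<Rightarrow> bool \<Rightarrow> real \<Rightarrow> real \<Rightarrow> real" where
  "B_plus q e l m = q powr m * sqrt (qnum q (l + m + 1) * qnum q (l + m + 2)) * alpha_plus q e l"

definition B_zero :: "real \<Rightarrow> bool \<Rightarrow> real \<Rightarrow> real \<Rightarrow> real" where
  "B_zero q e l m = q powr m * sqrt (qnum q (l + m + 1) * qnum q (l - m)) * alpha_zero q e l"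

definition B_minus :: "real \<Rightarrow> bool \<Rightarrow> real \<Rightarrow> real \<Rightarrow> real" where
  "B_minus q e l m = q powr m * sqrt (qnum q (l - m) * qnum q (l - m - 1)) * alpha_minus q e l"

definition op_A :: "real \<Rightarrow> oper" where
  "op_A q = basis_op (\<lambda>(l, m, e).
     A_plus q e l m *\<^sub>R ket (l + 1) m e + A_zero q e l m *\<^sub>R ket l m e
     + A_minus q e l m *\<^sub>R ket (l - 1) m e)"

definition op_B :: "real \<Rightarrow> oper" where
  "op_B q = basis_op (\<lambda>(l, m, e).
     B_plus q e l m *\<^sub>R ket (l + 1) (m + 1) e + B_zero q e l m *\<^sub>R ket l (m + 1) e
     + B_minus q e l m *\<^sub>R ket (l - 1) (m + 1) e)"

text \<open>The image \<open>\<pi>(\<A>\<^sub>q)\<close>: as \<open>\<A>\<^sub>q\<close> is generated by \<open>A = A\<^sup>*\<close>, \<open>B\<close>, \<open>B\<^sup>*\<close> and \<open>\<pi>\<close> is a unital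
  \<open>*\<close>-representation, it is the algebra generated by the images of these elements.\<close>

definition podles_alg :: "real \<Rightarrow> oper set" where
  "podles_alg q = alg_gen {op_A q, op_B q, op_adj (op_B q)}"

definition dirac :: "real \<Rightarrow> complex \<Rightarrow> oper" where
  "dirac q w = basis_op (\<lambda>(l, m, e).
     ((if e then w else cnj w) * complex_of_real (qnum q (l + 1/2))) *\<^sub>C ket l m (\<not> e))"

definition abs_dirac_eigenvalue :: "real \<Rightarrow> complex \<Rightarrow> real \<Rightarrow> real" where
  "abs_dirac_eigenvalue q w l = cmod w * qnum q (l + 1/2)"

definition abs_dirac :: "real \<Rightarrow> complex \<Rightarrow> oper" where
  "abs_dirac q w = basis_op (\<lambda>(l, m, e). abs_dirac_eigenvalue q w l *\<^sub>R ket l m e)"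

definition abs_dirac_pow :: "real \<Rightarrow> complex \<Rightarrow> complex \<Rightarrow> oper" where
  "abs_dirac_pow q w z = basis_op (\<lambda>(l, m, e).
     (complex_of_real (abs_dirac_eigenvalue q w l) powr z) *\<^sub>C ket l m e)"

text \<open>The antilinear extension of \<open>|l,m\<rangle>\<^sub>\<plusminus> \<mapsto> \<i>\<^sup>2\<^sup>m |l,-m\<rangle>\<^sub>\<mp>\<close>: first conjugate the coordinates.\<close>

definition op_J :: "hilb \<Rightarrow> hilb" where
  "op_J x = the (basis_op (\<lambda>(l, m, e). (\<i> powr complex_of_real (2*m)) *\<^sub>C ket l (-m) (\<not> e))
                   (hconj x))"

definition conj_J :: "oper \<Rightarrow> oper" where
  "conj_J T = (\<lambda>x. map_option op_J (T (inv op_J x)))"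

definition delta_rel :: "real \<Rightarrow> complex \<Rightarrow> oper \<Rightarrow> oper \<Rightarrow> bool" where
  "delta_rel q w T S \<longleftrightarrow>
     bounded_op T \<and> bounded_op S \<and>
     (\<forall>x\<in>dom (abs_dirac q w). the (T x) \<in> dom (abs_dirac q w) \<and>
        the (S x) = the (abs_dirac q w (the (T x))) - the (T (the (abs_dirac q w x))))"

fun dom_delta :: "real \<Rightarrow> complex \<Rightarrow> nat \<Rightarrow> oper set" where
  "dom_delta q w 0 = {T. bounded_op T}"
| "dom_delta q w (Suc n) = {T. \<exists>S\<in>dom_delta q w n. delta_rel q w T S}"

definition OP_zero :: "real \<Rightarrow> complex \<Rightarrow> oper set" where
  "OP_zero q w = (\<Inter>n. dom_delta q w n)"

definition OP_minus :: "real \<Rightarrow> complex \<Rightarrow> nat \<Rightarrow> oper set" where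
  "OP_minus q w N = {T. abs_dirac_pow q w (of_nat N) \<circ>\<^sub>m T \<in> OP_zero q w}"

definition H_infty :: "real \<Rightarrow> complex \<Rightarrow> hilb set" where
  "H_infty q w = (\<Inter>s\<in>{0::real..}. dom (abs_dirac_pow q w (complex_of_real s)))"

text \<open>The operator \<open>(1 + \<D>\<^sup>2)\<^sup>s\<^sup>/\<^sup>2\<close>, where \<open>\<D>\<^sup>2 = |\<D>|\<^sup>2\<close>.\<close>

definition bessel_pot :: "real \<Rightarrow> complex \<Rightarrow> real \<Rightarrow> oper" where
  "bessel_pot q w s = basis_op (\<lambda>(l, m, e).
     ((1 + (abs_dirac_eigenvalue q w l)\<^sup>2) powr (s/2)) *\<^sub>R ket l m e)"

definition sobolev_norm :: "real \<Rightarrow> complex \<Rightarrow> real \<Rightarrow> hilb \<Rightarrow> real" where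
  "sobolev_norm q w s x = sqrt ((norm x)\<^sup>2 + (norm (the (bessel_pot q w s x)))\<^sup>2)"

text \<open>Continuity of the linear restriction of \<open>T\<close> to \<open>\<H>\<^sup>\<infinity>\<close> is stated as boundedness.\<close>

definition op_class :: "real \<Rightarrow> complex \<Rightarrow> real \<Rightarrow> oper set" where
  "op_class q w r = {T. clinear_op T \<and> H_infty q w \<subseteq> dom T \<and>
     (\<forall>x\<in>H_infty q w. the (T x) \<in> H_infty q w) \<and>
     (\<forall>s\<ge>r. \<exists>C. \<forall>x\<in>H_infty q w.
        sobolev_norm q w (s - r) (the (T x)) \<le> C * sobolev_norm q w s x)}"

definition diff_ops :: "real \<Rightarrow> complex \<Rightarrow> oper set" where
  "diff_ops q w =
     alg_gen (podles_alg q \<union> conj_J ` podles_alg q \<union> {dirac q w, abs_dirac q w})"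

text \<open>The operators involved have different domains, all of them containing \<open>\<H>\<^sup>\<infinity>\<close>; the identity
  \<open>P = T |\<D>|\<^sup>-\<^sup>p + R\<close> is an identity of operators on \<open>\<H>\<^sup>\<infinity>\<close>.\<close>

definition pseudo_diff :: "real \<Rightarrow> complex \<Rightarrow> oper set" where
  "pseudo_diff q w = {P. clinear_op P \<and> H_infty q w \<subseteq> dom P \<and>
     (\<forall>N. \<exists>T\<in>diff_ops q w. \<exists>R\<in>OP_minus q w N. \<exists>p :: nat. \<forall>x\<in>H_infty q w.
        P x = op_add (T \<circ>\<^sub>m abs_dirac_pow q w (- of_nat p)) R x)}"

definition pseudo_diff_zero :: "real \<Rightarrow> complex \<Rightarrow> oper set" where
  "pseudo_diff_zero q w = pseudo_diff q w \<inter> op_class q w 0"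

text \<open>Elements of \<open>op\<^sup>0\<close> are bounded on the dense subspace \<open>\<H>\<^sup>\<infinity>\<close> (take \<open>s = 0\<close>), so they have a unique
  bounded extension to all of \<open>\<H>\<close>; this is needed for \<open>P |\<D>|\<^sup>-\<^sup>s\<close> to be defined on all of \<open>\<H>\<close>.\<close>

definition bounded_ext :: "real \<Rightarrow> complex \<Rightarrow> oper \<Rightarrow> oper" where
  "bounded_ext q w P = (THE S. bounded_op S \<and> (\<forall>x\<in>H_infty q w. S x = P x))"

text \<open>\<open>Z\<close> is the meromorphic continuation of \<open>s \<mapsto> Tr(P |\<D>|\<^sup>-\<^sup>s)\<close> from a right half-plane on which the
  operator is of trace class.\<close>

definition zeta_continuation ::
    "real \<Rightarrow> complex \<Rightarrow> oper \<Rightarrow> (complex \<Rightarrow> complex) \<Rightarrow> bool" where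
  "zeta_continuation q w P Z \<longleftrightarrow> Z meromorphic_on UNIV \<and>
     (\<exists>c::real. \<forall>s. Re s > c \<longrightarrow>
        trace_class (bounded_ext q w P \<circ>\<^sub>m abs_dirac_pow q w (- s)) \<and>
        Z s = op_trace (bounded_ext q w P \<circ>\<^sub>m abs_dirac_pow q w (- s)))"

definition dimension_spectrum :: "real \<Rightarrow> complex \<Rightarrow> complex set" where
  "dimension_spectrum q w =
     {z. \<exists>P\<in>pseudo_diff_zero q w. \<exists>Z. zeta_continuation q w P Z \<and> is_pole Z z}"

end

theory Submission
  imports Defs "HOL-Library.Landau_Symbols"
begin

text \<open>
  After conjugation with a diagonal operator (the gauge) all generators of the algebra of differential
  operators have matrix elements that are finite sums of terms \<open>q\<^sup>j\<^sup>m g(l)\<close>, with \<open>j\<close> an integer and \<open>g\<close>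
  having an asymptotic expansion in integer powers of \<open>q\<^sup>l\<close>.  Such operators form an algebra, so the same
  holds for the diagonal of every \<open>P\<close> in \<open>\<B>\<close>, up to an error \<open>O(q\<^sup>N\<^sup>l)\<close> for each \<open>N\<close>.  Summing over \<open>m\<close> and
  the sign yields a geometric sum (for \<open>j \<noteq> 0\<close>) or a factor \<open>2l + 1\<close> (for \<open>j = 0\<close>), hence coefficients
  \<open>f(\<nu>)\<close>, \<open>\<nu> = l + 1/2\<close>, expandable in the functions \<open>q\<^sup>j\<^sup>\<nu>\<close> and \<open>\<nu> q\<^sup>j\<^sup>\<nu>\<close>.  With the binomial expansion of
  \<open>(1 - q\<^sup>2\<^sup>\<nu>)\<^sup>-\<^sup>s\<close> the zeta function becomes, on each half-plane and up to a holomorphic function, a combination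
  of \<open>\<Sum>\<^sub>\<nu> q\<^sup>\<nu>\<^sup>(\<^sup>s\<^sup>+\<^sup>j\<^sup>)\<close> and \<open>\<Sum>\<^sub>\<nu> \<nu> q\<^sup>\<nu>\<^sup>(\<^sup>s\<^sup>+\<^sup>j\<^sup>)\<close>, which have simple and double poles where \<open>q\<^sup>s\<^sup>+\<^sup>j = 1\<close>.  Boundedness
  of \<open>P\<close> excludes poles with positive real part, and \<open>P = |\<D>|\<^sup>-\<^sup>k\<close> attains the poles with real part \<open>-k\<close>.
\<close>

text \<open>The gauge is harmless because conjugation by a diagonal operator leaves diagonal matrix
  elements, hence traces, unchanged. It is needed because a factor such as
  \<open>sqrt (qnum q (l - m))\<close> is not a finite sum of terms q^(jm) g(l); a path of shifts
  that returns to its label, however, meets these roots in pairs, so that only their squares are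
  left. Domains of products of unbounded generators are never determined: every generator maps
  finitely supported vectors to finitely supported vectors, and a trace is computed on basis
  vectors. Second order is the limit because no power of l occurs in g(l): the only polynomial
  factor is the number 2l + 1 of values of m, and it enters once. As j is an integer in q^(jm) and
  the exponents of q^l are integers too, the sum over m produces only integer powers of q^l, so the
  pole lattice suffers no fractional shift. Finally [4l+4] + [2][2l+2] is [2l+2] times a power of q
  times two factors 1 + q^(2l+c), which is why the reciprocal of the radicand in alpha^+_l can be
  expanded.\<close>

section \<open>Identity theorem and holomorphic series on half-planes\<close>

text \<open>A meromorphic difference on a connected open set vanishes at almost all points or at
  almost none, and the latter is impossible near a point of \<open>V\<close>. The conclusion
  concerns a punctured neighbourhood, since a meromorphic function may take any value at an isolated
  point.\<close>

lemma meromorphic_on_eqI: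
  assumes f: "f meromorphic_on U" and g: "g meromorphic_on U" and U: "open U" "connected U"
    and V: "open V" "V \<subseteq> U" "V \<noteq> {}" and eq: "\<And>s. s \<in> V \<Longrightarrow> f s = g s" and z: "z \<in> U"
  shows "eventually (\<lambda>s. f s = g s) (at z)"
proof -
  have "(\<lambda>s. f s - g s) meromorphic_on U"
    by (intro meromorphic_intros f g)
  then consider "\<forall>\<^sub>\<approx>s\<in>U. f s - g s = 0" | "\<forall>\<^sub>\<approx>s\<in>U. f s - g s \<noteq> 0"
    using meromorphic_imp_constant_or_avoid[OF _ U] by blast
  then show ?thesis
  proof cases
    case 1
    then show ?thesis
      using eventually_cosparse_imp_eventually_at[OF 1 z, where B = UNIV] by simp
  next
    case 2
    obtain v where v: "v \<in> V" using V by blast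
    have "\<forall>\<^sub>F s in at v. f s - g s \<noteq> 0"
      using eventually_cosparse_imp_eventually_at[OF 2, of v UNIV] v V by auto
    moreover have "\<forall>\<^sub>F s in at v. s \<in> V"
      using v V by (intro eventually_at_in_open') auto
    ultimately have "\<forall>\<^sub>F s in at v. False"
      by eventually_elim (use eq in auto)
    then show ?thesis by simp
  qed
qed

lemma connected_halfplane: "connected {s. c < Re s}"
  by (intro convex_connected convex_halfspace_Re_gt)

text \<open>Weierstrass M-test on closed discs. The majorant may depend on the radius
  \<open>R\<close> and on the distance \<open>\<delta>\<close> to the boundary line, because
  binomial coefficients grow with s and geometric series degenerate at the line.\<close>

lemma holomorphic_series_halfplane:
  fixes u :: "nat \<Rightarrow> complex \<Rightarrow> complex"
  assumes hol: "\<And>n. u n holomorphic_on {s. c < Re s}"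
    and bd: "\<And>R \<delta>. \<delta> > 0 \<Longrightarrow> \<exists>M. summable M \<and>
               (\<forall>n s. cmod s \<le> R \<longrightarrow> c + \<delta> \<le> Re s \<longrightarrow> cmod (u n s) \<le> M n)"
  shows "(\<lambda>s. \<Sum>n. u n s) holomorphic_on {s. c < Re s}"
    and "c < Re s \<Longrightarrow> summable (\<lambda>n. u n s)"
proof -
  have op: "open {s. c < Re s}" by (rule open_halfspace_Re_gt)
  show "(\<lambda>s. \<Sum>n. u n s) holomorphic_on {s. c < Re s}"
  proof (rule holomorphic_uniform_sequence[OF op])
    show "(\<lambda>s. \<Sum>i<n. u i s) holomorphic_on {s. c < Re s}" for n
      by (intro holomorphic_intros hol)
  next
    fix x assume x: "x \<in> {s. c < Re s}"
    \<comment> \<open>Half the distance from \<open>x\<close> to the boundary: the closed disc of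
      this radius stays at distance \<open>\<delta>\<close> from the line.\<close>
    define \<delta> where "\<delta> = (Re x - c) / 2"
    have \<delta>: "\<delta> > 0" using x by (simp add: \<delta>_def)
    obtain M where M: "summable M"
      "\<And>n s. cmod s \<le> cmod x + \<delta> \<Longrightarrow> c + \<delta> \<le> Re s \<Longrightarrow> cmod (u n s) \<le> M n"
      using bd[OF \<delta>, of "cmod x + \<delta>"] by blast
    have near: "cmod s \<le> cmod x + \<delta> \<and> c + \<delta> \<le> Re s" if "s \<in> cball x \<delta>" for s
    proof -
      have d: "cmod (s - x) \<le> \<delta>" using that by (simp add: dist_norm norm_minus_commute)
      have "cmod s \<le> cmod x + cmod (s - x)" using norm_triangle_ineq[of x "s - x"] by simp
      moreover have "\<bar>Re (s - x)\<bar> \<le> cmod (s - x)" by (rule abs_Re_le_cmod)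
      ultimately show ?thesis using d by (auto simp: \<delta>_def field_simps)
    qed
    have "uniform_limit (cball x \<delta>) (\<lambda>n s. \<Sum>i<n. u i s) (\<lambda>s. \<Sum>n. u n s) sequentially"
      by (rule Weierstrass_m_test[OF _ M(1)]) (use near M(2) in blast)
    moreover have "cball x \<delta> \<subseteq> {s. c < Re s}"
    proof (rule subsetI)
      fix s assume "s \<in> cball x \<delta>"
      then have "c + \<delta> \<le> Re s" using near by blast
      then show "s \<in> {s. c < Re s}" using \<delta> by simp
    qed
    ultimately show "\<exists>d>0. cball x d \<subseteq> {s. c < Re s} \<and>
        uniform_limit (cball x d) (\<lambda>n s. \<Sum>i<n. u i s) (\<lambda>s. \<Sum>n. u n s) sequentially"
      using \<delta> by blast
  qed
  show "summable (\<lambda>n. u n s)" if s: "c < Re s"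
  proof -
    obtain M where "summable M" "\<And>n s'. cmod s' \<le> cmod s \<Longrightarrow> c + (Re s - c) \<le> Re s' \<Longrightarrow> cmod (u n s') \<le> M n"
      using bd[of "Re s - c" "cmod s"] s by auto
    then show ?thesis
      by (intro summable_comparison_test'[of M 0 "\<lambda>n. u n s"]) simp_all
  qed
qed


subsection \<open>Vectors and operators\<close>

lemma ell2_hcoeff: "ell2 (hcoeff x)"
  using hcoeff[of x] by simp

lemma hcoeff_hvec: "ell2 x \<Longrightarrow> hcoeff (hvec x) = x"
  by (simp add: hvec_inverse)

lemma hcoeff_outside: "i \<notin> labels \<Longrightarrow> hcoeff x i = 0"
  using ell2_hcoeff[of x] unfolding ell2_def by blast

lemma hilb_eqI: "(\<And>i. i \<in> labels \<Longrightarrow> hcoeff x i = hcoeff y i) \<Longrightarrow> x = y"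
  using hcoeff_outside by (metis hcoeff_inject ext)

lemma hcoeff_simps [simp]:
  "hcoeff (x + y) i = hcoeff x i + hcoeff y i" "hcoeff (x - y) i = hcoeff x i - hcoeff y i"
  "hcoeff (- x) i = - hcoeff x i" "hcoeff 0 i = 0" "hcoeff (c *\<^sub>C x) i = c * hcoeff x i"
  "hcoeff (r *\<^sub>R x) i = of_real r * hcoeff x i"
  by (simp_all add: plus_hilb.rep_eq minus_hilb.rep_eq uminus_hilb.rep_eq zero_hilb.rep_eq
      scaleC.rep_eq scaleR_hilb.rep_eq)

lemma hcoeff_sum [simp]: "hcoeff (\<Sum>k\<in>A. f k) i = (\<Sum>k\<in>A. hcoeff (f k) i)"
  by (induction A rule: infinite_finite_induct) auto

lemma scaleC_algebra:
  "c *\<^sub>C (x + y) = c *\<^sub>C x + c *\<^sub>C y" "(a + b) *\<^sub>C x = a *\<^sub>C x + b *\<^sub>C x"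
  "a *\<^sub>C b *\<^sub>C x = (a * b) *\<^sub>C x" "1 *\<^sub>C x = x" "0 *\<^sub>C x = 0" "c *\<^sub>C 0 = 0"
  "(- 1) *\<^sub>C x = - x" "of_real r *\<^sub>C x = r *\<^sub>R x"
  by (rule hilb_eqI; simp add: algebra_simps)+

abbreviation basis :: "label \<Rightarrow> hilb" where
  "basis i \<equiv> ket (fst i) (fst (snd i)) (snd (snd i))"

lemma ell2_finite_support:
  assumes "finite {i. x i \<noteq> 0}" "{i. x i \<noteq> 0} \<subseteq> labels"
  shows "ell2 x"
proof -
  have "(\<lambda>i. (cmod (x i))\<^sup>2) summable_on {i. x i \<noteq> 0}"
    using assms(1) by (rule summable_on_finite)
  then have "(\<lambda>i. (cmod (x i))\<^sup>2) summable_on labels"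
    by (rule summable_on_cong_neutral[THEN iffD1, rotated -1]) (use assms(2) in auto)
  then show ?thesis using assms(2) by (auto simp: ell2_def)
qed

lemma hcoeff_ket:
  "hcoeff (ket l m e) i = (if i = (l, m, e) \<and> i \<in> labels then 1 else 0)"
proof (cases "(l, m, e) \<in> labels")
  case True
  have "ell2 (\<lambda>i. if i = (l, m, e) then 1 else 0)"
    by (rule ell2_finite_support) (use True in auto)
  then show ?thesis using True by (auto simp: ket_def hcoeff_hvec)
qed (auto simp: ket_def)

lemma hcoeff_basis: "hcoeff (basis j) i = (if i = j \<and> i \<in> labels then 1 else 0)"
  by (simp add: hcoeff_ket)

lemma basis_outside: "j \<notin> labels \<Longrightarrow> basis j = 0"
  by (simp add: ket_def)

lemma summable_norm_sq: "(\<lambda>i. (cmod (hcoeff x i))\<^sup>2) summable_on labels"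
  using ell2_hcoeff[of x] by (simp add: ell2_def)

lemma norm_sq: "(norm x)\<^sup>2 = (\<Sum>\<^sub>\<infinity>i\<in>labels. (cmod (hcoeff x i))\<^sup>2)"
  unfolding norm_hilb_def inner_hilb_def cinner_self by (simp add: infsum_nonneg)

lemma sum_le_norm_sq:
  "finite F \<Longrightarrow> F \<subseteq> labels \<Longrightarrow> (\<Sum>i\<in>F. (cmod (hcoeff x i))\<^sup>2) \<le> (norm x)\<^sup>2"
  unfolding norm_sq by (intro finite_sum_le_infsum summable_norm_sq) auto

lemma hcoeff_le_norm: "cmod (hcoeff x i) \<le> norm x"
proof (cases "i \<in> labels")
  case True
  then have "(cmod (hcoeff x i))\<^sup>2 \<le> (norm x)\<^sup>2" using sum_le_norm_sq[of "{i}" x] by simp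
  then show ?thesis by (rule power2_le_imp_le) simp
qed (simp add: hcoeff_outside)

lemma bounded_sums_ell2:
  assumes "\<And>i. i \<notin> labels \<Longrightarrow> y i = 0"
    and "\<And>F. finite F \<Longrightarrow> F \<subseteq> labels \<Longrightarrow> (\<Sum>i\<in>F. (cmod (y i))\<^sup>2) \<le> C\<^sup>2" and C: "0 \<le> C"
  shows "ell2 y" "norm (hvec y) \<le> C"
proof -
  have s: "(\<lambda>i. (cmod (y i))\<^sup>2) summable_on labels"
    by (rule nonneg_bdd_above_summable_on) (use assms(2) in \<open>auto intro!: bdd_aboveI2[where M = "C\<^sup>2"]\<close>)
  then show e: "ell2 y" using assms(1) by (auto simp: ell2_def)
  have "(norm (hvec y))\<^sup>2 \<le> C\<^sup>2"
    unfolding norm_sq hcoeff_hvec[OF e] by (rule infsum_le_finite_sums[OF s assms(2)])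
  then show "norm (hvec y) \<le> C" using C by (rule power2_le_imp_le)
qed

lemma norm_le_coeff:
  assumes "\<And>i. i \<in> labels \<Longrightarrow> cmod (hcoeff x i) \<le> C * cmod (hcoeff y i)" "C \<ge> 0"
  shows "norm x \<le> C * norm y"
proof -
  have "norm (hvec (hcoeff x)) \<le> C * norm y"
  proof (rule bounded_sums_ell2(2))
    fix F assume F: "finite F" "F \<subseteq> labels"
    have "(\<Sum>i\<in>F. (cmod (hcoeff x i))\<^sup>2) \<le> (\<Sum>i\<in>F. (C * cmod (hcoeff y i))\<^sup>2)"
      using F assms by (intro sum_mono power_mono) auto
    also have "\<dots> = C\<^sup>2 * (\<Sum>i\<in>F. (cmod (hcoeff y i))\<^sup>2)"
      by (simp add: power_mult_distrib sum_distrib_left)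
    also have "\<dots> \<le> C\<^sup>2 * (norm y)\<^sup>2" by (intro mult_left_mono sum_le_norm_sq F) auto
    finally show "(\<Sum>i\<in>F. (cmod (hcoeff x i))\<^sup>2) \<le> (C * norm y)\<^sup>2" by (simp add: power_mult_distrib)
  qed (use assms(2) hcoeff_outside in auto)
  then show ?thesis by (simp add: hcoeff_inverse)
qed

lemma norm_scaleC: "norm (c *\<^sub>C x) = cmod c * norm x"
proof -
  have "norm (c *\<^sub>C x) \<le> cmod c * norm x" for c x
    by (rule norm_le_coeff) (auto simp: norm_mult)
  note le = this
  show ?thesis
  proof (cases "c = 0")
    case False
    have "norm x = norm (inverse c *\<^sub>C c *\<^sub>C x)" using False by (simp add: scaleC_algebra)
    also have "\<dots> \<le> cmod (inverse c) * norm (c *\<^sub>C x)" by (rule le)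
    finally have "cmod c * norm x \<le> norm (c *\<^sub>C x)" using False
        by (simp add: norm_inverse norm_divide divide_simps mult.commute)
    then show ?thesis using le[of c x] by simp
  qed (simp add: scaleC_algebra)
qed

lemma norm_basis_le: "norm (basis i) \<le> 1"
proof (cases "i \<in> labels")
  case True
  have "(norm (basis i))\<^sup>2 = (\<Sum>\<^sub>\<infinity>j\<in>{i}. 1)"
    unfolding norm_sq by (rule infsum_cong_neutral) (auto simp: hcoeff_basis True)
  then show ?thesis by (simp add: power2_le_imp_le)
qed (simp add: basis_outside)

lemma cinner_basis: "cinner (basis i) x = hcoeff x i"
proof (cases "i \<in> labels")
  case True
  have "cinner (basis i) x = (\<Sum>\<^sub>\<infinity>j\<in>{i}. hcoeff x j)"
    unfolding cinner.rep_eq by (rule infsum_cong_neutral) (auto simp: hcoeff_basis True)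
  then show ?thesis by simp
qed (simp add: basis_outside hcoeff_outside cinner.rep_eq)

lemma cinner_basis_right: "cinner x (basis i) = cnj (hcoeff x i)"
  using cinner_commute[of x "basis i"] by (simp add: cinner_basis)

lemma cinner_scaleC_left: "cinner (c *\<^sub>C x) y = cnj c * cinner x y"
  by (simp add: cinner.rep_eq infsum_cmult_right' mult.assoc)

lemma cinner_zero_left: "cinner 0 y = 0"
  by (simp add: cinner.rep_eq)

lemma cinner_sum_left: "cinner (\<Sum>k\<in>A. f k) y = (\<Sum>k\<in>A. cinner (f k) y)"
  by (induction A rule: infinite_finite_induct) (auto simp: cinner_add_left cinner_zero_left)

lemma finite_basis_expansion:
  assumes "finite F" "\<And>i. i \<notin> F \<Longrightarrow> hcoeff x i = 0"
  shows "x = (\<Sum>i\<in>F. hcoeff x i *\<^sub>C basis i)"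
proof (rule hilb_eqI)
  fix j assume j: "j \<in> labels"
  have "(\<Sum>i\<in>F. hcoeff x i * (if j = i then 1 else 0)) = (\<Sum>i\<in>F. if j = i then hcoeff x i else 0)"
    by (intro sum.cong refl) simp
  also have "\<dots> = hcoeff x j"
    using assms(2)[of j] by (simp add: sum.delta'[OF assms(1)])
  finally have "(\<Sum>i\<in>F. hcoeff x i * (if j = i then 1 else 0)) = hcoeff x j" .
  then show "hcoeff x j = hcoeff (\<Sum>i\<in>F. hcoeff x i *\<^sub>C basis i) j"
    using j by (simp add: hcoeff_basis)
qed

section \<open>Enumerations of the basis\<close>

text \<open>The triple \<open>(n, k, e)\<close> encodes l = n + 1/2 and l + m = k, so each level has
  2l + 1 = 2n + 2 values of \<open>k\<close>.\<close>

definition label_index :: "(nat \<times> nat \<times> bool) set" where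
  "label_index = (SIGMA n:UNIV. {..<2 * n + 2} \<times> UNIV)"

definition label_of :: "nat \<times> nat \<times> bool \<Rightarrow> label" where
  "label_of = (\<lambda>(n, k, e). (real n + 1 / 2, real k - (real n + 1 / 2), e))"

lemma label_of_bij: "bij_betw label_of label_index labels"
proof (rule bij_betwI')
  fix x y assume "x \<in> label_index" "y \<in> label_index"
  then show "(label_of x = label_of y) = (x = y)"
    by (auto simp: label_of_def split: prod.splits)
next
  fix x assume "x \<in> label_index"
  then obtain n k e where x: "x = (n, k, e)" "k < 2 * n + 2" by (auto simp: label_index_def)
  have "real n + 1 / 2 - (real k - (real n + 1 / 2)) = real (2 * n + 1 - k)"
    using x(2) by (simp add: of_nat_diff)
  then have "real n + 1 / 2 - (real k - (real n + 1 / 2)) \<in> \<nat>" by (simp only: of_nat_in_Nats)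
  then show "label_of x \<in> labels"
    unfolding x label_of_def labels_def by simp
next
  fix i assume "i \<in> labels"
  then obtain l m e where i: "i = (l, m, e)" "l - 1 / 2 \<in> \<nat>" "l - m \<in> \<nat>" "l + m \<in> \<nat>"
    by (auto simp: labels_def)
  then obtain n x y where n: "l - 1 / 2 = real n" "l - m = real x" "l + m = real y"
    by (auto elim!: Nats_cases)
  have "real x + real y = real (2 * n + 1)" using n by (simp add: algebra_simps)
  then have "x + y = 2 * n + 1" by (metis of_nat_add of_nat_eq_iff)
  then have "y < 2 * n + 2" by simp
  moreover have "i = label_of (n, y, e)"
    using n unfolding i label_of_def by (simp add: algebra_simps)
  ultimately show "\<exists>x\<in>label_index. i = label_of x"
    unfolding label_index_def by blast
qed

text \<open>Replaces half-integers by naturals. The odd sum x + y = 2l is what later forces n > 0 in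
  the lowering steps.\<close>

lemma labels_cases:
  assumes "(l, m, e) \<in> labels"
  obtains n x y :: nat where "l = real n + 1 / 2" "l - m = real x" "l + m = real y" "x + y = 2 * n + 1"
proof -
  obtain n x y where n: "l - 1 / 2 = real n" "l - m = real x" "l + m = real y"
    using assms by (auto simp: labels_def elim!: Nats_cases)
  have "real x + real y = real (2 * n + 1)" using n by (simp add: algebra_simps)
  then have "x + y = 2 * n + 1" by (metis of_nat_add of_nat_eq_iff)
  then show thesis using n that[of n x y] by simp
qed

lemma countable_labels: "countable labels"
  using label_of_bij bij_betw_imp_surj_on
  by (metis countable_image countableI_type)

lemma infinite_labels: "infinite labels"
proof -
  have "infinite (range (\<lambda>n. (n, 0, True)) :: (nat \<times> nat \<times> bool) set)"
    by (rule range_inj_infinite) (auto simp: inj_def)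
  moreover have "range (\<lambda>n. (n, 0, True)) \<subseteq> label_index"
    by (auto simp: label_index_def)
  ultimately have "infinite label_index"
    using finite_subset by blast
  then show ?thesis using bij_betw_finite[OF label_of_bij] by simp
qed

text \<open>An enumeration in no particular order, for partial sums and nuclear series; sums by
  level use \<open>label_of\<close> instead.\<close>

definition label_seq :: "nat \<Rightarrow> label" where
  "label_seq = from_nat_into labels"

lemma label_seq_bij: "bij_betw label_seq UNIV labels"
  unfolding label_seq_def by (rule bij_betw_from_nat_into[OF countable_labels infinite_labels])

lemma label_seq_inj: "inj label_seq" and label_seq_range: "range label_seq = labels"
  using label_seq_bij by (auto simp: bij_betw_def)

lemma label_seq_in: "label_seq n \<in> labels"
  using label_seq_range by auto

lemma label_seq_sums:
  fixes f :: "label \<Rightarrow> 'a :: real_normed_vector"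
  assumes "(f has_sum s) labels" shows "(\<lambda>n. f (label_seq n)) sums s"
  using has_sum_imp_sums has_sum_reindex_bij_betw[OF label_seq_bij, of f] assms by blast

definition truncate :: "hilb \<Rightarrow> nat \<Rightarrow> hilb" where
  "truncate x N = (\<Sum>n<N. hcoeff x (label_seq n) *\<^sub>C basis (label_seq n))"

lemma hcoeff_truncate: "hcoeff (truncate x N) i = (if i \<in> label_seq ` {..<N} then hcoeff x i else 0)"
proof -
  have "hcoeff (truncate x N) i = (\<Sum>n<N. if i = label_seq n then hcoeff x i else 0)"
    unfolding truncate_def hcoeff_sum
    by (intro sum.cong refl) (auto simp: hcoeff_basis label_seq_in simp del: prod.collapse)
  also have "\<dots> = (if i \<in> label_seq ` {..<N} then hcoeff x i else 0)"
  proof (cases "i \<in> label_seq ` {..<N}")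
    case True
    then obtain k where k: "k < N" "i = label_seq k" by auto
    then have "(\<Sum>n<N. if i = label_seq n then hcoeff x i else 0) = (\<Sum>n<N. if n =
        k then hcoeff x i else 0)"
      using label_seq_inj by (intro sum.cong refl) (auto simp: inj_def)
    then show ?thesis using k True by simp
  next
    case False
    then show ?thesis by (auto intro!: sum.neutral)
  qed
  finally show ?thesis .
qed

lemma norm_truncate_le: "norm (truncate x N) \<le> norm x"
  using norm_le_coeff[of "truncate x N" 1 x] by (simp add: hcoeff_truncate)

lemma truncate_tendsto: "(\<lambda>N. truncate x N) \<longlonglongrightarrow> x"
proof -
  \<comment> \<open>The squared norm of the tail is the whole series minus a partial sum.\<close>
  have eq: "(norm (truncate x N - x))\<^sup>2 = (norm x)\<^sup>2 - (\<Sum>n<N. (cmod (hcoeff x (label_seq n)))\<^sup>2)" for N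
  proof -
    let ?F = "label_seq ` {..<N}"
    have F: "finite ?F" "?F \<subseteq> labels" using label_seq_in by auto
    have "(norm (truncate x N - x))\<^sup>2 = (\<Sum>\<^sub>\<infinity>i\<in>labels - ?F. (cmod (hcoeff x i))\<^sup>2)"
      unfolding norm_sq by (rule infsum_cong_neutral) (auto simp: hcoeff_truncate)
    also have "\<dots> = (norm x)\<^sup>2 - (\<Sum>\<^sub>\<infinity>i\<in>?F. (cmod (hcoeff x i))\<^sup>2)"
      unfolding norm_sq by (rule infsum_Diff[OF summable_norm_sq _ F(2)]) (use F in simp)
    also have "(\<Sum>\<^sub>\<infinity>i\<in>?F. (cmod (hcoeff x i))\<^sup>2) = (\<Sum>n<N. (cmod (hcoeff x (label_seq n)))\<^sup>2)"
      using F by (simp add: sum.reindex[OF inj_on_subset[OF label_seq_inj subset_UNIV]])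
    finally show ?thesis .
  qed
  have "((\<lambda>i. (cmod (hcoeff x i))\<^sup>2) has_sum (norm x)\<^sup>2) labels"
    unfolding norm_sq by (rule has_sum_infsum[OF summable_norm_sq])
  from label_seq_sums[OF this] have "(\<lambda>N. \<Sum>n<N. (cmod (hcoeff x (label_seq n)))\<^sup>2) \<longlonglongrightarrow> (norm x)\<^sup>2"
    by (simp add: sums_def)
  then have "(\<lambda>N. (norm x)\<^sup>2 - (\<Sum>n<N. (cmod (hcoeff x (label_seq n)))\<^sup>2)) \<longlonglongrightarrow> (norm x)\<^sup>2 - (norm x)\<^sup>2"
    by (intro tendsto_intros)
  then have "(\<lambda>N. (norm (truncate x N - x))\<^sup>2) \<longlonglongrightarrow> 0" by (simp add: eq)
  then have "(\<lambda>N. sqrt ((norm (truncate x N - x))\<^sup>2)) \<longlonglongrightarrow> sqrt 0"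
    by (rule tendsto_real_sqrt)
  then show ?thesis by (simp add: LIM_zero_iff tendsto_norm_zero_iff)
qed

section \<open>Operators seen on finitely supported vectors\<close>

definition finsupp :: "hilb \<Rightarrow> bool" where
  "finsupp x \<longleftrightarrow> finite {i. hcoeff x i \<noteq> 0}"

lemma finsupp_0 [simp]: "finsupp 0"
  by (simp add: finsupp_def)

lemma finsupp_add: "finsupp x \<Longrightarrow> finsupp y \<Longrightarrow> finsupp (x + y)"
  unfolding finsupp_def by (rule finite_subset[of _ "{i. hcoeff x i \<noteq> 0} \<union> {i. hcoeff y i \<noteq> 0}"]) auto

lemma finsupp_scale: "finsupp x \<Longrightarrow> finsupp (c *\<^sub>C x)"
  unfolding finsupp_def by (rule finite_subset[of _ "{i. hcoeff x i \<noteq> 0}"]) auto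

lemma finsupp_ket [simp]: "finsupp (ket l m e)"
  unfolding finsupp_def by (rule finite_subset[of _ "{(l, m, e)}"]) (auto simp: hcoeff_ket)

lemma finsupp_sum: "(\<And>k. k \<in> A \<Longrightarrow> finsupp (f k)) \<Longrightarrow> finsupp (\<Sum>k\<in>A. f k)"
  by (induction A rule: infinite_finite_induct) (auto intro: finsupp_add)

lemma finsupp_expansion:
  "finsupp x \<Longrightarrow> x = (\<Sum>i\<in>{i. hcoeff x i \<noteq> 0}. hcoeff x i *\<^sub>C basis i)"
  unfolding finsupp_def by (rule finite_basis_expansion) auto

text \<open>All that is kept of an unbounded operator besides its matrix. The property passes to
  sums, multiples, compositions and \<open>conj_J\<close> without any study of domains.\<close>

definition finlin :: "oper \<Rightarrow> bool" where
  "finlin T \<longleftrightarrow> (\<forall>x. finsupp x \<longrightarrow> (\<exists>y. T x = Some y \<and> finsupp y)) \<and>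
     (\<forall>x y. finsupp x \<longrightarrow> finsupp y \<longrightarrow> the (T (x + y)) = the (T x) + the (T y)) \<and>
     (\<forall>c x. finsupp x \<longrightarrow> the (T (c *\<^sub>C x)) = c *\<^sub>C the (T x))"

lemma finlinD:
  assumes "finlin T" "finsupp x"
  shows "T x = Some (the (T x))" "finsupp (the (T x))" "x \<in> dom T"
    "finsupp y \<Longrightarrow> the (T (x + y)) = the (T x) + the (T y)" "the (T (c *\<^sub>C x)) = c *\<^sub>C the (T x)"
  using assms unfolding finlin_def by fastforce+

lemma finlin_zero: "finlin T \<Longrightarrow> the (T 0) = 0"
  using finlinD(5)[of T 0 0] by (simp add: scaleC_algebra)

lemma dom_basis_op:
  "x \<in> dom (basis_op v) \<longleftrightarrow> (\<forall>i. (\<lambda>j. hcoeff x j * hcoeff (v j) i) summable_on labels) \<and>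
     ell2 (\<lambda>i. \<Sum>\<^sub>\<infinity>j\<in>labels. hcoeff x j * hcoeff (v j) i)"
  by (auto simp: basis_op_def Let_def split: if_splits)

lemma hcoeff_basis_op:
  "x \<in> dom (basis_op v) \<Longrightarrow> hcoeff (the (basis_op v x)) i = (\<Sum>\<^sub>\<infinity>j\<in>labels. hcoeff x j * hcoeff (v j) i)"
  unfolding dom_basis_op by (simp add: basis_op_def Let_def hcoeff_hvec)

lemma basis_op_eqI:
  assumes "\<And>i. ((\<lambda>j. hcoeff x j * hcoeff (v j) i) has_sum hcoeff y i) labels"
  shows "basis_op v x = Some y"
proof -
  have s: "(\<lambda>j. hcoeff x j * hcoeff (v j) i) summable_on labels" for i
    using assms by (rule has_sum_imp_summable)
  have "(\<lambda>i. \<Sum>\<^sub>\<infinity>j\<in>labels. hcoeff x j * hcoeff (v j) i) = hcoeff y"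
    using assms by (intro ext infsumI)
  then show ?thesis
    by (simp add: basis_op_def Let_def s ell2_hcoeff hcoeff_inverse)
qed

lemma basis_op_cong:
  assumes "\<And>i. i \<in> labels \<Longrightarrow> v i = u i"
  shows "basis_op v = basis_op u"
proof -
  have "(\<lambda>j. hcoeff x j * hcoeff (v j) i) summable_on
      labels \<longleftrightarrow> (\<lambda>j. hcoeff x j * hcoeff (u j) i) summable_on labels" for x i
    using assms by (intro summable_on_cong) simp
  moreover have "(\<Sum>\<^sub>\<infinity>j\<in>labels. hcoeff x j * hcoeff (v j) i) =
      (\<Sum>\<^sub>\<infinity>j\<in>labels. hcoeff x j * hcoeff (u j) i)" for x i
    using assms by (intro infsum_cong) simp
  ultimately show ?thesis by (simp add: basis_op_def fun_eq_iff)
qed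

lemma basis_op_has_sum:
  assumes "x \<in> dom (basis_op v)"
  shows "((\<lambda>j. hcoeff x j * hcoeff (v j) i) has_sum hcoeff (the (basis_op v x)) i) labels"
  unfolding hcoeff_basis_op[OF assms] using assms unfolding dom_basis_op
      by (blast intro: has_sum_infsum)

lemma clinear_basis_op: "clinear_op (basis_op v)"
  unfolding clinear_op_def
proof (intro conjI ballI allI)
  show "basis_op v 0 = Some 0" by (rule basis_op_eqI) simp
  fix x y a b assume x: "x \<in> dom (basis_op v)" and y: "y \<in> dom (basis_op v)"
  have "((\<lambda>j. a * (hcoeff x j * hcoeff (v j) i) + b * (hcoeff y j * hcoeff (v j) i)) has_sum
      (a * hcoeff (the (basis_op v x)) i + b * hcoeff (the (basis_op v y)) i)) labels" for i
    by (intro has_sum_add has_sum_cmult_right basis_op_has_sum x y)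
  then show "basis_op v (a *\<^sub>C x + b *\<^sub>C y) = Some (a *\<^sub>C the (basis_op v x) +
      b *\<^sub>C the (basis_op v y))"
    by (intro basis_op_eqI) (simp add: distrib_right mult.assoc)
qed

lemma basis_op_finsupp:
  assumes "finite F" "\<And>i. i \<notin> F \<Longrightarrow> hcoeff x i = 0"
  shows "basis_op v x = Some (\<Sum>j\<in>F. hcoeff x j *\<^sub>C v j)"
proof (rule basis_op_eqI)
  fix i
  have "((\<lambda>j. hcoeff x j * hcoeff (v j) i) has_sum (\<Sum>j\<in>F. hcoeff x j * hcoeff (v j) i)) F"
    using assms(1) by (rule has_sum_finite)
  then have "((\<lambda>j. hcoeff x j * hcoeff (v j) i) has_sum (\<Sum>j\<in>F. hcoeff x j * hcoeff (v j) i)) labels"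
    by (rule has_sum_cong_neutral[THEN iffD1, rotated -1]) (use assms(2) hcoeff_outside in auto)
  then show "((\<lambda>j. hcoeff x j * hcoeff (v j) i) has_sum hcoeff (\<Sum>j\<in>F. hcoeff x j *\<^sub>C v j) i) labels"
    by simp
qed

lemma basis_op_basis: "i \<in> labels \<Longrightarrow> basis_op v (basis i) = Some (v i)"
  using basis_op_finsupp[of "{i}" "basis i" v] by (simp add: hcoeff_basis scaleC_algebra)

lemma finlin_basis_op:
  assumes "\<And>i. i \<in> labels \<Longrightarrow> finsupp (v i)"
  shows "finlin (basis_op v)"
proof -
  have *: "\<exists>y. basis_op v x = Some y \<and> finsupp y" if x: "finsupp x" for x
  proof -
    have "basis_op v x = Some (\<Sum>j\<in>{i. hcoeff x i \<noteq> 0}. hcoeff x j *\<^sub>C v j)"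
      using x by (intro basis_op_finsupp) (auto simp: finsupp_def)
    moreover have "finsupp (\<Sum>j\<in>{i. hcoeff x i \<noteq> 0}. hcoeff x j *\<^sub>C v j)"
    proof (intro finsupp_sum finsupp_scale assms)
      fix k assume "k \<in> {i. hcoeff x i \<noteq> 0}"
      then show "k \<in> labels" using hcoeff_outside by blast
    qed
    ultimately show ?thesis by blast
  qed
  have lin: "the (basis_op v (a *\<^sub>C x + b *\<^sub>C y)) = a *\<^sub>C the (basis_op v x) + b *\<^sub>C the (basis_op v y)"
    if "finsupp x" "finsupp y" for a b x y
  proof -
    have "x \<in> dom (basis_op v)" "y \<in> dom (basis_op v)" using *[OF that(1)] *[OF that(2)] by blast+
    then have "basis_op v (a *\<^sub>C x + b *\<^sub>C y) = Some (a *\<^sub>C the (basis_op v x) +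
        b *\<^sub>C the (basis_op v y))"
      using clinear_basis_op[of v] unfolding clinear_op_def by blast
    then show ?thesis by simp
  qed
  show ?thesis
    unfolding finlin_def using * lin[of _ _ 1 1] lin[of _ 0 _ 0] by (auto simp: scaleC_algebra)
qed

text \<open>On the whole maximal domain the coordinate of \<open>basis_op v x\<close> at
  \<open>i\<close> is the pairing of \<open>u i\<close> with \<open>x\<close>; pairing with a
  finitely supported \<open>y\<close> gives a finite sum of these. The adjoint vector is unique
  because the domain contains every basis vector.\<close>

lemma op_adj_basis_op:
  assumes adj: "\<And>i j. i \<in> labels \<Longrightarrow> j \<in> labels \<Longrightarrow> hcoeff (u i) j = cnj (hcoeff (v j) i)"
    and y: "finsupp y"
  shows "op_adj (basis_op v) y = basis_op u y"
proof -
  define S where "S = {i. hcoeff y i \<noteq> 0}"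
  have S: "finite S" "S \<subseteq> labels" using y hcoeff_outside unfolding S_def finsupp_def by blast+
  define z where "z = (\<Sum>i\<in>S. hcoeff y i *\<^sub>C u i)"
  have bu: "basis_op u y = Some z"
    unfolding z_def using S by (intro basis_op_finsupp) (auto simp: S_def)
  have adj_z: "cinner y (the (basis_op v x)) = cinner z x" if x: "x \<in> dom (basis_op v)" for x
  proof -
    have "hcoeff (the (basis_op v x)) i = cinner (u i) x" if i: "i \<in> S" for i
    proof -
      have "(\<Sum>\<^sub>\<infinity>j\<in>labels. hcoeff x j * hcoeff (v j) i) =
          (\<Sum>\<^sub>\<infinity>j\<in>labels. cnj (hcoeff (u i) j) * hcoeff x j)"
        using S i by (intro infsum_cong) (auto simp: adj subsetD)
      then show ?thesis by (simp add: hcoeff_basis_op[OF x] cinner.rep_eq)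
    qed
    moreover have "y = (\<Sum>i\<in>S. hcoeff y i *\<^sub>C basis i)"
      unfolding S_def using y by (rule finsupp_expansion)
    then have "cinner y (the (basis_op v x)) = (\<Sum>i\<in>S. cnj (hcoeff y i) * hcoeff (the (basis_op v x)) i)"
      by (metis (no_types, lifting) cinner_basis cinner_scaleC_left cinner_sum_left sum.cong)
    ultimately show ?thesis
      unfolding z_def by (simp add: cinner_sum_left cinner_scaleC_left)
  qed
  have "z' = z" if z': "\<forall>x\<in>dom (basis_op v). cinner y (the (basis_op v x)) = cinner z' x" for z'
  proof (rule hilb_eqI)
    fix j assume "j \<in> labels"
    then have "basis j \<in> dom (basis_op v)" using basis_op_basis by blast
    then have "cinner z' (basis j) = cinner z (basis j)" using z' adj_z by metis
    then show "hcoeff z' j = hcoeff z j" by (simp add: cinner_basis_right)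
  qed
  then have "(THE z. \<forall>x\<in>dom (basis_op v). cinner y (the (basis_op v x)) = cinner z x) = z"
    using adj_z by (intro the_equality) blast+
  then show ?thesis
    unfolding op_adj_def bu using adj_z by auto
qed

section \<open>The real structure J\<close>

definition reflect :: "label \<Rightarrow> label" where
  "reflect i = (fst i, - fst (snd i), \<not> snd (snd i))"

lemma reflect_reflect [simp]: "reflect (reflect i) = i"
  by (simp add: reflect_def)

lemma reflect_labels [simp]: "reflect i \<in> labels \<longleftrightarrow> i \<in> labels"
  by (auto simp: reflect_def labels_def)

definition phase :: "real \<Rightarrow> complex" where
  "phase m = \<i> powr complex_of_real (2 * m)"

lemma phase_cis: "phase m = cis (pi * m)"
  by (simp add: phase_def powr_def cis_conv_exp mult_ac)

lemma phase_simps: "phase (a + b) = phase a * phase b" "cnj (phase a) = phase (- a)" "cmod (phase a) =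
    1"
  "phase a * phase (- a) = 1"
  by (simp_all add: phase_cis cis_mult distrib_left cis_cnj)

text \<open>2m is odd, so i^(4m) = -1. This sign is the origin of J^2 = -1.\<close>

lemma phase_sq:
  assumes "i \<in> labels" shows "phase (fst (snd i)) * phase (fst (snd i)) = - 1"
proof -
  have "(fst i, fst (snd i), snd (snd i)) \<in> labels" using assms by simp
  then obtain n x y :: nat where l: "fst i = real n + 1 / 2" "fst i - fst (snd i) = real x"
    by (rule labels_cases)
  have "phase (fst (snd i)) * phase (fst (snd i)) = cis (pi + 2 * pi * (real n - real x))"
  proof -
    have m: "fst (snd i) = real n + 1 / 2 - real x" using l by linarith
    show ?thesis unfolding m by (simp add: phase_cis cis_mult algebra_simps)
  qed
  also have "\<dots> = cis pi * cis (2 * pi * (real n - real x))" by (simp only: cis_mult)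
  also have "cis (2 * pi * (real n - real x)) = 1" by (rule cis_multiple_2pi) auto
  finally show ?thesis by simp
qed

text \<open>Only the label \<open>reflect i\<close> feeds the coordinate \<open>i\<close>. Its
  second entry is -m, hence the sign in the phase; antilinearity conjugates the coordinate.\<close>

lemma hcoeff_op_J:
  assumes i: "i \<in> labels"
  shows "hcoeff (op_J x) i = phase (- fst (snd i)) * cnj (hcoeff x (reflect i))"
proof -
  have "ell2 (\<lambda>i. cnj (hcoeff x i))"
    using ell2_hcoeff[of x] by (simp add: ell2_def)
  then have hconj: "hcoeff (hconj x) i = cnj (hcoeff x i)" for i
    by (simp add: hconj_def hcoeff_hvec)
  define y where "y i = (if i \<in> labels then phase (- fst (snd i)) *
      cnj (hcoeff x (reflect i)) else 0)" for i
  have "ell2 y"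
  proof (rule bounded_sums_ell2(1))
    fix F assume F: "finite F" "F \<subseteq> labels"
    have inj: "inj_on reflect F" by (metis inj_onI reflect_reflect)
    have "(\<Sum>i\<in>F. (cmod (y i))\<^sup>2) = (\<Sum>i\<in>F. (cmod (hcoeff x (reflect i)))\<^sup>2)"
      using F by (intro sum.cong refl) (auto simp: y_def norm_mult phase_simps)
    also have "\<dots> = (\<Sum>i\<in>reflect ` F. (cmod (hcoeff x i))\<^sup>2)"
      by (simp add: sum.reindex[OF inj])
    also have "\<dots> \<le> (norm x)\<^sup>2" using F by (intro sum_le_norm_sq) auto
    finally show "(\<Sum>i\<in>F. (cmod (y i))\<^sup>2) \<le> (norm x)\<^sup>2" .
  qed (auto simp: y_def)
  then have hy: "hcoeff (hvec y) = y" by (rule hcoeff_hvec)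
  define V where "V = (\<lambda>(l, m, e). (\<i> powr complex_of_real (2*m)) *\<^sub>C ket l (-m) (\<not> e))"
  have v: "hcoeff (V j) i = (if j = reflect i \<and> i \<in> labels then phase (- fst (snd i)) else 0)" for i j
    by (cases i; cases j) (auto simp: V_def reflect_def hcoeff_ket phase_def)
  have "basis_op V (hconj x) = Some (hvec y)"
  proof (rule basis_op_eqI)
    fix i
    show "((\<lambda>j. hcoeff (hconj x) j * hcoeff (V j) i) has_sum hcoeff (hvec y) i) labels"
    proof (cases "i \<in> labels")
      case True
      have "((\<lambda>j. hcoeff (hconj x) j * hcoeff (V j) i) has_sum
          (\<Sum>j\<in>{reflect i}. hcoeff (hconj x) j * hcoeff (V j) i)) {reflect i}"
        by (rule has_sum_finite) simp
      then have "((\<lambda>j. hcoeff (hconj x) j * hcoeff (V j) i) has_sum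
          (\<Sum>j\<in>{reflect i}. hcoeff (hconj x) j * hcoeff (V j) i)) labels"
        by (rule has_sum_cong_neutral[THEN iffD1, rotated -1]) (use True in \<open>auto simp: v simp del:
            split_paired_All\<close>)
      moreover have "(\<Sum>j\<in>{reflect i}. hcoeff (hconj x) j * hcoeff (V j) i) = y i"
        using True by (simp add: v hconj y_def mult.commute)
      ultimately show ?thesis by (simp add: hy)
    next
      case False
      then show ?thesis by (simp add: v hy y_def)
    qed
  qed
  then show ?thesis using i unfolding op_J_def V_def[symmetric] by (simp add: hy y_def)
qed

lemma op_J_add: "op_J (x + y) = op_J x + op_J y"
  by (rule hilb_eqI) (simp add: hcoeff_op_J distrib_left)

lemma op_J_scale: "op_J (c *\<^sub>C x) = cnj c *\<^sub>C op_J x"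
  by (rule hilb_eqI) (simp add: hcoeff_op_J)

lemma op_J_op_J: "op_J (op_J x) = - x"
proof (rule hilb_eqI)
  fix i assume i: "i \<in> labels"
  have "hcoeff (op_J (op_J x)) i = phase (- fst (snd i)) * cnj (phase (fst (snd i)) * cnj (hcoeff x i))"
    using i by (simp add: hcoeff_op_J) (simp add: reflect_def)
  also have "\<dots> = cnj (phase (fst (snd i)) * phase (fst (snd i))) * hcoeff x i"
    by (simp add: phase_simps)
  also have "\<dots> = hcoeff (- x) i"
    unfolding phase_sq[OF i] by simp
  finally show "hcoeff (op_J (op_J x)) i = hcoeff (- x) i" .
qed

lemma op_J_minus: "op_J (- x) = - op_J x"
  using op_J_scale[of "-1" x] by (simp add: scaleC_algebra)

text \<open>From J^2 = -1; it rewrites the inverse that occurs in \<open>conj_J\<close>.\<close>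

lemma inv_op_J: "inv op_J x = - op_J x"
proof (rule inv_f_eq)
  show "inj op_J" by (rule injI) (metis op_J_op_J neg_equal_iff_equal)
  show "op_J (- op_J x) = x" by (simp add: op_J_minus op_J_op_J)
qed

lemma op_J_basis: "i \<in> labels \<Longrightarrow> op_J (basis i) = phase (fst (snd i)) *\<^sub>C basis (reflect i)"
proof (rule hilb_eqI)
  fix k assume i: "i \<in> labels" and k: "k \<in> labels"
  have r: "reflect k = i \<longleftrightarrow> k = reflect i" by (metis reflect_reflect)
  have "hcoeff (op_J (basis i)) k = (if k = reflect i then phase (- fst (snd k)) else 0)"
    using i k unfolding hcoeff_op_J[OF k] hcoeff_basis r by simp
  also have "\<dots> = hcoeff (phase (fst (snd i)) *\<^sub>C basis (reflect i)) k"
    using k unfolding hcoeff_simps hcoeff_basis by (simp add: reflect_def)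
  finally show "hcoeff (op_J (basis i)) k = hcoeff (phase (fst (snd i)) *\<^sub>C basis (reflect i)) k" .
qed

lemma finsupp_op_J:
  assumes "finsupp x" shows "finsupp (op_J x)"
proof -
  have "{i. hcoeff (op_J x) i \<noteq> 0} \<subseteq> reflect ` {i. hcoeff x i \<noteq> 0}"
  proof
    fix i assume i: "i \<in> {i. hcoeff (op_J x) i \<noteq> 0}"
    then have "i \<in> labels" using hcoeff_outside by blast
    then have "hcoeff x (reflect i) \<noteq> 0" using i by (auto simp: hcoeff_op_J)
    then show "i \<in> reflect ` {i. hcoeff x i \<noteq> 0}" by (metis (mono_tags) imageI mem_Collect_eq
        reflect_reflect)
  qed
  then show ?thesis using assms finite_subset unfolding finsupp_def by blast
qed

lemma finlin_conj_J:
  assumes "finlin T" shows "finlin (conj_J T)"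
proof -
  have f: "finsupp (- op_J x)" if "finsupp x" for x
    using finsupp_scale[OF finsupp_op_J[OF that], of "-1"] by (simp add: scaleC_algebra)
  have c: "conj_J T x = Some (op_J (the (T (- op_J x))))" if "finsupp x" for x
    using finlinD(1)[OF assms f[OF that]] unfolding conj_J_def inv_op_J by (metis option.simps(9))
  have 1: "the (conj_J T (x + y)) = the (conj_J T x) + the (conj_J T y)" if "finsupp x" "finsupp y"
      for x y
    using finlinD(4)[OF assms f f, of x y] that
    by (simp add: c finsupp_add op_J_add)
  \<comment> \<open>J acts twice, so the scalar is conjugated twice.\<close>
  have 2: "the (conj_J T (a *\<^sub>C x)) = a *\<^sub>C the (conj_J T x)" if "finsupp x" for a x
  proof -
    have "- op_J (a *\<^sub>C x) = cnj a *\<^sub>C (- op_J x)"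
      unfolding op_J_scale by (rule hilb_eqI) simp
    then show ?thesis
      using finlinD(5)[OF assms f[OF that]] that by (simp add: c finsupp_scale op_J_scale)
  qed
  show ?thesis
    unfolding finlin_def using c 1 2 finlinD(2)[OF assms f] finsupp_op_J by blast
qed

lemma finlin_op_add:
  assumes "finlin S" "finlin T" shows "finlin (op_add S T)"
proof -
  have "op_add S T x = Some (the (S x) + the (T x))" if "finsupp x" for x
    using finlinD(3)[OF assms(1) that] finlinD(3)[OF assms(2) that] by (simp add: op_add_def)
  then show ?thesis
    using assms unfolding finlin_def
    by (auto simp: finsupp_add finsupp_scale scaleC_algebra) (metis finsupp_add option.sel)
qed

lemma finlin_op_scale:
  assumes "finlin T" shows "finlin (op_scale c T)"
proof -
  have "op_scale c T x = Some (c *\<^sub>C the (T x))" if "finsupp x" for x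
    using finlinD(1)[OF assms that] unfolding op_scale_def by (metis option.simps(9))
  then show ?thesis
    using assms unfolding finlin_def
    by (auto simp: finsupp_add finsupp_scale scaleC_algebra mult.commute)
qed

lemma finlin_comp:
  assumes "finlin S" "finlin T" shows "finlin (S \<circ>\<^sub>m T)"
proof -
  have c: "(S \<circ>\<^sub>m T) x = S (the (T x))" if "finsupp x" for x
    using finlinD(1)[OF assms(2) that] unfolding map_comp_def by (metis option.simps(5))
  have f: "finsupp (the (T x))" if "finsupp x" for x
    using finlinD(2)[OF assms(2) that] .
  show ?thesis
    unfolding finlin_def
  proof (intro conjI allI impI)
    show "\<exists>y. (S \<circ>\<^sub>m T) x = Some y \<and> finsupp y" if "finsupp x" for x
      using finlinD(1,2)[OF assms(1) f[OF that]] c[OF that] by metis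
  qed (simp_all add: c f finsupp_add finsupp_scale finlinD(4,5)[OF assms(1)] finlinD(4,5)[OF assms(2)])
qed

section \<open>Diagonal operators, bounded operators and traces\<close>

text \<open>The powers of |D| and the Sobolev weights are all of this form, on their maximal
  domains.\<close>

definition diag_op :: "(label \<Rightarrow> complex) \<Rightarrow> oper" where
  "diag_op d = basis_op (\<lambda>i. d i *\<^sub>C basis i)"

lemma diag_op_has_sum:
  "((\<lambda>j. hcoeff x j * hcoeff (d j *\<^sub>C basis j) i) has_sum (d i * hcoeff x i)) labels"
proof (cases "i \<in> labels")
  case True
  have "((\<lambda>j. hcoeff x j * hcoeff (d j *\<^sub>C basis j) i) has_sum
      (\<Sum>j\<in>{i}. hcoeff x j * hcoeff (d j *\<^sub>C basis j) i)) {i}"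
    by (rule has_sum_finite) simp
  then have "((\<lambda>j. hcoeff x j * hcoeff (d j *\<^sub>C basis j) i) has_sum
      (\<Sum>j\<in>{i}. hcoeff x j * hcoeff (d j *\<^sub>C basis j) i)) labels"
    by (rule has_sum_cong_neutral[THEN iffD1, rotated -1]) (use True in \<open>auto simp: hcoeff_basis simp
        del: split_paired_All\<close>)
  also have "(\<Sum>j\<in>{i}. hcoeff x j * hcoeff (d j *\<^sub>C basis j) i) = d i * hcoeff x i"
    using True hcoeff_basis[of i i] by simp
  finally show ?thesis .
next
  case False
  then show ?thesis by (simp add: hcoeff_outside hcoeff_basis)
qed

lemma dom_diag_op: "x \<in> dom (diag_op d) \<longleftrightarrow> ell2 (\<lambda>i. d i * hcoeff x i)"
proof -
  have "(\<lambda>j. hcoeff x j * hcoeff (d j *\<^sub>C basis j) i) summable_on labels" for i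
    using diag_op_has_sum by (rule has_sum_imp_summable)
  moreover have "(\<Sum>\<^sub>\<infinity>j\<in>labels. hcoeff x j * hcoeff (d j *\<^sub>C basis j) i) = d i * hcoeff x i" for i
    using diag_op_has_sum by (rule infsumI)
  ultimately show ?thesis unfolding diag_op_def dom_basis_op by simp
qed

lemma hcoeff_diag_op:
  assumes "x \<in> dom (diag_op d)" shows "hcoeff (the (diag_op d x)) i = d i * hcoeff x i"
  using hcoeff_basis_op[OF assms[unfolded diag_op_def]] infsumI[OF diag_op_has_sum]
  unfolding diag_op_def by simp

lemma diag_op_basis: "i \<in> labels \<Longrightarrow> diag_op d (basis i) = Some (d i *\<^sub>C basis i)"
  unfolding diag_op_def by (rule basis_op_basis)

lemma finlin_diag_op: "finlin (diag_op d)"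
  unfolding diag_op_def by (intro finlin_basis_op finsupp_scale finsupp_ket)

lemma clinear_diag_op: "clinear_op (diag_op d)"
  unfolding diag_op_def by (rule clinear_basis_op)

lemma ell2_mono:
  assumes "ell2 y" "\<And>i. i \<in> labels \<Longrightarrow> cmod (x i) \<le> C * cmod (y i)" "\<And>i. i \<notin> labels \<Longrightarrow> x i = 0"
  shows "ell2 x"
proof -
  have "(\<lambda>i. C\<^sup>2 * (cmod (y i))\<^sup>2) summable_on labels"
    using assms(1) unfolding ell2_def by (intro summable_on_cmult_right) blast
  then have "(\<lambda>i. (cmod (x i))\<^sup>2) summable_on labels"
  proof (rule summable_on_comparison_test)
    fix i assume "i \<in> labels"
    then have "(cmod (x i))\<^sup>2 \<le> (C * cmod (y i))\<^sup>2" by (intro power_mono assms) auto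
    then show "(cmod (x i))\<^sup>2 \<le> C\<^sup>2 * (cmod (y i))\<^sup>2" by (simp add: power_mult_distrib)
  qed simp
  then show ?thesis using assms(3) unfolding ell2_def by blast
qed

lemma bounded_diag_op:
  assumes "\<And>i. i \<in> labels \<Longrightarrow> cmod (d i) \<le> C" "C \<ge> 0"
  shows "dom (diag_op d) = UNIV" "norm (the (diag_op d x)) \<le> C * norm x"
proof -
  have "x \<in> dom (diag_op d)" for x
    unfolding dom_diag_op
  proof (rule ell2_mono[OF ell2_hcoeff[of x]])
    show "cmod (d i * hcoeff x i) \<le> C * cmod (hcoeff x i)" if "i \<in> labels" for i
      unfolding norm_mult using assms(1)[OF that] by (rule mult_right_mono) simp
  qed (simp add: hcoeff_outside)
  then show u: "dom (diag_op d) = UNIV" by blast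
  show "norm (the (diag_op d x)) \<le> C * norm x"
  proof (rule norm_le_coeff[OF _ assms(2)])
    show "cmod (hcoeff (the (diag_op d x)) i) \<le> C * cmod (hcoeff x i)" if "i \<in> labels" for i
    proof -
      have "x \<in> dom (diag_op d)" using u by blast
      from hcoeff_diag_op[OF this] show ?thesis
        using mult_right_mono[OF assms(1)[OF that] norm_ge_zero[of "hcoeff x i"]]
            by (simp add: norm_mult)
    qed
  qed
qed

lemma clinear_op_simps:
  assumes "clinear_op T" "x \<in> dom T" "y \<in> dom T"
  shows "the (T (x + y)) = the (T x) + the (T y)" "the (T (c *\<^sub>C x)) = c *\<^sub>C the (T x)"
    "the (T (x - y)) = the (T x) - the (T y)" "x + y \<in> dom T" "c *\<^sub>C x \<in> dom T" "x - y \<in> dom T"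
proof -
  have *: "T (a *\<^sub>C x + b *\<^sub>C y) = Some (a *\<^sub>C the (T x) + b *\<^sub>C the (T y))" for a b
    using assms unfolding clinear_op_def by blast
  have e: "1 *\<^sub>C x + 1 *\<^sub>C y = x + y" "c *\<^sub>C x + 0 *\<^sub>C y = c *\<^sub>C x" "1 *\<^sub>C x + (- 1) *\<^sub>C y = x - y"
      for x y :: hilb
    by (simp_all add: scaleC_algebra)
  show "the (T (x + y)) = the (T x) + the (T y)" "x + y \<in> dom T"
    using *[of 1 1] unfolding e by auto
  show "the (T (c *\<^sub>C x)) = c *\<^sub>C the (T x)" "c *\<^sub>C x \<in> dom T"
    using *[of c 0] unfolding e by auto
  show "the (T (x - y)) = the (T x) - the (T y)" "x - y \<in> dom T"
    using *[of 1 "- 1"] unfolding e by auto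
qed

lemma clinear_op_sum:
  assumes T: "clinear_op T" and d: "\<And>k. k \<in> A \<Longrightarrow> f k \<in> dom T" and "finite A"
  shows "the (T (\<Sum>k\<in>A. f k)) = (\<Sum>k\<in>A. the (T (f k)))" "(\<Sum>k\<in>A. f k) \<in> dom T"
  using assms(3) d
proof (induction A)
  case empty
  {
    case 1 then show ?case using T by (simp add: clinear_op_def)
  next
    case 2 then show ?case using T by (auto simp: clinear_op_def)
  }
next
  case (insert k A)
  {
    case 1 then show ?case using insert clinear_op_simps(1)[OF T] by simp
  next
    case 2 then show ?case using insert clinear_op_simps(4)[OF T] by simp
  }
qed

lemma bounded_opE:
  assumes "bounded_op T"
  obtains C where "C \<ge> 0" "\<And>x. norm (the (T x)) \<le> C * norm x" "clinear_op T" "dom T = UNIV"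
proof -
  obtain C where C: "\<And>x. norm (the (T x)) \<le> C * norm x"
    using assms unfolding bounded_op_def by blast
  have "norm (the (T x)) \<le> \<bar>C\<bar> * norm x" for x
    using order_trans[OF C[of x] mult_right_mono[OF abs_ge_self norm_ge_zero]] .
  then show thesis using that[of "\<bar>C\<bar>"] assms unfolding bounded_op_def by simp
qed

text \<open>Truncations converge in norm and \<open>T\<close> is Lipschitz, so a bounded operator is
  determined by its values on basis vectors.\<close>

lemma bounded_op_truncate:
  assumes "bounded_op T"
  shows "(\<lambda>N. the (T (truncate x N))) \<longlonglongrightarrow> the (T x)"
    "the (T (truncate x N)) = (\<Sum>n<N. hcoeff x (label_seq n) *\<^sub>C the (T (basis (label_seq n))))"
proof -
  obtain C where C: "C \<ge> 0" "\<And>x. norm (the (T x)) \<le> C * norm x" "clinear_op T" "dom T = UNIV"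
    using assms by (rule bounded_opE) blast
  have le: "norm (the (T (truncate x N)) - the (T x)) \<le> C * norm (truncate x N - x)" for N
    using C(2)[of "truncate x N - x"] clinear_op_simps(3)[OF C(3)] C(4) by simp
  have "(\<lambda>N. norm (truncate x N - x)) \<longlonglongrightarrow> 0"
    by (rule tendsto_norm_zero[OF LIM_zero[OF truncate_tendsto]])
  then have lim: "(\<lambda>N. C * norm (truncate x N - x)) \<longlonglongrightarrow> 0"
    by (rule tendsto_mult_right_zero)
  have "(\<lambda>N. the (T (truncate x N)) - the (T x)) \<longlonglongrightarrow> 0"
    by (rule Lim_null_comparison[OF always_eventually[OF allI[OF le]] lim])
  then show "(\<lambda>N. the (T (truncate x N))) \<longlonglongrightarrow> the (T x)" by (rule LIM_zero_cancel)
  show "the (T (truncate x N)) = (\<Sum>n<N. hcoeff x (label_seq n) *\<^sub>C the (T (basis (label_seq n))))"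
  proof -
    have "the (T (c *\<^sub>C y)) = c *\<^sub>C the (T y)" for c y
      using clinear_op_simps(2)[OF C(3), of y y c] C(4) by simp
    then show ?thesis
      unfolding truncate_def by (subst clinear_op_sum(1)[OF C(3)]) (simp_all add: C(4))
  qed
qed

lemma bounded_op_eqI:
  assumes "bounded_op S" "bounded_op T" "\<And>i. i \<in> labels \<Longrightarrow> S (basis i) = T (basis i)"
  shows "S = T"
proof
  fix x
  have "the (S (truncate x N)) = the (T (truncate x N))" for N
    unfolding bounded_op_truncate(2)[OF assms(1)] bounded_op_truncate(2)[OF assms(2)]
    using assms(3)[OF label_seq_in] by simp
  then have "the (S x) = the (T x)"
    using bounded_op_truncate(1)[OF assms(1), of x] bounded_op_truncate(1)[OF assms(2),
        of x] LIMSEQ_unique by simp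
  moreover have "x \<in> dom S" "x \<in> dom T" using assms(1,2) unfolding bounded_op_def by blast+
  ultimately show "S x = T x" by (metis domIff option.expand)
qed

text \<open>Completeness of the space is not needed: the coefficients of the extension are limits of
  coefficients, and the bound passes to the limit on finite sets of labels.\<close>

lemma bounded_extension_exists:
  assumes P: "clinear_op P" and V: "V \<subseteq> dom P" "\<And>x. finsupp x \<Longrightarrow> x \<in> V" "\<And>x y. x \<in> V \<Longrightarrow> y \<in> V \<Longrightarrow> x - y \<in> V"
    and C: "\<And>x. x \<in> V \<Longrightarrow> norm (the (P x)) \<le> C * norm x" "C \<ge> 0"
  shows "\<exists>S. bounded_op S \<and> (\<forall>x\<in>V. S x = P x)"
proof -
  have trV: "truncate x N \<in> V" for x N
    unfolding truncate_def by (intro V(2) finsupp_sum finsupp_scale finsupp_ket)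
  have Pdiff: "the (P (x - y)) = the (P x) - the (P y)" if "x \<in> V" "y \<in> V" for x y
    using clinear_op_simps(3)[OF P] V(1) that by blast
  have lip: "cmod (hcoeff (the (P x)) i - hcoeff (the (P y)) i) \<le> C * norm (x - y)" if "x \<in> V" "y \<in> V"
      for x y i
  proof -
    have "cmod (hcoeff (the (P x)) i - hcoeff (the (P y)) i) = cmod (hcoeff (the (P (x - y))) i)"
      using Pdiff[OF that] by simp
    also have "\<dots> \<le> norm (the (P (x - y)))" by (rule hcoeff_le_norm)
    also have "\<dots> \<le> C * norm (x - y)" by (intro C V(3) that)
    finally show ?thesis .
  qed
  have conv: "convergent (\<lambda>N. hcoeff (the (P (truncate x N))) i)" for x i
  proof -
    have "Cauchy (\<lambda>N. hcoeff (the (P (truncate x N))) i)"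
    proof (rule metric_CauchyI)
      fix e :: real assume e: "e > 0"
      have "Cauchy (truncate x)" using truncate_tendsto by (rule LIMSEQ_imp_Cauchy)
      then obtain M where M: "\<And>m n. m \<ge> M \<Longrightarrow> n \<ge> M \<Longrightarrow> dist (truncate x m) (truncate x n) < e / (C + 1)"
        using e C(2) unfolding Cauchy_def by (metis add_nonneg_pos divide_pos_pos zero_less_one)
      have "dist (hcoeff (the (P (truncate x m))) i) (hcoeff (the (P (truncate x n))) i) < e"
          if "m \<ge> M" "n \<ge> M" for m n
      proof -
        have "dist (hcoeff (the (P (truncate x m))) i) (hcoeff (the (P (truncate x n))) i) \<le>
            C * norm (truncate x m - truncate x n)"
          unfolding dist_norm by (intro lip trV)
        also have "\<dots> \<le> (C + 1) * norm (truncate x m - truncate x n)" by (intro mult_right_mono) auto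
        also have "\<dots> < (C + 1) * (e / (C + 1))"
          using M[OF that] C(2) unfolding dist_norm by (intro mult_strict_left_mono) auto
        also have "\<dots> = e" using C(2) by simp
        finally show ?thesis .
      qed
      then show "\<exists>M. \<forall>m\<ge>M. \<forall>n\<ge>M. dist (hcoeff (the (P (truncate x m))) i) (hcoeff (the (P (truncate x
          n))) i) < e"
        by blast
    qed
    then show ?thesis by (rule Cauchy_convergent)
  qed
  define y where "y x i = lim (\<lambda>N. hcoeff (the (P (truncate x N))) i)" for x i
  have y: "(\<lambda>N. hcoeff (the (P (truncate x N))) i) \<longlonglongrightarrow> y x i" for x i
    unfolding y_def using conv[of x i] by (simp add: convergent_LIMSEQ_iff)
  have y0: "y x i = 0" if "i \<notin> labels" for x i
    using y[of x i] that by (simp add: hcoeff_outside LIMSEQ_const_iff)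
  have ybd: "(\<Sum>i\<in>F. (cmod (y x i))\<^sup>2) \<le> (C * norm x)\<^sup>2" if F: "finite F" "F \<subseteq> labels" for x F
  proof (rule LIMSEQ_le_const2)
    show "(\<lambda>N. \<Sum>i\<in>F. (cmod (hcoeff (the (P (truncate x N))) i))\<^sup>2) \<longlonglongrightarrow> (\<Sum>i\<in>F. (cmod (y x i))\<^sup>2)"
      by (intro tendsto_intros y)
    have "(\<Sum>i\<in>F. (cmod (hcoeff (the (P (truncate x N))) i))\<^sup>2) \<le> (C * norm x)\<^sup>2" for N
    proof -
      have "(\<Sum>i\<in>F. (cmod (hcoeff (the (P (truncate x N))) i))\<^sup>2) \<le> (norm (the (P (truncate x N))))\<^sup>2"
        by (rule sum_le_norm_sq[OF F])
      also have "\<dots> \<le> (C * norm (truncate x N))\<^sup>2" by (intro power_mono C trV) auto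
      also have "\<dots> \<le> (C * norm x)\<^sup>2"
        using C(2) norm_truncate_le by (intro power_mono mult_left_mono) auto
      finally show ?thesis .
    qed
    then show "\<exists>M. \<forall>N\<ge>M. (\<Sum>i\<in>F. (cmod (hcoeff (the (P (truncate x N))) i))\<^sup>2) \<le> (C * norm x)\<^sup>2" by blast
  qed
  have e: "ell2 (y x)" and nb: "norm (hvec (y x)) \<le> C * norm x" for x
    using bounded_sums_ell2[of "y x" "C * norm x"] y0 ybd C(2) by auto
  define S where "S x = Some (hvec (y x))" for x
  have hS: "hcoeff (the (S x)) i = y x i" for x i
    unfolding S_def by (simp add: hcoeff_hvec e)
  have SV: "S x = P x" if x: "x \<in> V" for x
  proof -
    have "hcoeff (the (S x)) i = hcoeff (the (P x)) i" for i
    proof -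
      have lim: "(\<lambda>N. C * norm (truncate x N - x)) \<longlonglongrightarrow> 0"
        by (rule tendsto_mult_right_zero[OF tendsto_norm_zero[OF LIM_zero[OF truncate_tendsto]]])
      have "(\<lambda>N. hcoeff (the (P (truncate x N))) i - hcoeff (the (P x)) i) \<longlonglongrightarrow> 0"
        by (rule Lim_null_comparison[OF always_eventually[OF allI[OF lip[OF trV x]]] lim])
      then have "(\<lambda>N. hcoeff (the (P (truncate x N))) i) \<longlonglongrightarrow> hcoeff (the (P x)) i"
          by (rule LIM_zero_cancel)
      then show ?thesis unfolding hS by (rule LIMSEQ_unique[OF y])
    qed
    then have "the (S x) = the (P x)" by (intro hilb_eqI)
    moreover have "x \<in> dom P" using V(1) x by blast
    ultimately show ?thesis unfolding S_def by (metis domIff option.collapse option.sel)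
  qed
  have "S (a *\<^sub>C u + b *\<^sub>C v) = Some (a *\<^sub>C the (S u) + b *\<^sub>C the (S v))" for a b u v
  proof -
    have tr: "truncate (a *\<^sub>C u + b *\<^sub>C v) N = a *\<^sub>C truncate u N + b *\<^sub>C truncate v N" for N
      by (rule hilb_eqI) (simp add: hcoeff_truncate)
    have "P (a *\<^sub>C truncate u N + b *\<^sub>C truncate v N) =
        Some (a *\<^sub>C the (P (truncate u N)) + b *\<^sub>C the (P (truncate v N)))" for N
      using P trV V(1) unfolding clinear_op_def by blast
    then have "(\<lambda>N. hcoeff (the (P (truncate (a *\<^sub>C u + b *\<^sub>C v) N))) i) \<longlonglongrightarrow> a * y u i + b * y v i" for i
      unfolding tr by (simp add: tendsto_add tendsto_mult_left y)
    then have "y (a *\<^sub>C u + b *\<^sub>C v) i = a * y u i + b * y v i" for i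
      by (rule LIMSEQ_unique[OF y])
    then have "the (S (a *\<^sub>C u + b *\<^sub>C v)) = a *\<^sub>C the (S u) + b *\<^sub>C the (S v)"
      by (intro hilb_eqI) (simp add: hS)
    then show ?thesis by (simp add: S_def)
  qed
  moreover have "S 0 = Some 0"
    using SV[OF V(2)[OF finsupp_0]] P by (simp add: clinear_op_def)
  ultimately have "clinear_op S" unfolding clinear_op_def by blast
  moreover have "dom S = UNIV" unfolding S_def by auto
  ultimately have "bounded_op S"
    unfolding bounded_op_def using nb by (auto simp: S_def)
  then show ?thesis using SV by blast
qed

lemma bounded_op_comp:
  assumes "bounded_op S" "bounded_op T" shows "bounded_op (S \<circ>\<^sub>m T)"
proof -
  obtain C where C: "C \<ge> 0" "\<And>x. norm (the (S x)) \<le> C * norm x" "clinear_op S" "dom S = UNIV"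
    using assms(1) by (rule bounded_opE) blast
  obtain D where D: "D \<ge> 0" "\<And>x. norm (the (T x)) \<le> D * norm x" "clinear_op T" "dom T = UNIV"
    using assms(2) by (rule bounded_opE) blast
  have c: "(S \<circ>\<^sub>m T) x = Some (the (S (the (T x))))" for x
  proof -
    obtain y where "T x = Some y" using D(4) by blast
    moreover obtain z where "S y = Some z" using C(4) by blast
    ultimately show ?thesis by (simp add: map_comp_def)
  qed
  have "norm (the ((S \<circ>\<^sub>m T) x)) \<le> C * D * norm x" for x
    unfolding c using order_trans[OF C(2)[of "the (T x)"] mult_left_mono[OF D(2) C(1)]]
        by (simp add: mult.assoc)
  moreover have "clinear_op (S \<circ>\<^sub>m T)"
  proof -
    have "T 0 = Some 0" "S 0 = Some 0" using C(3) D(3) by (simp_all add: clinear_op_def)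
    moreover have "T (a *\<^sub>C x + b *\<^sub>C y) = Some (a *\<^sub>C the (T x) + b *\<^sub>C the (T y))" for a b x y
      using D(3,4) unfolding clinear_op_def by blast
    moreover have "S (a *\<^sub>C x + b *\<^sub>C y) = Some (a *\<^sub>C the (S x) + b *\<^sub>C the (S y))" for a b x y
      using C(3,4) unfolding clinear_op_def by blast
    ultimately show ?thesis unfolding clinear_op_def c by simp
  qed
  ultimately show ?thesis unfolding bounded_op_def using c by auto
qed

text \<open>Take basis vectors for \<open>f n\<close> and their images under \<open>S\<close>,
  scaled by \<open>d\<close>, for \<open>g n\<close>. The partial sums of the nuclear series are
  then the operator applied to truncations, so they converge by continuity, and nuclearity follows
  from summability of \<open>d\<close> and boundedness of \<open>S\<close>.\<close>

lemma trace_class_diag: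
  assumes S: "bounded_op S" and d: "(\<lambda>i. cmod (d i)) summable_on labels"
  shows "trace_class (S \<circ>\<^sub>m diag_op d)"
    and "op_trace (S \<circ>\<^sub>m diag_op d) = (\<Sum>\<^sub>\<infinity>i\<in>labels. d i * hcoeff (the (S (basis i))) i)"
proof -
  obtain C where C: "C \<ge> 0" "\<And>x. norm (the (S x)) \<le> C * norm x" "clinear_op S" "dom S = UNIV"
    using S by (rule bounded_opE) blast
  define M where "M = (\<Sum>\<^sub>\<infinity>i\<in>labels. cmod (d i))"
  have M: "cmod (d i) \<le> M" if "i \<in> labels" for i
    using finite_sum_le_infsum[OF d, of "{i}"] that by (simp add: M_def)
  have M0: "M \<ge> 0" unfolding M_def by (rule infsum_nonneg) simp
  have "bounded_op (diag_op d)"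
    unfolding bounded_op_def
    using clinear_diag_op[of d] bounded_diag_op(1)[of d M, OF M M0] bounded_diag_op(2)[of d M,
        OF M M0] by blast
  then have b: "bounded_op (S \<circ>\<^sub>m diag_op d)" by (rule bounded_op_comp[OF S])
  have Sb: "the ((S \<circ>\<^sub>m diag_op d) (basis i)) = d i *\<^sub>C the (S (basis i))" if "i \<in> labels" for i
    using clinear_op_simps(2)[OF C(3), of "basis i" "basis i" "d i"] C(4)
    by (simp add: map_comp_def diag_op_basis[OF that])
  define f where "f n = basis (label_seq n)" for n
  define g where "g n = d (label_seq n) *\<^sub>C the (S (basis (label_seq n)))" for n
  have "summable (\<lambda>n. cmod (d (label_seq n)))"
    using label_seq_sums[OF has_sum_infsum[OF d]] by (rule sums_summable)
  then have "summable (\<lambda>n. cmod (d (label_seq n)) * C)" by (rule summable_mult2)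
  then have "summable (\<lambda>n. norm (f n) * norm (g n))"
  proof (rule summable_comparison_test')
    fix n
    have "norm (the (S (basis (label_seq n)))) \<le> C * norm (basis (label_seq n))" by (rule C)
    also have "\<dots> \<le> C * 1" by (rule mult_left_mono[OF norm_basis_le C(1)])
    finally have "norm (g n) \<le> cmod (d (label_seq n)) * C"
      unfolding g_def norm_scaleC by (intro mult_left_mono) auto
    then have "norm (f n) * norm (g n) \<le> 1 * (cmod (d (label_seq n)) * C)"
      unfolding f_def by (intro mult_mono norm_basis_le) auto
    then show "norm (norm (f n) * norm (g n)) \<le> cmod (d (label_seq n)) * C" by simp
  qed
  moreover have "(\<lambda>n. cinner (f n) x *\<^sub>C g n) sums the ((S \<circ>\<^sub>m diag_op d) x)" for x
    unfolding sums_def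
  proof -
    have "(\<Sum>n<N. cinner (f n) x *\<^sub>C g n) = the ((S \<circ>\<^sub>m diag_op d) (truncate x N))" for N
      unfolding bounded_op_truncate(2)[OF b] f_def g_def cinner_basis using Sb[OF label_seq_in] by simp
    then show "(\<lambda>N. \<Sum>n<N. cinner (f n) x *\<^sub>C g n) \<longlonglongrightarrow> the ((S \<circ>\<^sub>m diag_op d) x)"
      using bounded_op_truncate(1)[OF b] by simp
  qed
  ultimately show "trace_class (S \<circ>\<^sub>m diag_op d)" unfolding trace_class_def using b by blast
  show "op_trace (S \<circ>\<^sub>m diag_op d) = (\<Sum>\<^sub>\<infinity>i\<in>labels. d i * hcoeff (the (S (basis i))) i)"
    unfolding op_trace_def
  proof (rule infsum_cong)
    fix i assume i: "i \<in> labels"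
    have "(case i of (l, m, e) \<Rightarrow> cinner (ket l m e) (the ((S \<circ>\<^sub>m diag_op d) (ket l m e)))) =
       cinner (basis i) (the ((S \<circ>\<^sub>m diag_op d) (basis i)))"
      by (simp add: split_beta)
    then show "(case i of (l, m, e) \<Rightarrow> cinner (ket l m e) (the ((S \<circ>\<^sub>m diag_op d) (ket l m e)))) =
       d i * hcoeff (the (S (basis i))) i"
      unfolding Sb[OF i] cinner_basis by simp
  qed
qed


subsection \<open>Continuation of series in powers of \<open>q\<close>\<close>

locale podles_param =
  fixes q :: real
  assumes q_pos: "0 < q" and q_less_1: "q < 1"
begin

text \<open>The entire function q^t. Its period 2 pi i / ln q produces the vertical spacing of the
  poles.\<close>

definition qexp :: "complex \<Rightarrow> complex" where
  "qexp t = exp (of_real (ln q) * t)"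

lemma ln_q_neg: "ln q < 0"
  using q_pos q_less_1 by simp

lemma qexp_add: "qexp (a + b) = qexp a * qexp b"
  by (simp add: qexp_def exp_add distrib_left)

lemma qexp_nonzero [simp]: "qexp a \<noteq> 0"
  by (simp add: qexp_def)

lemma qexp_0 [simp]: "qexp 0 = 1"
  by (simp add: qexp_def)

lemma qexp_of_nat_mult: "qexp (of_nat n * t) = qexp t ^ n"
  unfolding qexp_def by (simp add: exp_of_nat_mult[symmetric] algebra_simps)

lemma qexp_of_real: "qexp (of_real x) = of_real (q powr x)"
  using q_pos by (simp add: qexp_def powr_def exp_of_real[symmetric] mult.commute)

lemma norm_qexp: "cmod (qexp t) = q powr Re t"
  using q_pos by (simp add: qexp_def powr_def mult.commute)

lemma qexp_analytic [analytic_intros]: "f analytic_on S \<Longrightarrow> (\<lambda>s. qexp (f s)) analytic_on S"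
  unfolding qexp_def by (intro analytic_intros)

lemma qexp_holomorphic [holomorphic_intros]:
  "f holomorphic_on S \<Longrightarrow> (\<lambda>s. qexp (f s)) holomorphic_on S"
  unfolding qexp_def by (intro holomorphic_intros)

lemma qexp_eq_1_iff: "qexp t = 1 \<longleftrightarrow> (\<exists>n::int. t = \<i> * complex_of_real (2 * pi / ln q) * of_int n)"
proof -
  have l: "complex_of_real (ln q) \<noteq> 0" using ln_q_neg by simp
  have "qexp t = 1 \<longleftrightarrow> (\<exists>n::int. of_real (ln q) * t = of_int (2 * n) * (of_real pi * \<i>))"
  proof -
    have "Re (of_real (ln q) * t) = 0 \<and> Im (of_real (ln q) * t) = of_int (2 * n) * pi \<longleftrightarrow>
       of_real (ln q) * t = of_int (2 * n) * (of_real pi * \<i>)" for n :: int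
      by (subst complex_eq_iff) simp
    then show ?thesis unfolding qexp_def exp_eq_1 ex_simps(2)[symmetric] by simp
  qed
  also have "\<dots> \<longleftrightarrow> (\<exists>n::int. t = \<i> * complex_of_real (2 * pi / ln q) * of_int n)"
  proof (intro iff_exI)
    fix n :: int
    show "of_real (ln q) * t = of_int (2 * n) * (of_real pi * \<i>) \<longleftrightarrow>
       t = \<i> * complex_of_real (2 * pi / ln q) * of_int n"
      using l by (simp add: nonzero_eq_divide_eq[symmetric] mult.commute mult.left_commute)
  qed
  finally show ?thesis .
qed

section \<open>Poles of at most second order on the lattice\<close>

text \<open>\<open>j\<close> may be negative here; poles with positive real part are excluded later
  by a growth bound on the coefficients.\<close>

definition pole_lattice :: "complex set" where
  "pole_lattice = {z. \<exists>j::int. qexp (z + of_int j) = 1}"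

text \<open>The pole need not be genuine, which makes the notion stable under sums and analytic
  multiples. The quotient is compared on a punctured neighbourhood only, whereas off the lattice
  analyticity includes the value at \<open>z\<close>.\<close>

definition at_most_double_pole :: "(complex \<Rightarrow> complex) \<Rightarrow> complex \<Rightarrow> bool" where
  "at_most_double_pole Z z \<longleftrightarrow>
     (\<exists>g. g analytic_on {z} \<and> (\<forall>\<^sub>F s in at z. Z s = g s / (s - z)\<^sup>2)) \<and>
     (z \<notin> pole_lattice \<longrightarrow> Z analytic_on {z})"

lemma at_most_double_pole_analytic:
  assumes "Z analytic_on {z}"
  shows "at_most_double_pole Z z"
proof -
  have "\<forall>\<^sub>F s in at z. Z s = (Z s * (s - z)\<^sup>2) / (s - z)\<^sup>2"
    by (simp add: eventually_at_filter)
  moreover have "(\<lambda>s. Z s * (s - z)\<^sup>2) analytic_on {z}"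
    by (intro analytic_intros assms)
  ultimately show ?thesis
    using assms unfolding at_most_double_pole_def by blast
qed

lemma at_most_double_pole_add:
  assumes "at_most_double_pole Y z" "at_most_double_pole Z z"
  shows "at_most_double_pole (\<lambda>s. Y s + Z s) z"
proof -
  obtain f g where f: "f analytic_on {z}" "\<forall>\<^sub>F s in at z. Y s = f s / (s - z)\<^sup>2"
    and g: "g analytic_on {z}" "\<forall>\<^sub>F s in at z. Z s = g s / (s - z)\<^sup>2"
    using assms unfolding at_most_double_pole_def by blast
  have "\<forall>\<^sub>F s in at z. Y s + Z s = (f s + g s) / (s - z)\<^sup>2"
    using f(2) g(2) by eventually_elim (simp add: add_divide_distrib)
  moreover have "(\<lambda>s. f s + g s) analytic_on {z}"
    by (intro analytic_intros f g)
  ultimately show ?thesis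
    using assms unfolding at_most_double_pole_def by (auto intro: analytic_on_add)
qed

lemma at_most_double_pole_mult:
  assumes "h analytic_on {z}" "at_most_double_pole Z z"
  shows "at_most_double_pole (\<lambda>s. h s * Z s) z"
proof -
  obtain g where g: "g analytic_on {z}" "\<forall>\<^sub>F s in at z. Z s = g s / (s - z)\<^sup>2"
    using assms unfolding at_most_double_pole_def by blast
  have "\<forall>\<^sub>F s in at z. h s * Z s = (h s * g s) / (s - z)\<^sup>2"
    using g(2) by eventually_elim simp
  moreover have "(\<lambda>s. h s * g s) analytic_on {z}"
    by (intro analytic_intros assms g)
  ultimately show ?thesis
    using assms unfolding at_most_double_pole_def by (auto intro: analytic_on_mult)
qed

lemma at_most_double_pole_sum:
  assumes "\<And>k. k \<in> A \<Longrightarrow> at_most_double_pole (Z k) z"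
  shows "at_most_double_pole (\<lambda>s. \<Sum>k\<in>A. Z k s) z"
  using assms
proof (induction A rule: infinite_finite_induct)
  case (insert x F)
  then show ?case using at_most_double_pole_add[of "Z x" z "\<lambda>s. \<Sum>k\<in>F. Z k s"] by simp
qed (auto intro!: at_most_double_pole_analytic)

lemma at_most_double_pole_meromorphic:
  assumes "at_most_double_pole Z z"
  shows "Z meromorphic_on {z}"
proof -
  obtain g where g: "g analytic_on {z}" "\<forall>\<^sub>F s in at z. Z s = g s / (s - z)\<^sup>2"
    using assms unfolding at_most_double_pole_def by blast
  have "(\<lambda>s. g s / (s - z)\<^sup>2) meromorphic_on {z}"
    by (intro meromorphic_intros analytic_on_imp_meromorphic_on g)
  then show ?thesis
    by (subst meromorphic_on_cong[where B = "{z}"]) (use g(2) in auto)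
qed

text \<open>A genuine pole shows that \<open>g\<close> does not vanish identically near
  \<open>z\<close>; its order there is nonnegative, and division by the square lowers it by
  two.\<close>

lemma at_most_double_pole_cases:
  assumes "at_most_double_pole Y z" and ev: "\<forall>\<^sub>F s in at z. Z s = Y s" and "is_pole Z z"
  shows "z \<in> pole_lattice" "zorder Z z \<ge> -2"
proof -
  obtain g where g: "g analytic_on {z}" "\<forall>\<^sub>F s in at z. Y s = g s / (s - z)\<^sup>2"
    using assms unfolding at_most_double_pole_def by blast
  have pY: "is_pole Y z"
    using is_pole_cong[OF ev refl] assms by simp
  show "z \<in> pole_lattice"
  proof (rule ccontr)
    assume "z \<notin> pole_lattice"
    then have "Y analytic_on {z}" using assms unfolding at_most_double_pole_def by blast
    then show False using pY analytic_at_imp_no_pole by blast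
  qed
  have Zg: "\<forall>\<^sub>F s in at z. Z s = g s / (s - z)\<^sup>2"
    using ev g(2) by eventually_elim simp
  then have p: "is_pole (\<lambda>s. g s / (s - z)\<^sup>2) z"
    using is_pole_cong[OF Zg refl] assms by simp
  have nz: "\<exists>\<^sub>F s in at z. g s \<noteq> 0"
  proof (rule ccontr)
    assume "\<not> ?thesis"
    then have "\<forall>\<^sub>F s in at z. g s = 0" by (simp add: not_frequently)
    then have "\<forall>\<^sub>F s in at z. g s / (s - z)\<^sup>2 = 0" by eventually_elim simp
    then have "is_pole (\<lambda>s. 0 :: complex) z" using is_pole_cong[of "\<lambda>s. g s / (s - z)\<^sup>2" "\<lambda>s. 0" z z]
        p by simp
    then show False by simp
  qed
  have nzd: "\<exists>\<^sub>F s in at z. (s - z)\<^sup>2 \<noteq> 0"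
    by (intro eventually_frequently) (auto simp: eventually_at_filter)
  have "zorder Z z = zorder (\<lambda>s. g s / (s - z)\<^sup>2) z"
    by (rule zorder_cong[OF Zg refl])
  also have "\<dots> = zorder g z - zorder (\<lambda>s. (s - z)\<^sup>2) z"
    using g(1) nz nzd by (intro zorder_divide) (auto intro!: analytic_on_imp_meromorphic_on
        analytic_intros)
  also have "zorder (\<lambda>s. (s - z)\<^sup>2) z = 2"
    by (rule zorder_eqI[of UNIV _ "\<lambda>_. 1"]) (auto simp: power_int_def)
  finally have "zorder Z z = zorder g z - 2" .
  moreover have "zorder g z \<ge> 0"
    using g(1) nz by (intro zorder_ge_0)
  ultimately show "zorder Z z \<ge> -2" by simp
qed

lemma q_powr_less_1: "0 < x \<Longrightarrow> q powr x < 1"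
  using q_pos ln_q_neg by (simp add: powr_def mult_pos_neg)

lemma q_powr_power: "q powr (x * real n) = (q powr x) ^ n"
  using q_pos by (simp add: powr_powr[symmetric] powr_realpow)

lemma q_power_eq_powr: "q ^ n = q powr real n"
  using q_pos by (simp add: powr_realpow)

text \<open>With x = \<open>qexp t\<close>, of modulus below one, these are the sums of x^(n+1) and
  of (n+1) x^(n+1). The second, a differentiated geometric series, is the source of all double
  poles.\<close>

lemma geometric_qexp_sums:
  assumes "Re t > 0"
  shows "(\<lambda>n. qexp (of_nat (Suc n) * t)) sums (qexp t / (1 - qexp t))"
    and "(\<lambda>n. of_nat (Suc n) * qexp (of_nat (Suc n) * t)) sums (qexp t / (1 - qexp t)\<^sup>2)"
proof -
  have n: "cmod (qexp t) < 1"
    unfolding norm_qexp using assms by (rule q_powr_less_1)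
  show "(\<lambda>n. qexp (of_nat (Suc n) * t)) sums (qexp t / (1 - qexp t))"
    using sums_mult[OF geometric_sums[OF n], of "qexp t"]
    by (simp add: qexp_of_nat_mult del: of_nat_Suc)
  show "(\<lambda>n. of_nat (Suc n) * qexp (of_nat (Suc n) * t)) sums (qexp t / (1 - qexp t)\<^sup>2)"
    using sums_mult[OF geometric_deriv_sums[OF n], of "qexp t"]
    by (simp add: qexp_of_nat_mult mult.left_commute del: of_nat_Suc)
qed

text \<open>The derivative at the zero is \<open>- ln q\<close>, because
  \<open>qexp (z + c) = 1\<close>; being nonzero it makes the zero simple. \<open>h\<close> is the
  difference quotient with its removable singularity filled.\<close>

lemma qexp_simple_zero:
  assumes "qexp (z + c) = 1"
  obtains h where "h analytic_on {z}" "h z \<noteq> 0" "\<And>s. 1 - qexp (s + c) = h s * (s - z)"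
proof -
  define F where "F s = 1 - qexp (s + c)" for s
  define h where "h s = (if s = z then deriv F z else (F s - F z) / (s - z))" for s
  have Fz: "F z = 0" using assms by (simp add: F_def)
  have "F holomorphic_on UNIV"
    unfolding F_def by (intro holomorphic_intros)
  then have "h holomorphic_on UNIV"
    unfolding h_def by (rule pole_lemma_open) simp
  then have "h analytic_on {z}"
    using analytic_on_open[of UNIV h] analytic_on_subset by blast
  moreover have "(F has_field_derivative - (of_real (ln q) * qexp (z + c))) (at z)"
    unfolding F_def qexp_def by (auto intro!: derivative_eq_intros)
  then have "deriv F z = - of_real (ln q)"
    using assms by (simp add: DERIV_imp_deriv)
  then have "h z \<noteq> 0" using ln_q_neg by (simp add: h_def)
  moreover have "1 - qexp (s + c) = h s * (s - z)" for s
  proof -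
    have "F s = h s * (s - z)" using Fz by (simp add: h_def)
    then show ?thesis by (simp add: F_def)
  qed
  ultimately show thesis by (rule that)
qed

lemma double_pole_qexp: "at_most_double_pole (\<lambda>s. qexp (s + of_int j) / (1 - qexp (s + of_int j))\<^sup>2) z"
proof (cases "qexp (z + of_int j) = 1")
  case False
  then show ?thesis
    by (intro at_most_double_pole_analytic analytic_intros) auto
next
  case True
  then obtain h where h: "h analytic_on {z}" "h z \<noteq> 0" "\<And>s. 1 - qexp (s + of_int j) = h s * (s - z)"
    by (rule qexp_simple_zero) blast
  have "(\<lambda>s. qexp (s + of_int j) / (h s)\<^sup>2) analytic_on {z}"
    by (intro analytic_intros h) (use h in auto)
  moreover have "\<forall>\<^sub>F s in at z. qexp (s + of_int j) / (1 - qexp (s + of_int j))\<^sup>2 =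
      (qexp (s + of_int j) / (h s)\<^sup>2) / (s - z)\<^sup>2"
    unfolding h(3) by (simp add: power_mult_distrib)
  moreover have "z \<in> pole_lattice" using True by (auto simp: pole_lattice_def)
  ultimately show ?thesis unfolding at_most_double_pole_def by blast
qed

lemma simple_pole_qexp: "at_most_double_pole (\<lambda>s. qexp (s + of_int j) / (1 - qexp (s + of_int j))) z"
proof -
  \<comment> \<open>Valid also where the denominator vanishes: both sides are zero there, as
    division by zero gives zero.\<close>
  have "(\<lambda>s. qexp (s + of_int j) / (1 - qexp (s + of_int j))) =
    (\<lambda>s. (1 - qexp (s + of_int j)) * (qexp (s + of_int j) / (1 - qexp (s + of_int j))\<^sup>2))"
    by (auto simp: fun_eq_iff power2_eq_square)
  then show ?thesis
    using at_most_double_pole_mult[OF _ double_pole_qexp, of "\<lambda>s. 1 - qexp (s + of_int j)" z j]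
    by (simp add: analytic_intros)
qed

section \<open>Binomial expansion of the eigenvalue powers\<close>

text \<open>The eigenvalues of \<open>|\<D>|\<close> are \<open>\<kappa> q\<^sup>-\<^sup>\<nu> (1 - q\<^sup>2\<^sup>\<nu>)\<close> with \<open>\<nu> = l + 1/2 = n + 1\<close>; the weight is the last factor to
  the power \<open>-s\<close>.\<close>

definition weight :: "nat \<Rightarrow> complex \<Rightarrow> complex" where
  "weight n s = exp (- s * of_real (ln (1 - q ^ (2 * Suc n))))"

lemma weight_holomorphic: "weight n holomorphic_on S"
  unfolding weight_def by (intro holomorphic_intros)

lemma q_power_bound: "0 < q ^ (2 * Suc n)" "q ^ (2 * Suc n) \<le> q\<^sup>2" "q ^ (2 * Suc n) < 1"
proof -
  show "0 < q ^ (2 * Suc n)" using q_pos by simp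
  show *: "q ^ (2 * Suc n) \<le> q\<^sup>2" using q_pos q_less_1 by (intro power_decreasing) auto
  have "q\<^sup>2 < 1" using q_pos q_less_1 by (simp add: power_less_one_iff abs_square_less_1)
  then show "q ^ (2 * Suc n) < 1" using * by simp
qed

lemma q_sq: "q\<^sup>2 < 1" "0 < q\<^sup>2"
  using q_power_bound[of 0] q_pos by auto

lemma pochhammer_real_nonneg: "0 \<le> R \<Longrightarrow> 0 \<le> pochhammer (R::real) k"
  by (induction k) (auto simp: pochhammer_Suc)

lemma norm_pochhammer_le:
  assumes "cmod s \<le> R" shows "cmod (pochhammer s k) \<le> pochhammer R k"
proof (induction k)
  case (Suc k)
  have R: "0 \<le> R" using assms norm_ge_zero order_trans by blast
  have "cmod (s + of_nat k) \<le> R + of_nat k"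
    using norm_triangle_ineq[of s "of_nat k"] assms by simp
  then show ?case
    unfolding pochhammer_Suc norm_mult
    using Suc R by (intro mult_mono) (auto simp: pochhammer_real_nonneg)
qed auto

text \<open>The base 1 - q^(2(n+1)) is smallest at n = 0, so one constant serves every
  \<open>n\<close>.\<close>

lemma weight_bound:
  assumes "cmod s \<le> R"
  shows "cmod (weight n s) \<le> exp (R * - ln (1 - q\<^sup>2))"
proof -
  have l: "ln (1 - q\<^sup>2) \<le> ln (1 - q ^ (2 * Suc n))" "ln (1 - q ^ (2 * Suc n)) \<le> 0"
    using q_power_bound[of n] q_sq by (auto simp del: power_Suc power_mult_distrib)
  have R: "0 \<le> R" using assms norm_ge_zero order_trans by blast
  have "\<bar>Re s\<bar> \<le> R" using abs_Re_le_cmod[of s] assms by linarith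
  then have "Re s * - ln (1 - q ^ (2 * Suc n)) \<le> R * - ln (1 - q\<^sup>2)"
    using l R by (intro mult_mono) auto
  then show ?thesis by (simp add: weight_def)
qed

text \<open>Taylor's theorem for (1 - z)^(-s), whose derivative of order i is
  \<open>pochhammer s i\<close> times (1 - z)^(-s-i). The constant \<open>B\<close> bounds the
  derivative of order M + 1 on [0, r] for all s of modulus at most \<open>R\<close> at once.\<close>

lemma binomial_series_remainder:
  fixes r R :: real and M :: nat
  assumes r: "0 \<le> r" "r < 1" and R: "0 \<le> R"
  defines "B \<equiv> pochhammer R (Suc M) * exp ((R + real (Suc M)) * - ln (1 - r))"
  assumes s: "cmod s \<le> R" and x: "0 \<le> x" "x \<le> r"
  shows "cmod (exp (- s * of_real (ln (1 - x))) - (\<Sum>k\<le>M. pochhammer s k / fact k * of_real (x ^ k))) \<le>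
      B * x ^ Suc M"
proof -
  define L where "L = - ln (1 - r)"
  have L: "L \<ge> 0" using r by (simp add: L_def)
  have B: "B \<ge> 0" unfolding B_def using R by (intro mult_nonneg_nonneg pochhammer_real_nonneg) auto
  \<comment> \<open>On this convex set 1 - z is real and at least 1 - r, so its logarithm is real
    and the derivatives can be bounded.\<close>
  define S where "S = closed_segment (complex_of_real 0) (complex_of_real r)"
  define f where "f i z = pochhammer s i * exp (- (s + of_nat i) * Ln (1 - z))" for i z
  have S: "S = of_real ` {0..r}"
    unfolding S_def closed_segment_of_real using r by (simp add: closed_segment_eq_real_ivl)
  have Ln: "Ln (1 - of_real y) = of_real (ln (1 - y))" if "0 \<le> y" "y \<le> r" for y
    using that r Ln_of_real[of "1 - y"] by simp
  have der: "(f i has_field_derivative f (Suc i) z) (at z within S)" if z: "z \<in> S" for i z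
  proof -
    obtain y where y: "0 \<le> y" "y \<le> r" "z = of_real y" using z by (auto simp: S)
    then have "Re (1 - z) > 0" using r by auto
    then have nz: "1 - z \<notin> \<real>\<^sub>\<le>\<^sub>0" "1 - z \<noteq> 0" by (auto simp: complex_nonpos_Reals_iff)
    have "- (s + of_nat (Suc i)) * Ln (1 - z) = - (s + of_nat i) * Ln (1 - z) - Ln (1 - z)"
      by (simp add: algebra_simps)
    then have e: "exp (- (s + of_nat (Suc i)) * Ln (1 - z)) =
        exp (- (s + of_nat i) * Ln (1 - z)) / (1 - z)"
      by (simp only: exp_diff exp_Ln[OF nz(2)])
    have "((\<lambda>z. Ln (1 - z)) has_field_derivative - (1 / (1 - z))) (at z within S)"
      using nz by (auto intro!: derivative_eq_intros simp: divide_simps)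
    then have "((\<lambda>z. - (s + of_nat i) * Ln (1 - z)) has_field_derivative - (s + of_nat i) * - (1 /
        (1 - z))) (at z within S)"
      by (rule DERIV_cmult)
    then have "((\<lambda>z. exp (- (s + of_nat i) * Ln (1 - z))) has_field_derivative
       exp (- (s + of_nat i) * Ln (1 - z)) * (- (s + of_nat i) * - (1 / (1 - z)))) (at z within S)"
      by (rule DERIV_chain2[OF DERIV_exp])
    then have "(f i has_field_derivative pochhammer s i *
       (exp (- (s + of_nat i) * Ln (1 - z)) * (- (s + of_nat i) * - (1 / (1 - z))))) (at z within S)"
      unfolding f_def by (rule DERIV_cmult)
    moreover have "P * (E * (- a * - (1 / u))) = P * a * (E / u)" for P E a u :: complex
      by simp
    ultimately show ?thesis unfolding f_def[of "Suc i"] e pochhammer_Suc by (simp only:)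
  qed
  have bd: "cmod (f (Suc M) z) \<le> B" if z: "z \<in> S" for z
  proof -
    obtain y where y: "0 \<le> y" "y \<le> r" "z = of_real y" using z by (auto simp: S)
    have l: "ln (1 - r) \<le> ln (1 - y)" "ln (1 - y) \<le> 0"
      using y r by auto
    have "\<bar>Re s\<bar> \<le> R" using abs_Re_le_cmod[of s] s by linarith
    then have "(Re s + real (Suc M)) * - ln (1 - y) \<le> (R + real (Suc M)) * L"
      unfolding L_def using l R by (intro mult_mono) auto
    moreover have "Re (- (s + of_nat (Suc M)) * Ln (1 - z)) = (Re s + real (Suc M)) * - ln (1 - y)"
      unfolding y(3) Ln[OF y(1,2)] by (simp add: algebra_simps)
    ultimately have "cmod (exp (- (s + of_nat (Suc M)) * Ln (1 - z))) \<le> exp ((R + real (Suc M)) * L)"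
      unfolding norm_exp_eq_Re by simp
    then show ?thesis
      unfolding f_def B_def norm_mult L_def
      using norm_pochhammer_le[OF s, of "Suc M"] R by (intro mult_mono) (auto simp:
          pochhammer_real_nonneg)
  qed
  have xS: "complex_of_real x \<in> S" "0 \<in> S"
    unfolding S using x r by (auto intro: image_eqI[of _ _ 0])
  have cv: "convex S" by (simp add: S_def)
  have "cmod (f 0 (of_real x) - (\<Sum>i\<le>M. f i 0 * (of_real x - 0) ^ i / fact i))
      \<le> B * cmod (of_real x - 0) ^ Suc M / fact M"
    by (rule complex_Taylor[OF cv der bd xS(2,1)])
  \<comment> \<open>The factorial is given away; only the power of \<open>x\<close> matters.\<close>
  also have "\<dots> = B * x ^ Suc M * inverse (fact M)"
    using x by (simp add: divide_inverse)
  also have "\<dots> \<le> B * x ^ Suc M * 1"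
    using x B by (intro mult_left_mono mult_nonneg_nonneg) (auto simp: fact_ge_1 inverse_le_1_iff)
  also have "f 0 (of_real x) = exp (- s * of_real (ln (1 - x)))"
    unfolding f_def Ln[OF x] by simp
  also have "(\<Sum>i\<le>M. f i 0 * (of_real x - 0) ^ i / fact i) =
      (\<Sum>k\<le>M. pochhammer s k / fact k * of_real (x ^ k))"
    by (intro sum.cong refl) (simp add: f_def)
  finally show ?thesis by simp
qed
text \<open>The binomial series at x = q^(2(n+1)). The remainder is uniform in \<open>n\<close> and
  in bounded s, and only even powers of q^(n+1) occur.\<close>

lemma weight_expansion:
  "\<exists>B\<ge>0. \<forall>n s. cmod s \<le> R \<longrightarrow>
     cmod (weight n s - (\<Sum>k\<le>M. pochhammer s k / fact k * of_real (q ^ (2 * k * Suc n)))) \<le>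
         B * q ^ (2 * Suc M * Suc n)"
proof (cases "R \<ge> 0")
  \<comment> \<open>For negative \<open>R\<close> no s satisfies the bound.\<close>
  case False
  then show ?thesis by (intro exI[of _ 0]) (auto intro: order_trans[OF norm_ge_zero])
next
  case R: True
  define B where "B = pochhammer R (Suc M) * exp ((R + real (Suc M)) * - ln (1 - q\<^sup>2))"
  have B: "B \<ge> 0"
    unfolding B_def using R by (intro mult_nonneg_nonneg pochhammer_real_nonneg) auto
  show ?thesis
  proof (intro exI[of _ B] conjI B allI impI)
    fix n s assume s: "cmod s \<le> R"
    define x where "x = q ^ (2 * Suc n)"
    have x: "0 \<le> x" "x \<le> q\<^sup>2"
      using q_power_bound(1,2)[of n] unfolding x_def by linarith+
    have pw: "x ^ k = q ^ (2 * k * Suc n)" for k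
      unfolding x_def power_mult[symmetric] by (simp only: mult_ac)
    have "cmod (weight n s - (\<Sum>k\<le>M. pochhammer s k / fact k * of_real (x ^ k))) \<le> B * x ^ Suc M"
      unfolding B_def weight_def x_def[symmetric]
      using q_sq R s x by (intro binomial_series_remainder) auto
    then show "cmod (weight n s - (\<Sum>k\<le>M. pochhammer s k / fact k * of_real (q ^ (2 * k * Suc n))))
       \<le> B * q ^ (2 * Suc M * Suc n)"
      unfolding pw .
  qed
qed

text \<open>\<open>qexp (of_nat (Suc n) * s)\<close> has modulus q^((n+1) Re s), so decay q^(N(n+1))
  of the coefficients leaves q^((n+1)(N + Re s)), a geometric majorant to the right of -N.\<close>

lemma holomorphic_dirichlet_series:
  assumes hol: "\<And>n. v n holomorphic_on {s. - real N < Re s}"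
    and bd: "\<And>R. \<exists>B. \<forall>n s. cmod s \<le> R \<longrightarrow> cmod (v n s) \<le> B * q ^ (N * Suc n)"
  shows "(\<lambda>s. \<Sum>n. v n s * qexp (of_nat (Suc n) * s)) holomorphic_on {s. - real N < Re s}"
    and "- real N < Re s \<Longrightarrow> summable (\<lambda>n. v n s * qexp (of_nat (Suc n) * s))"
proof -
  have hol': "(\<lambda>s. v n s * qexp (of_nat (Suc n) * s)) holomorphic_on {s. - real N < Re s}" for n
    by (intro holomorphic_intros hol)
  have bd': "\<exists>M. summable M \<and> (\<forall>n s. cmod s \<le> R \<longrightarrow> - real N + \<delta> \<le> Re s \<longrightarrow>
     cmod (v n s * qexp (of_nat (Suc n) * s)) \<le> M n)" if \<delta>: "\<delta> > 0" for R \<delta>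
  proof -
    obtain B where B: "\<And>n s. cmod s \<le> R \<Longrightarrow> cmod (v n s) \<le> B * q ^ (N * Suc n)"
      using bd by blast
    have "summable (\<lambda>n. (q powr \<delta>) ^ Suc n)"
      unfolding summable_Suc_iff using q_powr_less_1[OF \<delta>] by (intro summable_geometric) simp
    then have "summable (\<lambda>n. \<bar>B\<bar> * (q powr \<delta>) ^ Suc n)" by (rule summable_mult)
    moreover have "cmod (v n s * qexp (of_nat (Suc n) * s)) \<le> \<bar>B\<bar> * (q powr \<delta>) ^ Suc n"
      if s: "cmod s \<le> R" "- real N + \<delta> \<le> Re s" for n s
    proof -
      have 1: "cmod (v n s) \<le> \<bar>B\<bar> * q ^ (N * Suc n)"
        using B[OF s(1), of n] q_pos by (smt (verit) abs_ge_self mult_right_mono zero_less_power)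
      have "q ^ (N * Suc n) * q powr (real (Suc n) * Re s) = q powr (real (Suc n) * (real N + Re s))"
        using q_pos by (simp add: powr_add powr_realpow[symmetric] algebra_simps)
      also have "\<dots> \<le> q powr (real (Suc n) * \<delta>)"
        using q_pos q_less_1 s by (intro powr_mono') (auto intro!: mult_left_mono)
      also have "\<dots> = (q powr \<delta>) ^ Suc n"
        by (simp only: mult.commute[of "real (Suc n)"] q_powr_power)
      finally have 2: "q ^ (N * Suc n) * q powr (real (Suc n) * Re s) \<le> (q powr \<delta>) ^ Suc n" .
      have "cmod (v n s * qexp (of_nat (Suc n) * s)) = cmod (v n s) * q powr (real (Suc n) * Re s)"
        by (simp add: norm_mult norm_qexp del: of_nat_Suc)
      also have "\<dots> \<le> \<bar>B\<bar> * q ^ (N * Suc n) * q powr (real (Suc n) * Re s)"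
        using 1 by (intro mult_right_mono) auto
      also have "\<dots> \<le> \<bar>B\<bar> * (q powr \<delta>) ^ Suc n"
        unfolding mult.assoc using 2 by (intro mult_left_mono) auto
      finally show ?thesis .
    qed
    ultimately show ?thesis by blast
  qed
  show "(\<lambda>s. \<Sum>n. v n s * qexp (of_nat (Suc n) * s)) holomorphic_on {s. - real N < Re s}"
    by (rule holomorphic_series_halfplane(1)[OF hol' bd'])
  show "summable (\<lambda>n. v n s * qexp (of_nat (Suc n) * s))" if "- real N < Re s"
    by (rule holomorphic_series_halfplane(2)[OF hol' bd' that])
qed


section \<open>Continuation of the series\<close>

text \<open>Continuation to one half-plane at a time, from an unspecified half-plane of convergence.
  The functions for different \<open>N\<close> are glued later.\<close>

definition continues :: "nat \<Rightarrow> (nat \<Rightarrow> complex) \<Rightarrow> bool" where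
  "continues N u \<longleftrightarrow> (\<exists>Z. (\<forall>z. - real N < Re z \<longrightarrow> at_most_double_pole Z z) \<and>
     (\<exists>c. \<forall>s. c < Re s \<longrightarrow> (\<lambda>n. u n * qexp (of_nat (Suc n) * s) * weight n s) sums Z s))"

lemma continues_add:
  assumes "continues N u" "continues N v"
  shows "continues N (\<lambda>n. u n + v n)"
proof -
  obtain Y c where Y: "\<And>z. - real N < Re z \<Longrightarrow> at_most_double_pole Y z"
    "\<And>s. c < Re s \<Longrightarrow> (\<lambda>n. u n * qexp (of_nat (Suc n) * s) * weight n s) sums Y s"
    using assms(1) unfolding continues_def by blast
  obtain Z d where Z: "\<And>z. - real N < Re z \<Longrightarrow> at_most_double_pole Z z"
    "\<And>s. d < Re s \<Longrightarrow> (\<lambda>n. v n * qexp (of_nat (Suc n) * s) * weight n s) sums Z s"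
    using assms(2) unfolding continues_def by blast
  have "(\<lambda>n. (u n + v n) * qexp (of_nat (Suc n) * s) * weight n s) sums (Y s + Z s)"
    if "max c d < Re s" for s
    using sums_add[OF Y(2) Z(2), of s s] that by (simp add: distrib_right)
  then show ?thesis
    unfolding continues_def using at_most_double_pole_add Y(1) Z(1)
    by (intro exI[of _ "\<lambda>s. Y s + Z s"]) blast
qed

lemma analytic_at_halfplane:
  assumes "f holomorphic_on {s. c < Re s}" "c < Re z"
  shows "f analytic_on {z}"
proof -
  have "f analytic_on {s. c < Re s}"
    using assms(1) by (subst analytic_on_open) (auto simp: open_halfspace_Re_gt)
  then show ?thesis using assms(2) analytic_on_subset by blast
qed

lemma continues_small:
  assumes "\<And>n. cmod (u n) \<le> C * q ^ (N * Suc n)"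
  shows "continues N u"
proof -
  have C: "cmod (u n) \<le> \<bar>C\<bar> * q ^ (N * Suc n)" for n
    using assms[of n] q_pos by (smt (verit) abs_ge_self mult_right_mono zero_less_power)
  have bd: "\<exists>B. \<forall>n s. cmod s \<le> R \<longrightarrow> cmod (u n * weight n s) \<le> B * q ^ (N * Suc n)" for R
  proof (intro exI allI impI)
    fix n s assume s: "cmod s \<le> R"
    have "cmod (u n * weight n s) \<le> (\<bar>C\<bar> * q ^ (N * Suc n)) * exp (R * - ln (1 - q\<^sup>2))"
      unfolding norm_mult using C q_pos by (intro mult_mono weight_bound s) auto
    then show "cmod (u n * weight n s) \<le> (\<bar>C\<bar> * exp (R * - ln (1 - q\<^sup>2))) * q ^ (N * Suc n)"
      by (simp only: mult_ac)
  qed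
  have hol: "(\<lambda>s. u n * weight n s) holomorphic_on {s. - real N < Re s}" for n
    by (intro holomorphic_intros weight_holomorphic)
  note H = holomorphic_dirichlet_series[of "\<lambda>n s. u n * weight n s" N, OF hol bd]
  show ?thesis
    unfolding continues_def
  proof (intro exI conjI allI impI)
    show "at_most_double_pole (\<lambda>s. \<Sum>n. u n * weight n s * qexp (of_nat (Suc n) * s)) z"
        if "- real N < Re z" for z
      by (intro at_most_double_pole_analytic analytic_at_halfplane[OF H(1)] that)
    show "(\<lambda>n. u n * qexp (of_nat (Suc n) * s) * weight n s) sums
       (\<Sum>n. u n * weight n s * qexp (of_nat (Suc n) * s))" if "- real N < Re s" for s
      using summable_sums[OF H(2)[OF that]] by (simp only: mult_ac)
  qed
qed

text \<open>One spare power of q^(n+1) pays for a factor n + 1; hence the shifts by one in the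
  orders of approximation below.\<close>

lemma nat_times_power_bounded: "\<exists>B\<ge>0. \<forall>n. real (Suc n) * q ^ Suc n \<le> B"
proof -
  have "Bseq (\<lambda>n. of_nat n * q ^ n)"
    using powser_times_n_limit_0[of q] q_pos q_less_1 by (intro convergent_imp_Bseq convergentI) auto
  then obtain K where "K > 0" "\<And>n. norm (of_nat n * q ^ n) \<le> K"
    unfolding Bseq_def by blast
  then show ?thesis
    by (intro exI[of _ K]) (metis abs_ge_self less_imp_le order_trans real_norm_def)
qed

text \<open>The binomial expansion of \<open>weight\<close> turns the series into finitely many
  shifted functions E(s + j + 2k), each a geometric series or its derivative, plus a remainder that
  converges for Re s > -N.\<close>

lemma continues_monomial:
  assumes d: "d \<le> 1"
  shows "continues N (\<lambda>n. c * of_nat (Suc n) ^ d * qexp (of_int j * of_nat (Suc n)))"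
proof -
  \<comment> \<open>Large enough that j + 2(M + 1) is at least N + 1 whatever the sign of
    \<open>j\<close>; the spare one absorbs the factor n + 1.\<close>
  define M where "M = N + nat \<bar>j\<bar>"
  define u where "u n = c * of_nat (Suc n) ^ d * qexp (of_int j * of_nat (Suc n))" for n
  define p where "p n s = (\<Sum>k\<le>M. pochhammer s k / fact k * of_real (q ^ (2 * k * Suc n)))" for n
      and s :: complex
  define v where "v n s = u n * (weight n s - p n s)" for n s
  \<comment> \<open>Simple poles for \<open>d = 0\<close>, double poles for
    \<open>d = 1\<close>.\<close>
  define E where "E s = qexp s / (1 - qexp s) ^ Suc d" for s
  have E: "at_most_double_pole (\<lambda>s. E (s + of_int j)) z" for j z
  proof -
    consider "d = 0" | "d = 1" using d by linarith
    then show ?thesis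
      by cases (use double_pole_qexp simple_pole_qexp in \<open>simp_all add: E_def power2_eq_square\<close>)
  qed
  have Es: "(\<lambda>n. of_nat (Suc n) ^ d * qexp (of_nat (Suc n) * t)) sums E t" if "Re t > 0" for t
  proof -
    consider "d = 0" | "d = 1" using d by linarith
    then show ?thesis
      by cases (use geometric_qexp_sums[OF that] in \<open>simp_all add: E_def power2_eq_square del:
          of_nat_Suc\<close>)
  qed
  obtain B0 where B0: "B0 \<ge> 0" "\<And>n. real (Suc n) * q ^ Suc n \<le> B0"
    using nat_times_power_bounded by blast
  have u_bound: "cmod (u n) * q ^ (2 * Suc M * Suc n) \<le> cmod c * B0 * q ^ (N * Suc n)" for n
  proof -
    have a: "real (Suc n) ^ d \<le> real (Suc n)"
      using d by (cases d) auto
    have "cmod (u n) = cmod c * real (Suc n) ^ d * q powr (of_int j * real (Suc n))"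
      by (simp add: u_def norm_mult norm_power norm_qexp del: of_nat_Suc)
    also have "\<dots> * q ^ (2 * Suc M * Suc n) = cmod c * real (Suc n) ^ d *
        (q powr (of_int j * real (Suc n)) * q powr real (2 * Suc M * Suc n))"
      unfolding q_power_eq_powr by (simp only: mult.assoc)
    also have "q powr (of_int j * real (Suc n)) * q powr real (2 * Suc M * Suc n) =
        q powr ((of_int j + 2 * real (Suc M)) * real (Suc n))"
      unfolding powr_add[symmetric] by (simp only: of_nat_mult of_nat_numeral distrib_right)
    also have "cmod c * real (Suc n) ^ d * q powr ((of_int j + 2 * real (Suc M)) * real (Suc n))
        \<le> cmod c * real (Suc n) * q powr ((real N + 1) * real (Suc n))"
    proof -
      have "real_of_int j + real (nat \<bar>j\<bar>) \<ge> 0" by simp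
      then have "(real N + 1) * real (Suc n) \<le> (of_int j + 2 * real (Suc M)) * real (Suc n)"
        by (intro mult_right_mono) (auto simp: M_def)
      then have "q powr ((of_int j + 2 * real (Suc M)) * real (Suc n)) \<le>
          q powr ((real N + 1) * real (Suc n))"
        using q_pos q_less_1 by (intro powr_mono') auto
      from mult_mono[OF mult_left_mono[OF a norm_ge_zero] this] show ?thesis by simp
    qed
    also have "\<dots> = cmod c * (real (Suc n) * q ^ Suc n) * q ^ (N * Suc n)"
      unfolding q_power_eq_powr of_nat_mult distrib_right powr_add mult_1 by (simp only: mult_ac)
    also have "\<dots> \<le> cmod c * B0 * q ^ (N * Suc n)"
      using q_pos B0 by (intro mult_right_mono mult_left_mono) auto
    finally show ?thesis .
  qed
  have bd: "\<exists>B. \<forall>n s. cmod s \<le> R \<longrightarrow> cmod (v n s) \<le> B * q ^ (N * Suc n)" for R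
  proof -
    obtain B where B: "B \<ge> 0" "\<And>n s. cmod s \<le> R \<Longrightarrow> cmod (weight n s - p n s) \<le>
        B * q ^ (2 * Suc M * Suc n)"
      using weight_expansion[of R M] unfolding p_def by blast
    have "cmod (v n s) \<le> (B * (cmod c * B0)) * q ^ (N * Suc n)" if s: "cmod s \<le> R" for n s
    proof -
      have "cmod (v n s) \<le> cmod (u n) * (B * q ^ (2 * Suc M * Suc n))"
        unfolding v_def norm_mult by (intro mult_left_mono B s) auto
      also have "\<dots> = B * (cmod (u n) * q ^ (2 * Suc M * Suc n))" by (simp only: mult_ac)
      also have "\<dots> \<le> B * (cmod c * B0 * q ^ (N * Suc n))"
        by (intro mult_left_mono u_bound B)
      finally show ?thesis by (simp only: mult_ac)
    qed
    then show ?thesis by blast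
  qed
  have hol: "v n holomorphic_on {s. - real N < Re s}" for n
    unfolding v_def p_def by (intro holomorphic_intros weight_holomorphic) auto
  note H = holomorphic_dirichlet_series[of v N, OF hol bd]
  define Z where "Z s = (\<Sum>k\<le>M. (c * pochhammer s k / fact k) * E (s + of_int (j + 2 * int k)))
      + (\<Sum>n. v n s * qexp (of_nat (Suc n) * s))" for s
  have hp: "(\<lambda>s. c * pochhammer s k / fact k) analytic_on {z}" for k and z :: complex
  proof -
    have "(\<lambda>s. c * pochhammer s k / fact k) holomorphic_on UNIV" by (intro holomorphic_intros) auto
    then show ?thesis using analytic_on_open[of UNIV] analytic_on_subset by blast
  qed
  show ?thesis
    unfolding continues_def
  proof (intro exI conjI allI impI)
    fix z assume z: "- real N < Re z"
    show "at_most_double_pole Z z" unfolding Z_def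
      by (intro at_most_double_pole_add at_most_double_pole_sum at_most_double_pole_mult hp E
          at_most_double_pole_analytic analytic_at_halfplane[OF H(1)] z)
  next
    \<comment> \<open>The bound |j| makes Re (s + j + 2k) positive for every k, as the geometric
      sums require; -N is for the remainder.\<close>
    fix s assume s: "max (- real N) (real_of_int \<bar>j\<bar>) < Re s"
    have "(\<lambda>n. (\<Sum>k\<le>M. (c * pochhammer s k / fact k) *
         (of_nat (Suc n) ^ d * qexp (of_nat (Suc n) * (s + of_int (j + 2 * int k)))))
       + v n s * qexp (of_nat (Suc n) * s)) sums Z s"
      unfolding Z_def using s
      by (intro sums_add sums_sum sums_mult Es summable_sums H(2)) auto
    moreover have "(\<Sum>k\<le>M. (c * pochhammer s k / fact k) *
         (of_nat (Suc n) ^ d * qexp (of_nat (Suc n) * (s + of_int (j + 2 * int k)))))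
         = u n * p n s * qexp (of_nat (Suc n) * s)" for n
    proof -
      have e: "qexp (of_nat (Suc n) * (s + of_int (j + 2 * int k))) =
        qexp (of_int j * of_nat (Suc n)) * of_real (q ^ (2 * k * Suc n)) * qexp (of_nat (Suc n) * s)"
            for k
      proof -
        have "of_nat (Suc n) * (s + of_int (j + 2 * int k)) =
          of_int j * of_nat (Suc n) + of_real (real (2 * k * Suc n)) + of_nat (Suc n) * s"
          by (simp add: algebra_simps)
        then show ?thesis
          by (simp only: qexp_add qexp_of_real q_power_eq_powr)
      qed
      show ?thesis
        unfolding e u_def p_def sum_distrib_left sum_distrib_right
        by (intro sum.cong refl) (simp add: mult_ac)
    qed
    ultimately have "(\<lambda>n. u n * p n s * qexp (of_nat (Suc n) * s) + v n s * qexp (of_nat (Suc n) *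
        s)) sums Z s"
      by simp
    moreover have "u n * p n s * qexp (of_nat (Suc n) * s) + v n s * qexp (of_nat (Suc n) * s)
       = u n * qexp (of_nat (Suc n) * s) * weight n s" for n
      by (simp add: v_def algebra_simps del: of_nat_Suc)
    ultimately show "(\<lambda>n. c * of_nat (Suc n) ^ d * qexp (of_int j * of_nat (Suc n)) *
        qexp (of_nat (Suc n) * s) * weight n s) sums Z s"
      by (simp add: u_def del: of_nat_Suc)
  qed
qed

text \<open>The index \<open>n\<close> stands for nu = n + 1. At most one factor nu is allowed,
  which corresponds to poles of order at most two.\<close>

inductive_set log_laurent :: "(nat \<Rightarrow> complex) set" where
  monomial: "d \<le> 1 \<Longrightarrow> (\<lambda>n. c * of_nat (Suc n) ^ d * qexp (of_int j * of_nat (Suc n))) \<in> log_laurent"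
| add: "u \<in> log_laurent \<Longrightarrow> v \<in> log_laurent \<Longrightarrow> (\<lambda>n. u n + v n) \<in> log_laurent"

text \<open>The error bound is required for every \<open>n\<close>, not just eventually, so that
  error series can be estimated term by term.\<close>

definition log_expansion :: "(nat \<Rightarrow> complex) \<Rightarrow> bool" where
  "log_expansion u \<longleftrightarrow> (\<forall>N. \<exists>p\<in>log_laurent. \<exists>C. \<forall>n. cmod (u n - p n) \<le> C * q ^ (N * Suc n))"

lemma continues_log_expansion:
  assumes "log_expansion u"
  shows "continues N u"
proof -
  obtain p C where p: "p \<in> log_laurent" and C: "\<And>n. cmod (u n - p n) \<le> C * q ^ (N * Suc n)"
    using assms unfolding log_expansion_def by blast
  have "continues N p"
    using p by induction (intro continues_monomial continues_add; assumption)+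
  from continues_add[OF this continues_small[of "\<lambda>n. u n - p n", OF C]] show ?thesis
    by simp
qed

text \<open>For each \<open>N\<close> there is a continuation to Re s > -N, and any two of them
  agree on the overlap by the identity theorem; gluing gives one function on the plane. The linear
  bound on \<open>u\<close> makes the series converge for Re s > 0, which rules out poles
  there.\<close>

lemma meromorphic_continuation_exists:
  assumes u: "log_expansion u" and bd: "\<And>n. cmod (u n) \<le> C * real (Suc n)"
  shows "\<exists>Z. Z meromorphic_on UNIV \<and>
    (\<forall>s. 0 < Re s \<longrightarrow> (\<lambda>n. u n * qexp (of_nat (Suc n) * s) * weight n s) sums Z s) \<and>
    (\<forall>z. is_pole Z z \<longrightarrow> Re z \<le> 0 \<and> z \<in> pole_lattice \<and> zorder Z z \<ge> -2)"
proof -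
  define F where "F s = (\<Sum>n. u n * qexp (of_nat (Suc n) * s) * weight n s)" for s
  have F_bd: "\<exists>M. summable M \<and> (\<forall>n s. cmod s \<le> R \<longrightarrow> 0 + \<delta> \<le> Re s \<longrightarrow>
     cmod (u n * qexp (of_nat (Suc n) * s) * weight n s) \<le> M n)" if \<delta>: "\<delta> > 0" for R \<delta>
  proof -
    define r where "r = q powr \<delta>"
    have r: "0 < r" "r < 1" using q_powr_less_1[OF \<delta>] q_pos by (auto simp: r_def)
    have "summable (\<lambda>n. real (Suc n) * r ^ n)"
      using geometric_deriv_sums[of r] r by (auto simp: sums_iff)
    then have "summable (\<lambda>n. \<bar>C\<bar> * exp (R * - ln (1 - q\<^sup>2)) * r * (real (Suc n) * r ^ n))"
      by (rule summable_mult)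
    moreover have "cmod (u n * qexp (of_nat (Suc n) * s) * weight n s) \<le>
        \<bar>C\<bar> * exp (R * - ln (1 - q\<^sup>2)) * r * (real (Suc n) * r ^ n)"
      if s: "cmod s \<le> R" "0 + \<delta> \<le> Re s" for n s
    proof -
      have 1: "cmod (u n) \<le> \<bar>C\<bar> * real (Suc n)"
        using bd[of n] by (smt (verit) abs_ge_self mult_right_mono of_nat_0_le_iff)
      have "q powr (real (Suc n) * Re s) \<le> q powr (\<delta> * real (Suc n))"
        using q_pos q_less_1 s by (intro powr_mono') (auto simp: mult.commute intro!: mult_left_mono)
      also have "\<dots> = r ^ Suc n"
        by (simp only: r_def q_powr_power)
      finally have 2: "cmod (qexp (of_nat (Suc n) * s)) \<le> r ^ Suc n"
        by (simp add: norm_qexp del: of_nat_Suc power_Suc)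
      have "cmod (u n * qexp (of_nat (Suc n) * s) * weight n s) \<le>
         (\<bar>C\<bar> * real (Suc n)) * r ^ Suc n * exp (R * - ln (1 - q\<^sup>2))"
        unfolding norm_mult using r by (intro mult_mono 1 2 weight_bound s) auto
      then show ?thesis by (simp add: mult_ac)
    qed
    ultimately show ?thesis by blast
  qed
  have F_hol: "F holomorphic_on {s. 0 < Re s}" and F_summable: "\<And>s. 0 < Re s \<Longrightarrow>
      summable (\<lambda>n. u n * qexp (of_nat (Suc n) * s) * weight n s)"
  proof -
    have h: "(\<lambda>s. u n * qexp (of_nat (Suc n) * s) * weight n s) holomorphic_on {s. 0 < Re s}" for n
      by (intro holomorphic_intros weight_holomorphic)
    show "F holomorphic_on {s. 0 < Re s}"
      unfolding F_def by (rule holomorphic_series_halfplane(1)[OF h F_bd])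
    show "summable (\<lambda>n. u n * qexp (of_nat (Suc n) * s) * weight n s)" if "0 < Re s" for s
      by (rule holomorphic_series_halfplane(2)[OF h F_bd that])
  qed
  have F_sums: "(\<lambda>n. u n * qexp (of_nat (Suc n) * s) * weight n s) sums F s" if "0 < Re s" for s
    unfolding F_def using F_summable[OF that] by (rule summable_sums)
  have "\<exists>Z. (\<forall>z. - real N < Re z \<longrightarrow> at_most_double_pole Z z) \<and>
     (\<exists>c. \<forall>s. c < Re s \<longrightarrow> (\<lambda>n. u n * qexp (of_nat (Suc n) * s) * weight n s) sums Z s)" for N
    using continues_log_expansion[OF u] unfolding continues_def by blast
  then obtain Z c where Z: "\<And>N z. - real N < Re z \<Longrightarrow> at_most_double_pole (Z N) z"
    and c: "\<And>N s. c N < Re s \<Longrightarrow> (\<lambda>n. u n * qexp (of_nat (Suc n) * s) * weight n s) sums Z N s"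
    by metis
  have Z_mero: "Z N meromorphic_on {s. - real N < Re s}" for N
    using Z at_most_double_pole_meromorphic by (subst meromorphic_on_meromorphic_at) auto
  have ZF: "\<forall>\<^sub>F s in at z. Z N s = F s" if "0 < Re z" for N z
  proof (rule meromorphic_on_eqI[where U = "{s. 0 < Re s}" and V = "{s. max 0 (c N) < Re s}"])
    show "Z N meromorphic_on {s. 0 < Re s}"
      by (rule meromorphic_on_subset[OF Z_mero[of N]]) auto
    show "F meromorphic_on {s. 0 < Re s}"
      using F_hol analytic_on_open[of "{s. 0 < Re s}" F] open_halfspace_Re_gt
      by (intro analytic_on_imp_meromorphic_on) auto
    have "complex_of_real (\<bar>c N\<bar> + 1) \<in> {s. max 0 (c N) < Re s}" by (auto; linarith)
    then show "{s. max 0 (c N) < Re s} \<noteq> {}" by blast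
    show "Z N s = F s" if "s \<in> {s. max 0 (c N) < Re s}" for s
      using that c[of N s] F_sums[of s] sums_unique2 by force
  qed (use that in \<open>auto simp: open_halfspace_Re_gt connected_halfplane simp del: max_less_iff_conj\<close>)
  have ZZ: "\<forall>\<^sub>F s in at z. Z N s = Z N' s" if "- real N < Re z" "- real N' < Re z" for N N' z
  proof (rule meromorphic_on_eqI[where U = "{s. max (- real N) (- real N') < Re s}"
        and V = "{s. max 0 (max (c N) (c N')) < Re s}"])
    show "Z N meromorphic_on {s. max (- real N) (- real N') < Re s}"
      by (rule meromorphic_on_subset[OF Z_mero[of N]]) auto
    show "Z N' meromorphic_on {s. max (- real N) (- real N') < Re s}"
      by (rule meromorphic_on_subset[OF Z_mero[of N']]) auto
    have "complex_of_real (\<bar>c N\<bar> + \<bar>c N'\<bar> + 1) \<in> {s. max 0 (max (c N) (c N')) < Re s}" by (auto;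
        linarith)
    then show "{s. max 0 (max (c N) (c N')) < Re s} \<noteq> {}" by blast
    show "Z N s = Z N' s" if "s \<in> {s. max 0 (max (c N) (c N')) < Re s}" for s
      using that c[of N s] c[of N' s] sums_unique2 by force
  qed (use that in \<open>auto simp: open_halfspace_Re_gt connected_halfplane simp del: max_less_iff_conj\<close>)
  \<comment> \<open>An integer above -Re s: the half-plane belonging to \<open>Z (\<nu> s)\<close>
    then contains \<open>s\<close>.\<close>
  define \<nu> where "\<nu> s = nat \<lceil>1 - Re s\<rceil>" for s
  have \<nu>: "- real (\<nu> s) < Re s" for s
    unfolding \<nu>_def by linarith
  \<comment> \<open>The functions \<open>Z N\<close> agree on punctured neighbourhoods only.
    Removing singularities makes the value at \<open>s\<close> independent of \<open>N\<close>, so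
    the index may vary with \<open>s\<close>.\<close>
  define Y where "Y s = remove_sings (Z (\<nu> s)) s" for s
  have rs: "remove_sings (Z N) s = remove_sings (Z N') s" if "- real N < Re s" "- real N' < Re s"
      for s N N'
    by (rule remove_sings_cong[OF ZZ[OF that] refl])
  have YZ: "\<forall>\<^sub>F s in at z. Y s = Z N s" if z: "- real N < Re z" for z N
  proof -
    have iso: "isolated_singularity_at (Z N) z"
      using at_most_double_pole_meromorphic[OF Z[OF z]] meromorphic_on_isolated_singularity by blast
    have "\<forall>\<^sub>F s in at z. s \<in> {s. - real N < Re s}"
      using z by (intro eventually_at_in_open') (auto simp: open_halfspace_Re_gt)
    then show ?thesis
      using eventually_remove_sings_eq_at[OF iso]
    proof eventually_elim
      case (elim s)
      then have "- real N < Re s" by simp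
      from rs[OF \<nu> this] elim(2) show ?case unfolding Y_def by simp
    qed
  qed
  have "Y meromorphic_on {z}" for z
    using at_most_double_pole_meromorphic[OF Z[OF \<nu>[of z]]] YZ[OF \<nu>[of z]]
      meromorphic_on_cong[of "{z}" Y "Z (\<nu> z)" "{z}"] by simp
  then have "Y meromorphic_on UNIV"
    by (subst meromorphic_on_meromorphic_at) auto
  moreover have FA: "F analytic_on {z}" if "0 < Re z" for z
    using that by (rule analytic_at_halfplane[OF F_hol])
  have "Y s = F s" if s: "0 < Re s" for s
  proof -
    have "remove_sings (Z (\<nu> s)) s = remove_sings F s"
      by (rule remove_sings_cong[OF ZF[OF s] refl])
    then show ?thesis using FA[OF s] by (simp add: Y_def)
  qed
  then have "(\<lambda>n. u n * qexp (of_nat (Suc n) * s) * weight n s) sums Y s" if "0 < Re s" for s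
    using F_sums[OF that] that by simp
  moreover have "Re z \<le> 0 \<and> z \<in> pole_lattice \<and> zorder Y z \<ge> -2" if p: "is_pole Y z" for z
  proof -
    have "Re z \<le> 0"
    proof (rule ccontr)
      assume "\<not> Re z \<le> 0"
      then have z: "0 < Re z" by simp
      have "\<forall>\<^sub>F s in at z. Y s = F s"
        using YZ[OF \<nu>[of z]] ZF[OF z, of "\<nu> z"] by eventually_elim simp
      then have "is_pole F z" using p is_pole_cong by blast
      then show False using FA[OF z] analytic_at_imp_no_pole by blast
    qed
    then show ?thesis
      using at_most_double_pole_cases[OF Z[OF \<nu>] YZ[OF \<nu>] p] by blast
  qed
  ultimately show ?thesis by blast
qed

text \<open>The series is the function \<open>E\<close>, with its double pole, plus a series with
  \<open>weight - 1\<close> in place of \<open>weight\<close>. The latter is analytic for Re s > -1,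
  which contains every zero of \<open>1 - qexp\<close>, so nothing can cancel the pole.\<close>

lemma continuation_pole:
  assumes Z: "Z meromorphic_on UNIV"
    and sums: "\<And>s. c < Re s \<Longrightarrow> (\<lambda>n. of_nat (Suc n) * qexp (of_nat (Suc n) * s) * weight n s) sums Z s"
    and z: "qexp z = 1"
  shows "is_pole Z z"
proof -
  define v where "v n s = of_nat (Suc n) * (weight n s - 1)" for n s
  have hol: "v n holomorphic_on {s. - real 1 < Re s}" for n
    unfolding v_def by (intro holomorphic_intros weight_holomorphic)
  have bd: "\<exists>B. \<forall>n s. cmod s \<le> R \<longrightarrow> cmod (v n s) \<le> B * q ^ (1 * Suc n)" for R
  proof -
    obtain B where B: "B \<ge> 0" "\<And>n s. cmod s \<le> R \<Longrightarrow> cmod (weight n s - 1) \<le> B * q ^ (2 * Suc n)"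
      using weight_expansion[of R 0] by auto
    obtain K where K: "\<And>n. real (Suc n) * q ^ Suc n \<le> K"
      using nat_times_power_bounded by blast
    have "cmod (v n s) \<le> (B * K) * q ^ (1 * Suc n)" if s: "cmod s \<le> R" for n s
    proof -
      have "cmod (v n s) \<le> real (Suc n) * (B * q ^ (2 * Suc n))"
        unfolding v_def norm_mult norm_of_nat by (intro mult_left_mono B s) auto
      \<comment> \<open>One factor absorbs \<open>Suc n\<close>, the other gives the abscissa
        -1.\<close>
      also have "q ^ (2 * Suc n) = q ^ Suc n * q ^ Suc n"
        by (simp add: mult_2 power_add)
      also have "real (Suc n) * (B * (q ^ Suc n * q ^ Suc n)) =
          B * (real (Suc n) * q ^ Suc n) * q ^ Suc n"
        by (simp only: mult_ac)
      also have "\<dots> \<le> B * K * q ^ Suc n"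
        using q_pos B by (intro mult_right_mono mult_left_mono K) auto
      finally show ?thesis by simp
    qed
    then show ?thesis by blast
  qed
  note H = holomorphic_dirichlet_series[of v 1, OF hol bd]
  define h where "h s = (\<Sum>n. v n s * qexp (of_nat (Suc n) * s))" for s
  define E where "E s = qexp s / (1 - qexp s)\<^sup>2" for s
  have Emero: "E meromorphic_on S" for S
    unfolding E_def by (intro meromorphic_intros analytic_on_imp_meromorphic_on analytic_intros)
  have h_ana: "h analytic_on {s}" if "- 1 < Re s" for s
    using H(1) that analytic_at_halfplane[of h "-1" s] unfolding h_def by simp
  have Rez: "Re z = 0"
    using z by (auto simp: qexp_eq_1_iff)
  have "\<forall>\<^sub>F s in at z. Z s = h s + E s"
  proof (rule meromorphic_on_eqI[where U = "{s. - 1 < Re s}" and V = "{s. max 0 c < Re s}"])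
    show "Z meromorphic_on {s. - 1 < Re s}"
      using Z by (rule meromorphic_on_subset) auto
    show "(\<lambda>s. h s + E s) meromorphic_on {s. - 1 < Re s}"
      using h_ana by (intro meromorphic_intros Emero analytic_on_imp_meromorphic_on)
         (subst analytic_on_analytic_at, auto)
    have "complex_of_real (\<bar>c\<bar> + 1) \<in> {s. max 0 c < Re s}" by (auto; linarith)
    then show "{s. max 0 c < Re s} \<noteq> {}" by blast
    show "z \<in> {s. - 1 < Re s}" using Rez by simp
    show "Z s = h s + E s" if "s \<in> {s. max 0 c < Re s}" for s
    proof -
      have s: "0 < Re s" "c < Re s" using that by auto
      have "(\<lambda>n. v n s * qexp (of_nat (Suc n) * s) + of_nat (Suc n) * qexp (of_nat (Suc n) * s)) sums
          (h s + E s)"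
        unfolding h_def E_def using s by (intro sums_add summable_sums H(2) geometric_qexp_sums) auto
      then have "(\<lambda>n. of_nat (Suc n) * qexp (of_nat (Suc n) * s) * weight n s) sums (h s + E s)"
        by (simp add: v_def algebra_simps)
      then show ?thesis using sums[OF s(2)] sums_unique2 by blast
    qed
  qed (auto simp: open_halfspace_Re_gt connected_halfplane simp del: max_less_iff_conj)
  moreover have "is_pole (\<lambda>s. h s + E s) z"
  proof -
    have "qexp (z + 0) = 1" using z by simp
    then obtain k where k: "k analytic_on {z}" "k z \<noteq> 0" "\<And>s. 1 - qexp (s + 0) = k s * (s - z)"
      by (rule qexp_simple_zero) blast
    have "(\<lambda>s. qexp s / (k s)\<^sup>2) analytic_on {z}"
      by (intro analytic_intros k) (use k in auto)
    then have "isCont (\<lambda>s. qexp s / (k s)\<^sup>2) z"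
      by (rule analytic_at_imp_isCont)
    moreover have "filterlim (\<lambda>s. (s - z)\<^sup>2) (at 0) (at z)"
      by (intro filterlim_atI tendsto_eq_intros) (auto simp: eventually_at_filter)
    ultimately have "is_pole (\<lambda>s. (qexp s / (k s)\<^sup>2) / (s - z)\<^sup>2) z"
      by (rule is_pole_divide) (use k in simp)
    also have "(\<lambda>s. (qexp s / (k s)\<^sup>2) / (s - z)\<^sup>2) = E"
      using k(3) by (simp add: E_def power_mult_distrib fun_eq_iff)
    finally have "filterlim E at_infinity (at z)" by (simp add: is_pole_def)
    moreover have "h \<midarrow>z\<rightarrow> h z"
      using h_ana[of z] Rez analytic_at_imp_isCont isCont_def by fastforce
    ultimately show ?thesis
      unfolding is_pole_def using tendsto_add_filterlim_at_infinity by blast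
  qed
  ultimately show ?thesis using is_pole_cong[of Z "\<lambda>s. h s + E s" z z] by simp
qed


subsection \<open>Asymptotic expansions\<close>

lemma qexp_cnj: "cnj (qexp z) = qexp (cnj z)"
  by (simp add: qexp_def exp_cnj)

inductive_set laurent :: "(real \<Rightarrow> complex) set" where
  monomial: "(\<lambda>l. c * qexp (of_int j * of_real l)) \<in> laurent"
| add: "u \<in> laurent \<Longrightarrow> v \<in> laurent \<Longrightarrow> (\<lambda>l. u l + v l) \<in> laurent"

lemma laurent_zero: "(\<lambda>l. 0) \<in> laurent"
  using laurent.monomial[of 0 0] by simp

lemma laurent_sum: "(\<And>k. k \<in> A \<Longrightarrow> u k \<in> laurent) \<Longrightarrow> (\<lambda>l. \<Sum>k\<in>A. u k l) \<in> laurent"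
proof (induction A rule: infinite_finite_induct)
  case (insert x A)
  then show ?case using laurent.add[of "u x" "\<lambda>l. \<Sum>k\<in>A. u k l"] by simp
qed (auto simp: laurent_zero)

lemma laurent_mult:
  assumes "u \<in> laurent" "v \<in> laurent"
  shows "(\<lambda>l. u l * v l) \<in> laurent"
  using assms
proof (induction arbitrary: v)
  case (monomial c j)
  from monomial show ?case
  proof induction
    case (monomial d k)
    have "(\<lambda>l. (c * d) * qexp (of_int (j + k) * of_real l)) \<in> laurent"
      by (rule laurent.monomial)
    then show ?case by (simp add: qexp_add distrib_right mult.assoc mult.left_commute)
  next
    case (add u v)
    then show ?case using laurent.add[OF add.IH] by (simp add: distrib_left)
  qed
next
  case (add u v w)
  then show ?case using laurent.add[OF add.IH(1,2)[OF add.prems]] by (simp add: distrib_right)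
qed

lemma laurent_shift:
  assumes "u \<in> laurent" shows "(\<lambda>l. u (l + a)) \<in> laurent"
  using assms
proof induction
  case (monomial c j)
  have "(\<lambda>l. (c * qexp (of_int j * of_real a)) * qexp (of_int j * of_real l)) \<in> laurent"
    by (rule laurent.monomial)
  then show ?case by (simp add: qexp_add distrib_left mult_ac)
qed (rule laurent.add)

lemma laurent_cnj:
  assumes "u \<in> laurent" shows "(\<lambda>l. cnj (u l)) \<in> laurent"
  using assms
proof induction
  case (monomial c j)
  then show ?case using laurent.monomial[of "cnj c" j] by (simp add: qexp_cnj)
next
  case (add u v)
  then show ?case using laurent.add[OF add.IH] by simp
qed

lemma qexp_bigo: "a \<ge> b \<Longrightarrow> (\<lambda>l. qexp (of_real a * of_real l)) \<in> O(\<lambda>l. qexp (of_real b * of_real l))"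
  by (intro bigoI[of _ 1] eventually_mono[OF eventually_ge_at_top[of 0]])
     (use q_pos q_less_1 in \<open>auto simp: norm_qexp intro!: powr_mono' mult_right_mono\<close>)

lemma laurent_bigo:
  assumes "u \<in> laurent" shows "\<exists>M::nat. u \<in> O(\<lambda>l. qexp (of_real (- real M) * of_real l))"
  using assms
proof induction
  case (monomial c j)
  have "(\<lambda>l. qexp (of_int j * of_real l)) \<in> O(\<lambda>l. qexp (of_real (- real (nat \<bar>j\<bar>)) * of_real l))"
    using qexp_bigo[of "- real (nat \<bar>j\<bar>)" "of_int j"] by simp
  then show ?case by (intro exI[of _ "nat \<bar>j\<bar>"]) simp
next
  case (add u v)
  then obtain M M' where M: "u \<in> O(\<lambda>l. qexp (of_real (- real M) * of_real l))"
    "v \<in> O(\<lambda>l. qexp (of_real (- real M') * of_real l))" by blast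
  have "u \<in> O(\<lambda>l. qexp (of_real (- real (max M M')) * of_real l))"
    "v \<in> O(\<lambda>l. qexp (of_real (- real (max M M')) * of_real l))"
    by (rule landau_o.big_trans[OF M(1) qexp_bigo] landau_o.big_trans[OF M(2) qexp_bigo]; simp)+
  then show ?case using sum_in_bigo(1) by blast
qed

text \<open>The variable \<open>l\<close> is real, so that the shifts l + a of the matrix elements
  make sense. The expansion is asymptotic for large \<open>l\<close>; the comparison function is
  complex valued because the O-notation requires the type of \<open>g\<close>.\<close>

definition expansion :: "(real \<Rightarrow> complex) \<Rightarrow> bool" where
  "expansion g \<longleftrightarrow> (\<forall>N::nat. \<exists>p\<in>laurent. (\<lambda>l. g l - p l) \<in> O(\<lambda>l. qexp (of_nat N * of_real l)))"

lemma expansion_laurent: "p \<in> laurent \<Longrightarrow> expansion p"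
  unfolding expansion_def by (auto intro!: bexI[of _ p])

lemma expansion_const: "expansion (\<lambda>l. c)"
  using expansion_laurent[OF laurent.monomial[of c 0]] by simp

lemma expansion_add:
  assumes "expansion g" "expansion h" shows "expansion (\<lambda>l. g l + h l)"
  unfolding expansion_def
proof
  fix N
  obtain p r where p: "p \<in> laurent" "(\<lambda>l. g l - p l) \<in> O(\<lambda>l. qexp (of_nat N * of_real l))"
    and r: "r \<in> laurent" "(\<lambda>l. h l - r l) \<in> O(\<lambda>l. qexp (of_nat N * of_real l))"
    using assms unfolding expansion_def by blast
  have "(\<lambda>l. (g l - p l) + (h l - r l)) \<in> O(\<lambda>l. qexp (of_nat N * of_real l))"
    by (rule sum_in_bigo(1)[OF p(2) r(2)])
  then show "\<exists>p\<in>laurent. (\<lambda>l. g l + h l - p l) \<in> O(\<lambda>l. qexp (of_nat N * of_real l))"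
    by (intro bexI[OF _ laurent.add[OF p(1) r(1)]]) (simp add: algebra_simps)
qed

lemma expansion_bigo:
  assumes "expansion g" shows "\<exists>M::nat. g \<in> O(\<lambda>l. qexp (of_real (- real M) * of_real l))"
proof -
  obtain p where p: "p \<in> laurent" "(\<lambda>l. g l - p l) \<in> O(\<lambda>l. qexp (of_nat 0 * of_real l))"
    using assms unfolding expansion_def by blast
  obtain M where M: "p \<in> O(\<lambda>l. qexp (of_real (- real M) * of_real l))"
    using laurent_bigo[OF p(1)] by blast
  have "(\<lambda>l. g l - p l) \<in> O(\<lambda>l. qexp (of_real (- real M) * of_real l))"
    using landau_o.big_trans[OF p(2)] qexp_bigo[of "- real M" 0] by simp
  from sum_in_bigo(1)[OF this M] show ?thesis by auto
qed

lemma expansion_mult: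
  assumes g: "expansion g" and h: "expansion h" shows "expansion (\<lambda>l. g l * h l)"
  unfolding expansion_def
proof
  fix N
  obtain M M' where M: "g \<in> O(\<lambda>l. qexp (of_real (- real M) * of_real l))"
    "h \<in> O(\<lambda>l. qexp (of_real (- real M') * of_real l))"
    using expansion_bigo g h by blast
  \<comment> \<open>Each factor is approximated beyond order \<open>N\<close> by the growth exponent
    of the other one.\<close>
  obtain p r where p: "p \<in> laurent" "(\<lambda>l. g l - p l) \<in> O(\<lambda>l. qexp (of_nat (N + M') * of_real l))"
    and r: "r \<in> laurent" "(\<lambda>l. h l - r l) \<in> O(\<lambda>l. qexp (of_nat (N + M) * of_real l))"
    using assms unfolding expansion_def by blast
  have "(\<lambda>l. g l - p l) \<in> O(\<lambda>l. qexp (of_real (- real M) * of_real l))"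
    using landau_o.big_trans[OF p(2)] qexp_bigo[of "- real M" "real (N + M')"] by simp
  from sum_in_bigo(2)[OF M(1) this] have pM: "p \<in> O(\<lambda>l. qexp (of_real (- real M) * of_real l))"
    by simp
  have "(\<lambda>l. (g l - p l) * h l) \<in> O(\<lambda>l. qexp (of_nat (N + M') * of_real l) *
      qexp (of_real (- real M') * of_real l))"
    by (rule landau_o.big.mult[OF p(2) M(2)])
  moreover have "(\<lambda>l. p l * (h l - r l)) \<in> O(\<lambda>l. qexp (of_real (- real M) * of_real l) *
      qexp (of_nat (N + M) * of_real l))"
    by (rule landau_o.big.mult[OF pM r(2)])
  moreover have "qexp (of_nat (N + M') * of_real l) * qexp (of_real (- real M') * of_real l) =
      qexp (of_nat N * of_real l)"
     "qexp (of_real (- real M) * of_real l) * qexp (of_nat (N + M) * of_real l) =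
         qexp (of_nat N * of_real l)" for l :: real
    by (simp_all add: qexp_add[symmetric] algebra_simps)
  ultimately have "(\<lambda>l. (g l - p l) * h l + p l * (h l - r l)) \<in> O(\<lambda>l. qexp (of_nat N * of_real l))"
    by (intro sum_in_bigo(1)) simp_all
  then show "\<exists>p\<in>laurent. (\<lambda>l. g l * h l - p l) \<in> O(\<lambda>l. qexp (of_nat N * of_real l))"
    by (intro bexI[OF _ laurent_mult[OF p(1) r(1)]]) (simp add: algebra_simps)
qed

lemma expansion_power: "expansion g \<Longrightarrow> expansion (\<lambda>l. g l ^ k)"
  by (induction k) (auto intro: expansion_const expansion_mult)

lemma expansion_cnj:
  assumes "expansion g" shows "expansion (\<lambda>l. cnj (g l))"
  unfolding expansion_def
proof
  fix N
  obtain p where p: "p \<in> laurent" "(\<lambda>l. g l - p l) \<in> O(\<lambda>l. qexp (of_nat N * of_real l))"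
    using assms unfolding expansion_def by blast
  have "(\<lambda>l. cnj (g l) - cnj (p l)) \<in> O(\<lambda>l. qexp (of_nat N * of_real l))"
    using p(2) unfolding bigo_def by (simp add: complex_cnj_diff[symmetric] del: complex_cnj_diff)
  then show "\<exists>p\<in>laurent. (\<lambda>l. cnj (g l) - p l) \<in> O(\<lambda>l. qexp (of_nat N * of_real l))"
    by (intro bexI[OF _ laurent_cnj[OF p(1)]])
qed

lemma expansion_shift:
  assumes "expansion g" shows "expansion (\<lambda>l. g (l + a))"
  unfolding expansion_def
proof
  fix N
  obtain p where p: "p \<in> laurent" "(\<lambda>l. g l - p l) \<in> O(\<lambda>l. qexp (of_nat N * of_real l))"
    using assms unfolding expansion_def by blast
  have "filterlim (\<lambda>l::real. l + a) at_top at_top"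
    by (rule filterlim_tendsto_add_at_top[where f = "\<lambda>_. a", THEN filterlim_cong[OF refl refl,
        THEN iffD1, rotated]])
       (auto simp: add.commute intro: filterlim_ident)
  from landau_o.big.compose[OF p(2) this]
  have "(\<lambda>l. g (l + a) - p (l + a)) \<in> O(\<lambda>l. qexp (of_nat N * of_real (l + a)))" .
  also have "(\<lambda>l. qexp (of_nat N * of_real (l + a))) =
      (\<lambda>l. qexp (of_nat N * of_real a) * qexp (of_nat N * of_real l))"
    by (simp add: qexp_add distrib_left mult_ac fun_eq_iff)
  finally have "(\<lambda>l. g (l + a) - p (l + a)) \<in> O(\<lambda>l. qexp (of_nat N * of_real l))"
    by simp
  then show "\<exists>p\<in>laurent. (\<lambda>l. g (l + a) - p l) \<in> O(\<lambda>l. qexp (of_nat N * of_real l))"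
    by (intro bexI[OF _ laurent_shift[OF p(1)]])
qed

text \<open>Truncated geometric series in z = t q^(kl): the remainder is z^N / (1 - z), and once |z|
  < 1/2 it is at most 2 |t|^N q^(Nl), because k is at least 1.\<close>

lemma expansion_inverse:
  assumes k: "k > 0"
  shows "expansion (\<lambda>l. 1 / (1 - t * qexp (of_nat k * of_real l)))"
  unfolding expansion_def
proof
  fix N
  define p where "p l = (\<Sum>i<N. t ^ i * qexp (of_int (int k * int i) * of_real l))" for l :: real
  have p: "p \<in> laurent"
    unfolding p_def by (intro laurent_sum laurent.monomial)
  have "((\<lambda>l. exp (ln q * real k * l)) \<longlongrightarrow> 0) at_top"
    by (rule filterlim_compose[OF exp_at_bot], rule filterlim_tendsto_neg_mult_at_bot[OF tendsto_const
        _ filterlim_ident])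
       (use ln_q_neg k in \<open>simp add: mult_neg_pos\<close>)
  then have "((\<lambda>l. cmod t * exp (ln q * real k * l)) \<longlongrightarrow> 0) at_top"
    by (rule tendsto_mult_right_zero)
  then have "\<forall>\<^sub>F l in at_top. cmod t * exp (ln q * real k * l) < 1 / 2"
    by (rule order_tendstoD) simp
  then have ev: "\<forall>\<^sub>F l in at_top. cmod (t * qexp (of_nat k * of_real l)) < 1 / 2"
    by (simp add: norm_mult qexp_def mult.assoc)
  have "(\<lambda>l. 1 / (1 - t * qexp (of_nat k * of_real l)) - p l) \<in> O(\<lambda>l. qexp (of_nat N * of_real l))"
  proof (rule bigoI[of _ "2 * cmod t ^ N"])
    show "\<forall>\<^sub>F l in at_top. cmod (1 / (1 - t * qexp (of_nat k * of_real l)) - p l)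
       \<le> 2 * cmod t ^ N * cmod (qexp (of_nat N * of_real l))"
      using ev eventually_ge_at_top[of 0]
    proof eventually_elim
      case (elim l)
      define z where "z = t * qexp (of_nat k * of_real l)"
      have z: "cmod z < 1 / 2" "z \<noteq> 1" using elim by (auto simp: z_def)
      have "p l = (\<Sum>i<N. z ^ i)"
        unfolding p_def z_def power_mult_distrib
      proof (intro sum.cong refl)
        fix i
        have "of_int (int k * int i) * complex_of_real l = of_nat i * (of_nat k * of_real l)"
          by simp
        then show "t ^ i * qexp (of_int (int k * int i) * of_real l) =
            t ^ i * qexp (of_nat k * of_real l) ^ i"
          by (simp only: qexp_of_nat_mult[of i])
      qed
      also have "\<dots> = (1 - z ^ N) / (1 - z)"
        using z by (simp add: sum_gp_strict)
      finally have e: "1 / (1 - z) - p l = z ^ N / (1 - z)"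
        by (simp add: diff_divide_distrib)
      have "cmod (1 - z) \<ge> 1 / 2"
        using norm_triangle_ineq2[of 1 z] z by simp
      then have "cmod (1 / (1 - z) - p l) \<le> cmod z ^ N / (1 / 2)"
        unfolding e norm_divide norm_power by (intro divide_left_mono) auto
      also have "\<dots> = 2 * cmod t ^ N * cmod (qexp (of_nat k * of_real l)) ^ N"
        by (simp add: z_def norm_mult power_mult_distrib)
      also have "\<dots> \<le> 2 * cmod t ^ N * cmod (qexp (of_real l)) ^ N"
        using elim q_pos q_less_1 k
        by (intro mult_left_mono power_mono) (auto simp: norm_qexp mult_le_cancel_right1 intro!:
            powr_mono')
      finally show ?case by (simp only: z_def qexp_of_nat_mult[of N] norm_power)
    qed
  qed
  then show "\<exists>p\<in>laurent. (\<lambda>l. 1 / (1 - t * qexp (of_nat k * of_real l)) - p l) \<in>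
      O(\<lambda>l. qexp (of_nat N * of_real l))"
    using p by blast
qed

lemma expansion_powr: "expansion (\<lambda>l. of_real (q powr (of_int j * l + c)))"
proof -
  have "(\<lambda>l. of_real (q powr (of_int j * l + c))) =
      (\<lambda>l. of_real (q powr c) * qexp (of_int j * of_real l))"
    by (simp add: fun_eq_iff qexp_of_real[symmetric] qexp_add[symmetric] add.commute)
  then show ?thesis using expansion_laurent[OF laurent.monomial] by simp
qed

lemma q_gap: "1 / q - q > 0"
  using q_pos q_less_1 by (simp add: field_simps) (metis mult_strict_mono' less_imp_le mult_1 q_pos)

lemma qnum_eq: "qnum q x = q powr (- x) * (1 - q powr (2 * x)) / (1 / q - q)"
  using q_pos by (simp add: qnum_def right_diff_distrib powr_add[symmetric])

lemma inverse_qnum_eq: "1 / qnum q x = (1 / q - q) * q powr x * (1 / (1 - q powr (2 * x)))"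
  using q_pos by (simp add: qnum_eq powr_minus field_simps)

lemma expansion_inverse_powr:
  assumes "k > 0"
  shows "expansion (\<lambda>l. of_real (1 / (1 - c * q powr (of_nat k * l + d))))"
proof -
  have "of_real (1 / (1 - c * q powr (of_nat k * l + d))) =
     1 / (1 - of_real (c * q powr d) * qexp (of_nat k * of_real l))" for l :: real
  proof -
    have "qexp (of_nat k * of_real l) = of_real (q powr (of_nat k * l))"
      using qexp_of_real[of "of_nat k * l"] by simp
    then show ?thesis by (simp add: powr_add mult_ac)
  qed
  then show ?thesis using expansion_inverse[OF assms] by (simp only:)
qed

lemma expansion_inverse_qnum:
  assumes "k > 0"
  shows "expansion (\<lambda>l. of_real (1 / qnum q (of_nat k * l + c)))"
proof -
  have "expansion (\<lambda>l. of_real (1 / q - q) * of_real (q powr (of_int (int k) * l + c)) *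
      of_real (1 / (1 - 1 * q powr (of_nat (2 * k) * l + 2 * c))))"
    by (intro expansion_mult expansion_const expansion_powr expansion_inverse_powr) (use assms in simp)
  then show ?thesis
    unfolding inverse_qnum_eq by (simp add: algebra_simps)
qed

text \<open>The radicand in the denominator of \<open>alpha_plus\<close>.\<close>

definition rho :: "real \<Rightarrow> real" where
  "rho l = qnum q (2 * l + 2) * (qnum q (4 * l + 4) + qnum q 2 * qnum q (2 * l + 2))"

text \<open>With u = q^(2l+2) one has [4l+4] = [2l+2] (1/u + u) and [2] = 1/q + q, and 1/u + u + 1/q
  + q = (1 + uq)(1 + u/q) / u. In this form the reciprocal of each factor has an expansion.\<close>

lemma rho_factor:
  "rho l = (qnum q (2 * l + 2))\<^sup>2 * q powr (- (2 * l + 2)) * (1 + q powr (2 * l + 3)) * (1 +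
      q powr (2 * l + 1))"
proof -
  define x where "x = 2 * l + 2"
  define u where "u = q powr x"
  have u: "u > 0" using q_pos by (simp add: u_def)
  have h: "1 / q - q \<noteq> 0" using q_gap by simp
  have 1: "q powr (4 * l + 4) = u\<^sup>2"
    using q_pos by (simp add: u_def x_def powr_power algebra_simps)
  have 2: "q powr (2 * l + 3) = u * q" "q powr (2 * l + 1) = u / q"
    using q_pos by (simp_all add: u_def x_def powr_add powr_diff powr_numeral power3_eq_cube
        power2_eq_square)
  have 3: "qnum q 2 = 1 / q + q"
    using q_pos q_gap h unfolding qnum_def powr_minus
        by (simp add: powr_numeral field_simps power2_eq_square)
  have 4: "qnum q x = (1 / u - u) / (1 / q - q)"
    using q_pos unfolding qnum_def powr_minus u_def[symmetric] by (simp add: divide_inverse)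
  have 5: "qnum q (4 * l + 4) = (1 / u - u) / (1 / q - q) * (1 / u + u)"
    unfolding qnum_def powr_minus 1 using u by (simp add: field_simps power2_eq_square)
  have generalize: "a * (a * (1 / u + u) + (1 / q + q) * a) =
      a\<^sup>2 * inverse u * (1 + u * q) * (1 + u / q)" for a
    using u q_pos by (simp add: field_simps power2_eq_square)
  show ?thesis
    unfolding rho_def 3 5 2 powr_minus x_def[symmetric] u_def[symmetric] unfolding 4
    using generalize[of "(1 / u - u) / (1 / q - q)"] by (simp only: mult_ac)
qed

lemma expansion_inverse_rho: "expansion (\<lambda>l. of_real (1 / rho l))"
proof -
  have "1 / rho l = (1 / qnum q (of_nat 2 * l + 2))\<^sup>2 * q powr (of_int 2 * l + 2) *
      (1 / (1 - (-1) * q powr (of_nat 2 * l + 3))) * (1 / (1 - (-1) * q powr (of_nat 2 * l + 1)))" for l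
    unfolding rho_factor powr_minus by (simp add: divide_simps)
  moreover have "expansion (\<lambda>l. of_real (1 / qnum q (of_nat 2 * l + 2)) ^ 2 *
      of_real (q powr (of_int 2 * l + 2)) *
      of_real (1 / (1 - (-1) * q powr (of_nat 2 * l + 3))) * of_real (1 / (1 - (-1) *
          q powr (of_nat 2 * l + 1))))"
    by (intro expansion_mult expansion_power expansion_inverse_qnum expansion_powr
        expansion_inverse_powr) auto
  ultimately show ?thesis by simp
qed

section \<open>Coefficients and their sums over a level\<close>

text \<open>\<open>m\<close> enters only through pure exponentials, so that sums over
  \<open>m\<close> can be evaluated exactly; only the dependence on \<open>l\<close> is
  asymptotic.\<close>

inductive_set coefficient :: "(label \<Rightarrow> complex) set" where
  monomial: "(\<And>e. expansion (g e)) \<Longrightarrow>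
     (\<lambda>i. qexp (of_int j * of_real (fst (snd i))) * g (snd (snd i)) (fst i)) \<in> coefficient"
| add: "f \<in> coefficient \<Longrightarrow> g \<in> coefficient \<Longrightarrow> (\<lambda>i. f i + g i) \<in> coefficient"

lemma coefficient_expansion:
  "(\<And>e. expansion (g e)) \<Longrightarrow> (\<lambda>i. g (snd (snd i)) (fst i)) \<in> coefficient"
  using coefficient.monomial[of g 0] by simp

lemma coefficient_const: "(\<lambda>i. c) \<in> coefficient"
  using coefficient_expansion[of "\<lambda>e l. c"] by (simp add: expansion_const)

lemma coefficient_mult:
  assumes "f \<in> coefficient" "g \<in> coefficient"
  shows "(\<lambda>i. f i * g i) \<in> coefficient"
  using assms
proof (induction arbitrary: g)
  case (monomial a j)
  from monomial(2) show ?case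
  proof induction
    case (monomial b k)
    have "(\<lambda>i. qexp (of_int (j + k) * of_real (fst (snd i))) * (a (snd (snd i)) (fst i) *
        b (snd (snd i)) (fst i))) \<in> coefficient"
      by (intro coefficient.monomial[of "\<lambda>e l. a e l * b e l"]
          expansion_mult \<open>\<And>e. expansion (a e)\<close> monomial)
    then show ?case by (simp add: qexp_add distrib_right mult.assoc mult.left_commute)
  next
    case (add u v)
    then show ?case using coefficient.add[OF add.IH] by (simp add: distrib_left)
  qed
next
  case (add u v w)
  then show ?case using coefficient.add[OF add.IH(1,2)[OF add.prems]] by (simp add: distrib_right)
qed

text \<open>For products of operators, where the second coefficient is read at a shifted label.
  Inequality of booleans is exclusive or: \<open>s = True\<close> exchanges the two signs.\<close>

lemma coefficient_shift:
  assumes "f \<in> coefficient"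
  shows "(\<lambda>i. f (fst i + a, fst (snd i) + b, snd (snd i) \<noteq> s)) \<in> coefficient"
  using assms
proof induction
  case (monomial g j)
  have "(\<lambda>i. qexp (of_int j * of_real (fst (snd i))) * (qexp (of_int j * of_real b) *
      g (snd (snd i) \<noteq> s) (fst i + a))) \<in> coefficient"
    by (intro coefficient.monomial[of "\<lambda>e l. qexp (of_int j * of_real b) * g (e \<noteq> s) (l + a)"]
        expansion_mult
        expansion_const expansion_shift monomial)
  then show ?case by (simp add: qexp_add distrib_left mult.assoc)
next
  case (add f g)
  then show ?case using coefficient.add[OF add.IH] by simp
qed

text \<open>The effect of conjugation by J on coefficients. The exponent \<open>j\<close> changes
  sign together with \<open>m\<close>, and \<open>qexp\<close> is real on real arguments.\<close>

lemma coefficient_reflect: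
  assumes "f \<in> coefficient"
  shows "(\<lambda>i. cnj (f (fst i, - fst (snd i), \<not> snd (snd i)))) \<in> coefficient"
  using assms
proof induction
  case (monomial g j)
  have "(\<lambda>i. qexp (of_int (- j) * of_real (fst (snd i))) * cnj (g (\<not> snd (snd i)) (fst i))) \<in>
      coefficient"
    by (intro coefficient.monomial[of "\<lambda>e l. cnj (g (\<not> e) l)"] expansion_cnj monomial)
  then show ?case by (simp add: qexp_cnj)
next
  case (add f g)
  then show ?case using coefficient.add[OF add.IH] by simp
qed

lemma coefficient_powr:
  "(\<lambda>i. of_real (q powr (of_int j * fst i + of_int k * fst (snd i) + c))) \<in> coefficient"
proof -
  have "(\<lambda>i::label. qexp (of_int k * of_real (fst (snd i))) * of_real (q powr (of_int j * fst i +
      c))) \<in> coefficient"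
    by (intro coefficient.monomial[of "\<lambda>e l. of_real (q powr (of_int j * l + c))"] expansion_powr)
  then show ?thesis
    by (simp add: qexp_of_real[symmetric] qexp_add[symmetric] add_ac)
qed

lemma coefficient_qnum:
  "(\<lambda>i. of_real (qnum q (of_int j * fst i + of_int k * fst (snd i) + c))) \<in> coefficient"
proof -
  have "(\<lambda>i::label. of_real (1 / (1 / q - q)) * (of_real (q powr (of_int (- j) * fst i +
      of_int (- k) * fst (snd i) + (- c)))
     + - 1 * of_real (q powr (of_int j * fst i + of_int k * fst (snd i) + c)))) \<in> coefficient"
    by (intro coefficient_mult coefficient_const coefficient.add coefficient_powr)
  moreover have "of_real (1 / (1 / q - q)) * (of_real (q powr (of_int (- j) * l + of_int (- k) * m +
      (- c)))
     + - 1 * of_real (q powr (of_int j * l + of_int k * m + c))) =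
         complex_of_real (qnum q (of_int j * l + of_int k * m + c))" for l m
    by (simp add: qnum_def)
  ultimately show ?thesis by simp
qed

lemma log_expansion_add:
  assumes "log_expansion u" "log_expansion v"
  shows "log_expansion (\<lambda>n. u n + v n)"
  unfolding log_expansion_def
proof
  fix N
  obtain p C where p: "p \<in> log_laurent" "\<And>n. cmod (u n - p n) \<le> C * q ^ (N * Suc n)"
    using assms unfolding log_expansion_def by blast
  obtain r D where r: "r \<in> log_laurent" "\<And>n. cmod (v n - r n) \<le> D * q ^ (N * Suc n)"
    using assms unfolding log_expansion_def by blast
  have "cmod (u n + v n - (p n + r n)) \<le> (C + D) * q ^ (N * Suc n)" for n
    using norm_triangle_mono[OF p(2) r(2), of n n] by (simp add: algebra_simps)
  then show "\<exists>p\<in>log_laurent. \<exists>C. \<forall>n. cmod (u n + v n - p n) \<le> C * q ^ (N * Suc n)"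
    using log_laurent.add[OF p(1) r(1)] by (intro bexI[of _ "\<lambda>n. p n + r n"] exI[of _ "C + D"] allI)
qed

text \<open>For pseudodifferential operators, where the approximating operator itself depends on
  \<open>N\<close>.\<close>

lemma log_expansion_approx:
  assumes "\<And>N. \<exists>v C. log_expansion v \<and> (\<forall>n. cmod (u n - v n) \<le> C * q ^ (N * Suc n))"
  shows "log_expansion u"
  unfolding log_expansion_def
proof
  fix N
  obtain v C where v: "log_expansion v" "\<And>n. cmod (u n - v n) \<le> C * q ^ (N * Suc n)"
    using assms by blast
  obtain r D where r: "r \<in> log_laurent" "\<And>n. cmod (v n - r n) \<le> D * q ^ (N * Suc n)"
    using v(1) unfolding log_expansion_def by blast
  have "cmod (u n - r n) \<le> (C + D) * q ^ (N * Suc n)" for n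
    using norm_triangle_mono[OF v(2) r(2), of n n] by (simp add: algebra_simps)
  then show "\<exists>p\<in>log_laurent. \<exists>C. \<forall>n. cmod (u n - p n) \<le> C * q ^ (N * Suc n)"
    using r(1) by blast
qed

text \<open>The finitely many exceptional ratios are added to the constant.\<close>

lemma eventually_bound_imp_bound:
  fixes f g :: "nat \<Rightarrow> real"
  assumes "\<forall>\<^sub>F n in sequentially. f n \<le> C * g n" "\<And>n. g n > 0"
  shows "\<exists>C. \<forall>n. f n \<le> C * g n"
proof -
  obtain n0 where n0: "\<And>n. n \<ge> n0 \<Longrightarrow> f n \<le> C * g n"
    using assms(1) unfolding eventually_sequentially by blast
  define D where "D = \<bar>C\<bar> + (\<Sum>k<n0. \<bar>f k\<bar> / g k)"
  have g0: "g n \<ge> 0" for n using assms(2) less_imp_le by blast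
  have "f n \<le> D * g n" for n
  proof (cases "n < n0")
    case True
    have "\<bar>f n\<bar> / g n \<le> (\<Sum>k<n0. \<bar>f k\<bar> / g k)"
      using True g0 by (intro member_le_sum) auto
    then have "\<bar>f n\<bar> / g n \<le> D" by (simp add: D_def)
    then have "\<bar>f n\<bar> \<le> D * g n" using assms(2)[of n] by (simp add: divide_le_eq)
    then show ?thesis by simp
  next
    case False
    have "(\<Sum>k<n0. \<bar>f k\<bar> / g k) \<ge> 0" using g0 by (intro sum_nonneg) auto
    then have "C \<le> D" by (simp add: D_def)
    then have "C * g n \<le> D * g n" using g0 by (rule mult_right_mono)
    then show ?thesis using n0[of n] False by simp
  qed
  then show ?thesis by blast
qed

text \<open>Passing from l to nu = l + 1/2 turns q^(jl) into q^(-j/2) q^(j nu): only constants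
  change and the exponents remain integers.\<close>

lemma log_expansion_expansion:
  assumes g: "expansion g" and d: "d \<le> 1"
  shows "log_expansion (\<lambda>n. of_nat (Suc n) ^ d * g (real n + 1 / 2))"
  unfolding log_expansion_def
proof
  fix N
  \<comment> \<open>Order N + 1, since the factor \<open>Suc n ^ d\<close> costs one power.\<close>
  obtain p where p: "p \<in> laurent" "(\<lambda>l. g l - p l) \<in> O(\<lambda>l. qexp (of_nat (N + 1) * of_real l))"
    using g unfolding expansion_def by blast
  have half: "real n + 1 / 2 = real (Suc n) - 1 / 2" for n by simp
  have mem: "(\<lambda>n. of_nat (Suc n) ^ d * p (real n + 1 / 2)) \<in> log_laurent"
    using p(1)
  proof induction
    case (monomial c j)
    have "(\<lambda>n. (c * qexp (- of_int j / 2)) * of_nat (Suc n) ^ d * qexp (of_int j * of_nat (Suc n))) \<in>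
        log_laurent"
      by (rule log_laurent.monomial[OF d])
    moreover have "of_nat (Suc n) ^ d * (c * qexp (of_int j * of_real (real n + 1 / 2))) =
       (c * qexp (- of_int j / 2)) * of_nat (Suc n) ^ d * qexp (of_int j * of_nat (Suc n))" for n
    proof -
      have "of_int j * complex_of_real (real n + 1 / 2) = - of_int j / 2 + of_int j * of_nat (Suc n)"
        unfolding half by (simp add: algebra_simps)
      then have "qexp (of_int j * complex_of_real (real n + 1 / 2)) =
          qexp (- of_int j / 2) * qexp (of_int j * of_nat (Suc n))"
        by (simp only: qexp_add)
      then show ?thesis by (simp only: mult_ac)
    qed
    ultimately show ?case by (simp only:)
  next
    case (add u v)
    then show ?case using log_laurent.add[OF add.IH] by (simp add: distrib_left)
  qed
  obtain c where c: "c > 0" "\<forall>\<^sub>F l in at_top. cmod (g l - p l) \<le>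
      c * cmod (qexp (of_nat (N + 1) * of_real l))"
    using landau_o.bigE[OF p(2)] by blast
  have "filterlim (\<lambda>n. real n + 1 / 2) at_top sequentially"
    using filterlim_tendsto_add_at_top[OF tendsto_const[of "1 / 2"] filterlim_real_sequentially]
    by (simp add: add.commute)
  then have ev: "\<forall>\<^sub>F n in sequentially. cmod (g (real n + 1 / 2) - p (real n + 1 / 2)) \<le>
      c * cmod (qexp (of_nat (N + 1) * of_real (real n + 1 / 2)))"
    using c(2) unfolding filterlim_iff by blast
  obtain K where K: "K \<ge> 0" "\<And>n. real (Suc n) * q ^ Suc n \<le> K"
    using nat_times_power_bounded by blast
  define D where "D = c * q powr (- (real N + 1) / 2) * K"
  have "\<forall>\<^sub>F n in sequentially. cmod (of_nat (Suc n) ^ d * g (real n + 1 / 2) - of_nat (Suc n) ^ d *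
      p (real n + 1 / 2))
      \<le> D * q ^ (N * Suc n)"
    using ev
  proof eventually_elim
    case (elim n)
    have "real (Suc n) ^ d \<le> real (Suc n)"
      using d by (cases d) auto
    have "cmod (qexp (of_nat (N + 1) * of_real (real n + 1 / 2))) =
        q powr ((real N + 1) * (real (Suc n) - 1 / 2))"
      unfolding half by (simp add: norm_qexp algebra_simps)
    also have "(real N + 1) * (real (Suc n) - 1 / 2) =
        - (real N + 1) / 2 + (real (N * Suc n) + real (Suc n))"
      by (simp add: field_simps)
    also have "q powr \<dots> = q powr (- (real N + 1) / 2) * (q ^ (N * Suc n) * q ^ Suc n)"
      by (simp only: powr_add q_power_eq_powr)
    finally have e: "cmod (qexp (of_nat (N + 1) * of_real (real n + 1 / 2))) =
      q powr (- (real N + 1) / 2) * (q ^ (N * Suc n) * q ^ Suc n)" .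
    have "cmod (of_nat (Suc n) ^ d * g (real n + 1 / 2) - of_nat (Suc n) ^ d * p (real n + 1 / 2))
      = real (Suc n) ^ d * cmod (g (real n + 1 / 2) - p (real n + 1 / 2))"
      by (simp add: right_diff_distrib[symmetric] norm_mult norm_power del: of_nat_Suc)
    also have "\<dots> \<le> real (Suc n) * (c * (q powr (- (real N + 1) / 2) * (q ^ (N * Suc n) * q ^ Suc n)))"
      using elim unfolding e by (intro mult_mono \<open>real (Suc n) ^ d \<le> real (Suc n)\<close>) auto
    also have "\<dots> = c * q powr (- (real N + 1) / 2) * (real (Suc n) * q ^ Suc n) * q ^ (N * Suc n)"
      by (simp only: mult_ac)
    also have "\<dots> \<le> D * q ^ (N * Suc n)"
      unfolding D_def using c q_pos by (intro mult_right_mono mult_left_mono K) auto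
    finally show ?case .
  qed
  from eventually_bound_imp_bound[OF this] mem q_pos
  show "\<exists>p\<in>log_laurent. \<exists>C. \<forall>n. cmod (of_nat (Suc n) ^ d * g (real n + 1 / 2) - p n) \<le>
      C * q ^ (N * Suc n)"
    by fastforce
qed

text \<open>For j = 0 the 2n + 2 = 2 nu values of \<open>m\<close> contribute equally, which is the
  only origin of the factor nu. Otherwise the sum of q^(jm) from -l to l is (q^(-jl) - q^j q^(jl)) /
  (1 - q^j), again with integer powers of q^l.\<close>

lemma log_expansion_coefficient_sum:
  assumes "f \<in> coefficient"
  shows "log_expansion (\<lambda>n. \<Sum>k<2 * n + 2. \<Sum>e\<in>UNIV. f (real n + 1 / 2, real k - (real n + 1 / 2), e))"
  using assms
proof induction
  case (monomial g j)
  define G where "G l = g False l + g True l" for l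
  have G: "expansion G" unfolding G_def by (intro expansion_add monomial)
  have E: "(\<Sum>k<2 * n + 2. \<Sum>e\<in>UNIV. qexp (of_int j * of_real (real k - (real n + 1 / 2))) *
      g e (real n + 1 / 2))
    = (\<Sum>k<2 * n + 2. qexp (of_int j) ^ k) * qexp (of_int j * - of_real (real n + 1 / 2)) * G (real n +
        1 / 2)" for n
  proof -
    have "qexp (of_int j * of_real (real k - (real n + 1 / 2))) =
        qexp (of_int j) ^ k * qexp (of_int j * - of_real (real n + 1 / 2))" for k
    proof -
      have "of_int j * complex_of_real (real k - (real n + 1 / 2)) =
          of_nat k * of_int j + of_int j * - of_real (real n + 1 / 2)"
        by (simp add: algebra_simps)
      then show ?thesis by (simp only: qexp_add qexp_of_nat_mult)
    qed
    then show ?thesis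
      by (simp add: G_def UNIV_bool sum_distrib_right sum_distrib_left distrib_left mult_ac)
  qed
  show ?case
  proof (cases "j = 0")
    case True
    have "log_expansion (\<lambda>n. of_nat (Suc n) ^ 1 * (2 * G (real n + 1 / 2)))"
      by (rule log_expansion_expansion) (auto intro!: expansion_mult expansion_const G)
    then show ?thesis unfolding fst_conv snd_conv E by (simp add: True algebra_simps)
  next
    case False
    have ne: "qexp (of_int j) \<noteq> 1"
    proof
      assume "qexp (of_int j) = 1"
      then have "q powr (of_int j) = 1" using norm_qexp[of "of_int j"] by simp
      then show False using False q_pos q_less_1 by (simp add: powr_def)
    qed
    define h where "h l = (qexp (of_int j * - of_real l) - qexp (of_int j) * qexp (of_int j *
        of_real l)) / (1 - qexp (of_int j)) * G l" for l
    have "expansion (\<lambda>l. (qexp (of_int j * - of_real l) + (- qexp (of_int j)) * qexp (of_int j *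
        of_real l)) * (1 / (1 - qexp (of_int j))) * G l)"
      using expansion_laurent[OF laurent.monomial[of 1 j]]
          expansion_laurent[OF laurent.monomial[of 1 "- j"]]
      by (intro expansion_mult expansion_add expansion_const G) simp_all
    then have "expansion h" unfolding h_def by simp
    then have "log_expansion (\<lambda>n. of_nat (Suc n) ^ 0 * h (real n + 1 / 2))"
      by (rule log_expansion_expansion) simp
    moreover have "(\<Sum>k<2 * n + 2. qexp (of_int j) ^ k) * qexp (of_int j * - of_real (real n + 1 /
        2)) * G (real n + 1 / 2)
        = h (real n + 1 / 2)" for n
    proof -
      have "qexp (of_int j) ^ (2 * n + 2) * qexp (of_int j * - of_real (real n + 1 / 2)) =
          qexp (of_nat (2 * n + 2) * of_int j + of_int j * - of_real (real n + 1 / 2))"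
        by (simp only: qexp_add qexp_of_nat_mult)
      also have "of_nat (2 * n + 2) * of_int j + of_int j * - of_real (real n + 1 / 2) =
         of_int j + of_int j * complex_of_real (real n + 1 / 2)"
        by (simp add: algebra_simps)
      finally have e: "qexp (of_int j) ^ (2 * n + 2) * qexp (of_int j * - of_real (real n + 1 / 2)) =
         qexp (of_int j) * qexp (of_int j * of_real (real n + 1 / 2))" by (simp only: qexp_add)
      have "(\<Sum>k<2 * n + 2. qexp (of_int j) ^ k) = (1 - qexp (of_int j) ^ (2 * n + 2)) /
          (1 - qexp (of_int j))"
        using ne by (simp only: sum_gp_strict if_False)
      then have "(\<Sum>k<2 * n + 2. qexp (of_int j) ^ k) * qexp (of_int j * - of_real (real n + 1 / 2)) =
        (qexp (of_int j * - of_real (real n + 1 / 2)) - qexp (of_int j) ^ (2 * n + 2) *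
            qexp (of_int j * - of_real (real n + 1 / 2))) / (1 - qexp (of_int j))"
        by (simp only: left_diff_distrib times_divide_eq_left mult_1)
      then show ?thesis unfolding e h_def by (simp only:)
    qed
    ultimately show ?thesis unfolding fst_conv snd_conv E by simp
  qed
next
  case (add f g)
  then show ?case using log_expansion_add[OF add.IH] by (simp add: sum.distrib)
qed


subsection \<open>Banded operators\<close>

text \<open>
  Conjugation with the gauge removes every square root: raising \<open>l - m\<close> or \<open>l + m\<close> by one costs the square root
  of a \<open>q\<close>-number, lowering it the same one, and likewise for the root in \<open>\<alpha>\<^sup>+\<^sub>l\<close>.  In the gauge all raising
  coefficients lose their roots and the lowering ones get the squares.
\<close>

definition qfact :: "nat \<Rightarrow> real" where
  "qfact n = (\<Prod>k<n. qnum q (real (Suc k)))"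

definition Gam :: "nat \<Rightarrow> real" where
  "Gam n = (\<Prod>k<n. sqrt (rho (real k + 1 / 2)))"

text \<open>The floors read the naturals l - m, l + m and l - 1/2 off a real label. On junk labels
  the value is still positive, so gauge ratios can be cancelled everywhere.\<close>

definition gauge :: "label \<Rightarrow> real" where
  "gauge i = sqrt (qfact (nat \<lfloor>fst i - fst (snd i)\<rfloor>)) * sqrt (qfact (nat \<lfloor>fst i + fst (snd i)\<rfloor>)) /
      Gam (nat \<lfloor>fst i\<rfloor>)"

lemma qnum_pos: "x > 0 \<Longrightarrow> qnum q x > 0"
  unfolding qnum_eq using q_gap q_pos q_powr_less_1[of "2 * x"] by simp

lemma qnum_0 [simp]: "qnum q 0 = 0"
  by (simp add: qnum_def)

lemma rho_pos:
  assumes "l > - 1" shows "rho l > 0"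
proof -
  have "qnum q (2 * l + 2) > 0" "qnum q (4 * l + 4) > 0" "qnum q 2 > 0"
    using assms by (auto intro!: qnum_pos)
  then show ?thesis unfolding rho_def by (intro mult_pos_pos add_pos_pos)
qed

lemma qfact_Suc: "qfact (Suc n) = qfact n * qnum q (real (Suc n))"
  by (simp add: qfact_def)

lemma Gam_Suc: "Gam (Suc n) = Gam n * sqrt (rho (real n + 1 / 2))"
  by (simp add: Gam_def)

lemma qfact_pos: "qfact n > 0"
  unfolding qfact_def by (intro prod_pos qnum_pos ballI) simp

lemma Gam_pos: "Gam n > 0"
  unfolding Gam_def by (intro prod_pos ballI) (simp add: rho_pos)

lemma gauge_pos: "gauge i > 0"
  by (simp add: gauge_def qfact_pos Gam_pos)

lemma gauge_nat:
  assumes "fst i = real n + 1 / 2" "fst i - fst (snd i) = real x" "fst i + fst (snd i) = real y"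
  shows "gauge i = sqrt (qfact x) * sqrt (qfact y) / Gam n"
proof -
  have "nat \<lfloor>real n + 1 / 2\<rfloor> = n" by linarith
  then show ?thesis unfolding gauge_def assms(2,3) unfolding assms(1) by simp
qed

lemma gauge_reflect: "gauge (reflect i) = gauge i"
  by (simp add: gauge_def reflect_def mult.commute)

section \<open>Symbols: finite sums of gauged shifts\<close>

text \<open>\<open>s = True\<close> exchanges the two halves of the space; with exclusive or the
  parities of composed shifts add.\<close>

definition shift :: "real \<Rightarrow> real \<Rightarrow> bool \<Rightarrow> label \<Rightarrow> label" where
  "shift a b s i = (fst i + a, fst (snd i) + b, snd (snd i) \<noteq> s)"

lemma shift_shift: "shift a b s (shift a' b' s' i) = shift (a' + a) (b' + b) (s' \<noteq> s) i"
  by (auto simp: shift_def add.assoc)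

text \<open>The vanishing condition makes the coefficient of a product independent of junk labels
  passed on the way.\<close>

inductive_set symbols :: "(label \<Rightarrow> hilb) set" where
  single: "f \<in> coefficient \<Longrightarrow> (\<And>i. i \<in> labels \<Longrightarrow> shift a b s i \<notin> labels \<Longrightarrow> f i = 0) \<Longrightarrow>
     (\<lambda>i. (f i * of_real (gauge (shift a b s i) / gauge i)) *\<^sub>C basis (shift a b s i)) \<in> symbols"
| add: "u \<in> symbols \<Longrightarrow> v \<in> symbols \<Longrightarrow> (\<lambda>i. u i + v i) \<in> symbols"

lemma symbols_finsupp: "v \<in> symbols \<Longrightarrow> finsupp (v i)"
  by (induction rule: symbols.induct) (auto intro: finsupp_add finsupp_scale)

lemma symbols_scale:
  assumes "v \<in> symbols" shows "(\<lambda>i. c *\<^sub>C v i) \<in> symbols"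
  using assms
proof induction
  case (single f a b s)
  have "(\<lambda>i. ((c * f i) * of_real (gauge (shift a b s i) / gauge i)) *\<^sub>C basis (shift a b s i)) \<in>
      symbols"
    by (intro symbols.single coefficient_mult coefficient_const single) (simp add: single)
  then show ?case by (simp only: scaleC_algebra mult.assoc)
next
  case (add u v)
  then show ?case using symbols.add[OF add.IH] by (simp add: scaleC_algebra)
qed

text \<open>Gauge ratios telescope: the gauge of the intermediate label cancels, and the
  coefficients multiply after a shift of the argument.\<close>

lemma symbols_shift:
  assumes f: "f \<in> coefficient" and f0: "\<And>i. i \<in> labels \<Longrightarrow> shift a b s i \<notin> labels \<Longrightarrow> f i = 0"
    and "u \<in> symbols"
  shows "\<exists>w\<in>symbols. \<forall>i\<in>labels. (f i * of_real (gauge (shift a b s i) /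
      gauge i)) *\<^sub>C u (shift a b s i) = w i"
  using assms(3)
proof induction
  case (single g a' b' s')
  let ?k = "\<lambda>i. shift (a + a') (b + b') (s \<noteq> s') i"
  let ?f = "\<lambda>i. f i * g (shift a b s i)"
  have "?f \<in> coefficient"
    using coefficient_mult[OF f coefficient_shift[OF single(1), of a b s]] by (simp add: shift_def)
  moreover have "?f i = 0" if "i \<in> labels" "?k i \<notin> labels" for i
    \<comment> \<open>If the intermediate label is junk the first factor vanishes; otherwise the
      step to the junk target makes the second one vanish.\<close>
    using single(2)[of "shift a b s i"] f0[of i] that by (cases "shift a b s i \<in>
        labels") (auto simp: shift_shift)
  ultimately have w: "(\<lambda>i. (?f i * of_real (gauge (?k i) / gauge i)) *\<^sub>C basis (?k i)) \<in> symbols"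
    by (rule symbols.single)
  have "(f i * of_real (gauge (shift a b s i) / gauge i)) *\<^sub>C
      ((g (shift a b s i) * of_real (gauge (shift a' b' s' (shift a b s i)) /
          gauge (shift a b s i))) *\<^sub>C
         basis (shift a' b' s' (shift a b s i))) =
      (?f i * of_real (gauge (?k i) / gauge i)) *\<^sub>C basis (?k i)" for i
    using gauge_pos[of "shift a b s i"] unfolding shift_shift scaleC_algebra
    by (intro arg_cong2[where f = scaleC] refl) simp
  then show ?case by (intro bexI[OF _ w] ballI)
next
  case (add u v)
  then obtain w w' where "w \<in> symbols" "w' \<in> symbols"
    "\<forall>i\<in>labels. (f i * of_real (gauge (shift a b s i) / gauge i)) *\<^sub>C u (shift a b s i) = w i"
    "\<forall>i\<in>labels. (f i * of_real (gauge (shift a b s i) / gauge i)) *\<^sub>C v (shift a b s i) = w' i"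
    by blast
  then show ?case
    by (intro bexI[of _ "\<lambda>i. w i + w' i"] ballI symbols.add) (simp_all only: scaleC_algebra)
qed

lemma symbols_compose:
  assumes S: "finlin S" "u \<in> symbols" "\<And>i. i \<in> labels \<Longrightarrow> S (basis i) = Some (u i)" and "v \<in> symbols"
  shows "\<exists>w\<in>symbols. \<forall>i\<in>labels. the (S (v i)) = w i"
  using assms(4)
proof induction
  case (single f a b s)
  from symbols_shift[OF single(1) single(2) S(2)] obtain w where w: "w \<in> symbols"
    "\<forall>i\<in>labels. (f i * of_real (gauge (shift a b s i) / gauge i)) *\<^sub>C u (shift a b s i) = w i" by blast
  have "the (S ((f i * of_real (gauge (shift a b s i) / gauge i)) *\<^sub>C basis (shift a b s i))) = w i"
    if i: "i \<in> labels" for i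
  proof (cases "shift a b s i \<in> labels")
    case True
    have "the (S ((f i * of_real (gauge (shift a b s i) / gauge i)) *\<^sub>C basis (shift a b s i))) =
       (f i * of_real (gauge (shift a b s i) / gauge i)) *\<^sub>C the (S (basis (shift a b s i)))"
      by (rule finlinD(5)[OF S(1) finsupp_ket])
    then show ?thesis using w(2) i S(3)[OF True] by simp
  next
    case False
    then show ?thesis using single(2)[OF i False] w(2) i
        by (auto simp: scaleC_algebra finlin_zero[OF S(1)])
  qed
  then show ?case by (intro bexI[OF _ w(1)] ballI)
next
  case (add v v')
  then obtain w w' where w: "w \<in> symbols" "\<forall>i\<in>labels. the (S (v i)) = w i"
    "w' \<in> symbols" "\<forall>i\<in>labels. the (S (v' i)) = w' i" by blast
  have "the (S (v i + v' i)) = w i + w' i" if "i \<in> labels" for i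
    using finlinD(4)[OF S(1) symbols_finsupp[OF add(1)] symbols_finsupp[OF add(2)]] w that by simp
  then show ?case by (intro bexI[OF _ symbols.add[OF w(1,3)]] ballI)
qed

text \<open>On the diagonal the gauge ratio is one, so the gauge disappears from everything that a
  trace can see.\<close>

lemma symbols_diagonal:
  assumes "v \<in> symbols"
  shows "\<exists>f\<in>coefficient. \<forall>i\<in>labels. hcoeff (v i) i = f i"
  using assms
proof induction
  case (single f a b s)
  show ?case
  proof (cases "a = 0 \<and> b = 0 \<and> \<not> s")
    case True
    then have "shift a b s i = i" for i by (auto simp: shift_def)
    then have "hcoeff ((f i * of_real (gauge (shift a b s i) /
        gauge i)) *\<^sub>C basis (shift a b s i)) i = f i" if "i \<in> labels" for i
      using gauge_pos[of i] that unfolding hcoeff_simps hcoeff_basis by simp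
    then show ?thesis using single(1) by blast
  next
    case False
    then have "i \<noteq> shift a b s i" for i by (cases i) (auto simp: shift_def)
    then have "hcoeff ((f i * of_real (gauge (shift a b s i) /
        gauge i)) *\<^sub>C basis (shift a b s i)) i = 0" for i
      unfolding hcoeff_simps hcoeff_basis by simp
    then show ?thesis by (intro bexI[OF _ coefficient_const[of 0]] ballI)
  qed
next
  case (add u v)
  then obtain f g where "f \<in> coefficient" "g \<in> coefficient" "\<forall>i\<in>labels. hcoeff (u i) i =
      f i" "\<forall>i\<in>labels. hcoeff (v i) i = g i"
    by blast
  then show ?case by (intro bexI[of _ "\<lambda>i. f i + g i"] ballI coefficient.add) simp_all
qed

lemma op_J_0: "op_J 0 = 0"
  using op_J_scale[of 0 0] by (simp only: scaleC_algebra(6) scaleC_algebra(5) complex_cnj_zero)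

text \<open>The action of J T J^-1 on the basis, with J^-1 = -J. By \<open>phase_sq\<close> the
  phases at \<open>i\<close> cancel down to the constant \<open>phase b\<close>, and
  \<open>gauge_reflect\<close> shows that the same gauge serves the conjugated operator.\<close>

lemma symbols_reflect:
  assumes "v \<in> symbols"
  shows "\<exists>w\<in>symbols. \<forall>i\<in>labels. (- cnj (phase (fst (snd i)))) *\<^sub>C op_J (v (reflect i)) = w i"
  using assms
proof induction
  case (single f a b s)
  let ?f = "\<lambda>i. phase b * cnj (f (reflect i))"
  let ?k = "shift a (- b) s"
  have shift_reflect: "shift a b s (reflect i) = reflect (?k i)" for i
      by (auto simp: shift_def reflect_def)
  have "?f \<in> coefficient"
    using coefficient_mult[OF coefficient_const coefficient_reflect[OF single(1)]]
        by (simp add: reflect_def)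
  moreover have "?f i = 0" if "i \<in> labels" "?k i \<notin> labels" for i
    using single(2)[of "reflect i"] that by (simp add: shift_reflect)
  ultimately have w: "(\<lambda>i. (?f i * of_real (gauge (?k i) / gauge i)) *\<^sub>C basis (?k i)) \<in> symbols"
    by (rule symbols.single)
  have "(- cnj (phase (fst (snd i)))) *\<^sub>C
       op_J ((f (reflect i) * of_real (gauge (shift a b s (reflect i)) /
           gauge (reflect i))) *\<^sub>C basis (shift a b s (reflect i)))
      = (?f i * of_real (gauge (?k i) / gauge i)) *\<^sub>C basis (?k i)" if i: "i \<in> labels" for i
  proof (cases "?k i \<in> labels")
    case True
    have J: "op_J (basis (reflect (?k i))) = phase (fst (snd (reflect (?k i)))) *\<^sub>C basis (?k i)"
      using op_J_basis[of "reflect (?k i)"] True by simp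
    have "fst (snd (reflect (?k i))) = - fst (snd i) + b" by (simp add: reflect_def shift_def)
    then have p: "phase (fst (snd (reflect (?k i)))) = phase (- fst (snd i)) * phase b"
      by (simp only: phase_simps)
    have "cnj (phase (fst (snd i))) * phase (- fst (snd i)) =
        cnj (phase (fst (snd i)) * phase (fst (snd i)))"
      by (simp add: phase_simps)
    then have "- cnj (phase (fst (snd i))) * phase (- fst (snd i)) = 1"
      using phase_sq[OF i] by simp
    then have e: "- cnj (phase (fst (snd i))) * (c * (phase (- fst (snd i)) * phase b)) = phase b * c"
        for c
      by (metis mult.assoc mult.commute mult_1)
    show ?thesis
      unfolding shift_reflect op_J_scale J p scaleC_algebra gauge_reflect
      by (intro arg_cong2[where f = scaleC] refl) (use e in simp)
  next
    case False
    then have "basis (?k i) = 0" "basis (reflect (?k i)) = 0"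
      using basis_outside[of "?k i"] basis_outside[of "reflect (?k i)"] by simp_all
    then show ?thesis unfolding shift_reflect op_J_scale by (simp only: op_J_0 scaleC_algebra(6))
  qed
  then show ?case by (intro bexI[OF _ w] ballI)
next
  case (add u v)
  then obtain w w' where "w \<in> symbols" "w' \<in> symbols"
    "\<forall>i\<in>labels. (- cnj (phase (fst (snd i)))) *\<^sub>C op_J (u (reflect i)) = w i"
    "\<forall>i\<in>labels. (- cnj (phase (fst (snd i)))) *\<^sub>C op_J (v (reflect i)) = w' i"
    by blast
  then show ?case
    by (intro bexI[of _ "\<lambda>i. w i + w' i"] ballI symbols.add) (simp_all only: scaleC_algebra op_J_add)
qed

text \<open>The algebra that is to contain \<open>diff_ops\<close>; \<open>finlin\<close> is
  included because a symbol alone controls basis vectors only.\<close>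

definition banded :: "oper \<Rightarrow> bool" where
  "banded T \<longleftrightarrow> finlin T \<and> (\<exists>v\<in>symbols. \<forall>i\<in>labels. T (basis i) = Some (v i))"

lemma bandedI:
  "finlin T \<Longrightarrow> v \<in> symbols \<Longrightarrow> (\<And>i. i \<in> labels \<Longrightarrow> T (basis i) = Some (v i)) \<Longrightarrow> banded T"
  unfolding banded_def by blast

lemma bandedE:
  assumes "banded T"
  obtains v where "finlin T" "v \<in> symbols" "\<And>i. i \<in> labels \<Longrightarrow> T (basis i) = Some (v i)"
  using assms unfolding banded_def by blast

lemma banded_basis_op:
  assumes "v \<in> symbols" "\<And>i. i \<in> labels \<Longrightarrow> u i = v i"
  shows "banded (basis_op u)"
proof (rule bandedI[OF _ assms(1)])
  show "finlin (basis_op u)"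
    using assms symbols_finsupp by (intro finlin_basis_op) simp
  show "basis_op u (basis i) = Some (v i)" if "i \<in> labels" for i
    using basis_op_basis[OF that, of u] assms(2)[OF that] by simp
qed

lemma banded_Some: "banded Some"
proof (rule bandedI)
  show "finlin Some" unfolding finlin_def by simp
  show "(\<lambda>i. (1 * of_real (gauge (shift 0 0 False i) / gauge i)) *\<^sub>C basis (shift 0 0 False i)) \<in>
      symbols"
    by (rule symbols.single[OF coefficient_const]) (simp add: shift_def)
  fix i
  have "shift 0 0 False i = i" "gauge i \<noteq> 0" using gauge_pos[of i] by (auto simp: shift_def)
  then show "Some (basis i) = Some ((1 * of_real (gauge (shift 0 0 False i) /
      gauge i)) *\<^sub>C basis (shift 0 0 False i))"
    by (simp add: scaleC_algebra)
qed

lemma banded_add: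
  assumes "banded S" "banded T" shows "banded (op_add S T)"
proof -
  obtain u where u: "finlin S" "u \<in> symbols" "\<And>i. i \<in> labels \<Longrightarrow> S (basis i) = Some (u i)"
    using assms(1) by (rule bandedE) blast
  obtain v where v: "finlin T" "v \<in> symbols" "\<And>i. i \<in> labels \<Longrightarrow> T (basis i) = Some (v i)"
    using assms(2) by (rule bandedE) blast
  show ?thesis
    by (rule bandedI[OF finlin_op_add[OF u(1) v(1)] symbols.add[OF u(2) v(2)]])
       (simp add: op_add_def domI u(3) v(3))
qed

lemma banded_scale:
  assumes "banded T" shows "banded (op_scale c T)"
proof -
  obtain v where v: "finlin T" "v \<in> symbols" "\<And>i. i \<in> labels \<Longrightarrow> T (basis i) = Some (v i)"
    using assms by (rule bandedE) blast
  show ?thesis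
    by (rule bandedI[OF finlin_op_scale[OF v(1)] symbols_scale[OF v(2)]]) (simp add: op_scale_def v(3))
qed

lemma banded_comp:
  assumes "banded S" "banded T" shows "banded (S \<circ>\<^sub>m T)"
proof -
  obtain u where u: "finlin S" "u \<in> symbols" "\<And>i. i \<in> labels \<Longrightarrow> S (basis i) = Some (u i)"
    using assms(1) by (rule bandedE) blast
  obtain v where v: "finlin T" "v \<in> symbols" "\<And>i. i \<in> labels \<Longrightarrow> T (basis i) = Some (v i)"
    using assms(2) by (rule bandedE) blast
  obtain w where w: "w \<in> symbols" "\<forall>i\<in>labels. the (S (v i)) = w i"
    using symbols_compose[OF u v(2)] by blast
  show ?thesis
  proof (rule bandedI[OF finlin_comp[OF u(1) v(1)] w(1)])
    fix i assume i: "i \<in> labels"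
    have "(S \<circ>\<^sub>m T) (basis i) = S (v i)" by (simp add: map_comp_def v(3)[OF i])
    also have "\<dots> = Some (the (S (v i)))" by (rule finlinD(1)[OF u(1) symbols_finsupp[OF v(2)]])
    finally show "(S \<circ>\<^sub>m T) (basis i) = Some (w i)" using w(2) i by simp
  qed
qed

lemma banded_conj_J:
  assumes "banded T" shows "banded (conj_J T)"
proof -
  obtain v where v: "finlin T" "v \<in> symbols" "\<And>i. i \<in> labels \<Longrightarrow> T (basis i) = Some (v i)"
    using assms by (rule bandedE) blast
  obtain w where w: "w \<in> symbols" "\<forall>i\<in>labels. (- cnj (phase (fst (snd i)))) *\<^sub>C op_J (v (reflect i)) =
      w i"
    using symbols_reflect[OF v(2)] by blast
  show ?thesis
  proof (rule bandedI[OF finlin_conj_J[OF v(1)] w(1)])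
    fix i assume i: "i \<in> labels"
    define c where "c = - phase (fst (snd i))"
    have "T (basis (reflect i)) = Some (v (reflect i))" using v(3) i reflect_labels by blast
    then have "the (T (c *\<^sub>C basis (reflect i))) = c *\<^sub>C v (reflect i)"
      using finlinD(5)[OF v(1), of "basis (reflect i)" c] by simp
    moreover have "finsupp (c *\<^sub>C basis (reflect i))" by (intro finsupp_scale finsupp_ket)
    ultimately have "T (c *\<^sub>C basis (reflect i)) = Some (c *\<^sub>C v (reflect i))"
      using finlinD(1)[OF v(1), of "c *\<^sub>C basis (reflect i)"] by simp
    moreover have "inv op_J (basis i) = c *\<^sub>C basis (reflect i)"
      unfolding inv_op_J op_J_basis[OF i] c_def by (rule hilb_eqI) simp
    ultimately have "conj_J T (basis i) = Some (op_J (c *\<^sub>C v (reflect i)))"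
      by (simp add: conj_J_def)
    also have "op_J (c *\<^sub>C v (reflect i)) = w i"
      using w(2) i unfolding op_J_scale c_def by simp
    finally show "conj_J T (basis i) = Some (w i)" .
  qed
qed

lemma banded_alg_gen:
  assumes "T \<in> alg_gen G" "\<And>T. T \<in> G \<Longrightarrow> banded T"
  shows "banded T"
  using assms by induction (auto intro: banded_Some banded_add banded_scale banded_comp)


subsection \<open>The generators\<close>

definition rcoef :: "(label \<Rightarrow> real) \<Rightarrow> bool" where
  "rcoef g \<longleftrightarrow> (\<lambda>i. complex_of_real (g i)) \<in> coefficient"

lemma rcoef_mult: "rcoef f \<Longrightarrow> rcoef g \<Longrightarrow> rcoef (\<lambda>i. f i * g i)"
  unfolding rcoef_def using coefficient_mult by fastforce

lemma rcoef_add: "rcoef f \<Longrightarrow> rcoef g \<Longrightarrow> rcoef (\<lambda>i. f i + g i)"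
  unfolding rcoef_def using coefficient.add by fastforce

lemma rcoef_const: "rcoef (\<lambda>i. c)"
  unfolding rcoef_def by (rule coefficient_const)

lemma rcoef_minus: "rcoef f \<Longrightarrow> rcoef (\<lambda>i. - f i)"
  using rcoef_mult[OF rcoef_const[of "-1"]] by simp

text \<open>Stated through \<open>h\<close> so that the linear form in \<open>l\<close> and
  \<open>m\<close> is recognised by arithmetic and not by its syntax.\<close>

lemma rcoef_powr:
  assumes "\<And>l m e. h (l, m, e) = of_int j * l + of_int k * m + c"
  shows "rcoef (\<lambda>i. q powr (h i))"
proof -
  have "h = (\<lambda>i. of_int j * fst i + of_int k * fst (snd i) + c)"
    by (rule ext) (metis assms prod.collapse)
  then show ?thesis unfolding rcoef_def by (simp only: coefficient_powr)
qed

lemma rcoef_qnum: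
  assumes "\<And>l m e. h (l, m, e) = of_int j * l + of_int k * m + c"
  shows "rcoef (\<lambda>i. qnum q (h i))"
proof -
  have "h = (\<lambda>i. of_int j * fst i + of_int k * fst (snd i) + c)"
    by (rule ext) (metis assms prod.collapse)
  then show ?thesis unfolding rcoef_def by (simp only: coefficient_qnum)
qed

lemma rcoef_expansion:
  "(\<And>e. expansion (\<lambda>l. of_real (g e l))) \<Longrightarrow> rcoef (\<lambda>i. g (snd (snd i)) (fst i))"
  unfolding rcoef_def by (rule coefficient_expansion[of "\<lambda>e l. of_real (g e l)"])

definition alpha_num :: "bool \<Rightarrow> real \<Rightarrow> real" where
  "alpha_num e l = q powr (if e then - l - 2 else - l - 1)"

lemma alpha_plus_eq: "alpha_plus q e l = alpha_num e l / sqrt (rho l)"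
  by (simp add: alpha_plus_def alpha_num_def rho_def)

lemma alpha_minus_eq: "alpha_minus q e l = - (q powr (2 * l)) * (alpha_num e (l - 1) /
    sqrt (rho (l - 1)))"
  by (simp add: alpha_minus_def alpha_plus_eq)

lemma expansion_alpha_num: "expansion (\<lambda>l. of_real (alpha_num e l))"
  using expansion_powr[of "-1" "-2"] expansion_powr[of "-1" "-1"]
  by (cases e) (simp_all add: alpha_num_def)

lemma expansion_qnum: "expansion (\<lambda>l. of_real (qnum q (of_int j * l + c)))"
proof -
  have "expansion (\<lambda>l. of_real (1 / (1 / q - q)) * (of_real (q powr (of_int (- j) * l + - c))
     + - 1 * of_real (q powr (of_int j * l + c))))"
    by (intro expansion_mult expansion_const expansion_add expansion_powr)
  moreover have "of_real (1 / (1 / q - q)) * (of_real (q powr (of_int (- j) * l + - c))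
     + - 1 * of_real (q powr (of_int j * l + c))) = complex_of_real (qnum q (of_int j * l + c))" for l
    by (simp add: qnum_def)
  ultimately show ?thesis by simp
qed

lemma expansion_alpha_zero: "expansion (\<lambda>l. of_real (alpha_zero q e l))"
proof -
  have eq: "alpha_zero q e l = q powr (- 1 / 2) * ((q - 1 / q) * qnum q (of_int 1 * l + (- 1 / 2))
      * qnum q (of_int 1 * l + 3 / 2) + (if e then q else - 1 / q))
      * (1 / qnum q (of_nat 2 * l + 0)) * (1 / qnum q (of_nat 2 * l + 2))" for l
    by (simp add: alpha_zero_def)
  show ?thesis
    unfolding eq of_real_mult of_real_add
    by (intro expansion_mult expansion_const expansion_add expansion_qnum expansion_inverse_qnum) auto
qed

lemma rcoef_alpha:
  "rcoef (\<lambda>i. alpha_num (snd (snd i)) (fst i))"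
  "rcoef (\<lambda>i. alpha_num (snd (snd i)) (fst i - 1))"
  "rcoef (\<lambda>i. alpha_zero q (snd (snd i)) (fst i))"
  "rcoef (\<lambda>i. 1 / rho (fst i - 1))"
  using rcoef_expansion[of alpha_num, OF expansion_alpha_num]
    rcoef_expansion[of "\<lambda>e l. alpha_num e (l - 1)"] expansion_shift[OF expansion_alpha_num, where a =
        "-1"]
    rcoef_expansion[of "alpha_zero q", OF expansion_alpha_zero]
    rcoef_expansion[of "\<lambda>e l. 1 / rho (l - 1)"] expansion_shift[OF expansion_inverse_rho, where a =
        "-1"]
  by auto

lemma label_nat:
  assumes "l = real n + 1 / 2" "l - m = real x" "l + m = real y"
  shows "(l, m, e) \<in> labels"
  using assms by (simp add: labels_def)

definition symbolic :: "(label \<Rightarrow> hilb) \<Rightarrow> bool" where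
  "symbolic u \<longleftrightarrow> (\<exists>v\<in>symbols. \<forall>i\<in>labels. u i = v i)"

lemma symbolic_add:
  assumes "symbolic u" "symbolic v" shows "symbolic (\<lambda>i. u i + v i)"
proof -
  obtain u' v' where "u' \<in> symbols" "\<forall>i\<in>labels. u i = u' i" "v' \<in> symbols" "\<forall>i\<in>labels. v i = v' i"
    using assms unfolding symbolic_def by blast
  then show ?thesis
    unfolding symbolic_def by (intro bexI[of _ "\<lambda>i. u' i + v' i"] ballI symbols.add) simp_all
qed

lemma banded_symbolic:
  assumes "symbolic u" shows "banded (basis_op u)"
proof -
  obtain v where "v \<in> symbols" "\<forall>i\<in>labels. u i = v i"
    using assms unfolding symbolic_def by blast
  then show ?thesis by (intro banded_basis_op) simp_all
qed

section \<open>Gauged matrix entries of A, B and the adjoint of B\<close>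

definition gauge_at :: "nat \<Rightarrow> nat \<Rightarrow> nat \<Rightarrow> real" where
  "gauge_at n x y = sqrt (qfact x) * sqrt (qfact y) / Gam n"

text \<open>\<open>c\<close> is the matrix entry and \<open>g\<close> the entry in the gauge. The
  first alternative takes care of targets outside \<open>labels\<close>, where both have to
  vanish.\<close>

definition entry_relation :: "real \<Rightarrow> real \<Rightarrow> real \<Rightarrow> real \<Rightarrow> nat \<Rightarrow> nat \<Rightarrow> nat \<Rightarrow> real \<Rightarrow> real \<Rightarrow> bool" where
  "entry_relation a b l m n x y c g \<longleftrightarrow> c = 0 \<and> g = 0 \<or>
     (\<exists>n' x' y'. l + a = real n' + 1 / 2 \<and> l + a - (m + b) = real x' \<and> l + a + (m + b) = real y' \<and>
        c = g * (gauge_at n' x' y' / gauge_at n x y))"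

lemma entry_relationI:
  "c = g * (gauge_at n' x' y' / gauge_at n x y) \<Longrightarrow> l + a = real n' + 1 / 2 \<Longrightarrow>
   l + a - (m + b) = real x' \<Longrightarrow> l + a + (m + b) = real y' \<Longrightarrow> entry_relation a b l m n x y c g"
  unfolding entry_relation_def by blast

lemma symbolic_entry:
  assumes g: "rcoef (\<lambda>i. g (fst i) (fst (snd i)) (snd (snd i)))"
    and c: "\<And>l m e n x y. l = real n + 1 / 2 \<Longrightarrow> l - m = real x \<Longrightarrow> l + m = real y \<Longrightarrow> x + y = 2 * n + 1 \<Longrightarrow>
       entry_relation a b l m n x y (c l m e) (g l m e)"
  shows "symbolic (\<lambda>i. c (fst i) (fst (snd i)) (snd (snd i)) *\<^sub>R basis (shift a b False i))"
proof -
  define C where "C i = c (fst i) (fst (snd i)) (snd (snd i))" for i :: label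
  define G where "G i = g (fst i) (fst (snd i)) (snd (snd i))" for i :: label
  have cc: "shift a b False i \<in> labels \<and> C i = G i * (gauge (shift a b False i) / gauge i) \<or> C i = 0 \<and>
      G i = 0"
    if i: "i \<in> labels" for i
  proof -
    have "(fst i, fst (snd i), snd (snd i)) \<in> labels" using i by simp
    then obtain n x y :: nat where n: "fst i = real n + 1 / 2" "fst i - fst (snd i) = real x"
      "fst i + fst (snd i) = real y" "x + y = 2 * n + 1"
      by (rule labels_cases)
    show ?thesis
    proof (cases "C i = 0 \<and> G i = 0")
      case False
      then obtain n' x' y' where t: "fst i + a = real n' + 1 / 2" "fst i + a - (fst (snd i) + b) =
          real x'"
        "fst i + a + (fst (snd i) + b) = real y'" "C i = G i * (gauge_at n' x' y' / gauge_at n x y)"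
        using c[OF n, of "snd (snd i)"] unfolding C_def G_def entry_relation_def by blast
      have "shift a b False i \<in> labels" unfolding shift_def by (rule label_nat[OF t(1-3)])
      moreover have "gauge (shift a b False i) = gauge_at n' x' y'"
        unfolding shift_def gauge_at_def by (rule gauge_nat) (use t in simp_all)
      moreover have "gauge i = gauge_at n x y"
        unfolding gauge_at_def by (rule gauge_nat[OF n(1-3)])
      ultimately show ?thesis using t(4) by simp
    qed simp
  qed
  have sym: "(\<lambda>i. (of_real (G i) * of_real (gauge (shift a b False i) /
      gauge i)) *\<^sub>C basis (shift a b False i)) \<in> symbols"
  proof (rule symbols.single)
    show "(\<lambda>i. complex_of_real (G i)) \<in> coefficient" using g unfolding rcoef_def G_def .
    show "complex_of_real (G i) = 0" if "i \<in> labels" "shift a b False i \<notin> labels" for i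
      using cc[OF that(1)] that(2) by simp
  qed
  have "C i *\<^sub>R basis (shift a b False i) =
      (of_real (G i) * of_real (gauge (shift a b False i) / gauge i)) *\<^sub>C basis (shift a b False i)"
          if "i \<in> labels" for i
  proof -
    have "C i = G i * (gauge (shift a b False i) / gauge i)" using cc[OF that] by auto
    then show ?thesis by (simp only: scaleC_algebra(8)[symmetric] of_real_mult)
  qed
  then show ?thesis unfolding symbolic_def C_def[symmetric]
    by (intro bexI[OF _ sym] ballI)
qed

text \<open>Named roots are atoms for the simplifier: each entry identity below becomes a rational
  identity in \<open>qroot\<close>, \<open>rroot\<close> and the gauge factors.\<close>

definition qroot :: "nat \<Rightarrow> real" where
  "qroot x = sqrt (qnum q (real (Suc x)))"

definition rroot :: "nat \<Rightarrow> real" where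
  "rroot n = sqrt (rho (real n + 1 / 2))"

lemma root_sqrt:
  "sqrt (qnum q (real (Suc x))) = qroot x" "sqrt (rho (real n + 1 / 2)) = rroot n"
  "sqrt (qfact (Suc x)) = sqrt (qfact x) * qroot x" "Gam (Suc n) = Gam n * rroot n"
  by (simp_all add: qroot_def rroot_def qfact_Suc Gam_Suc real_sqrt_mult)

lemma root_square: "qnum q (real (Suc x)) = qroot x * qroot x" "rho (real n + 1 / 2) =
    rroot n * rroot n"
  using qnum_pos[of "real (Suc x)"] rho_pos[of "real n + 1 / 2"] by (simp_all add: qroot_def rroot_def)

lemma root_pos: "qroot x > 0" "rroot n > 0" "sqrt (qfact x) > 0"
  by (simp_all add: qroot_def rroot_def qnum_pos rho_pos qfact_pos)

lemma A_plus_symbolic: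
  "symbolic (\<lambda>i. A_plus q (snd (snd i)) (fst i) (fst (snd i)) *\<^sub>R basis (shift 1 0 False i))"
proof -
  \<comment> \<open>A raising entry: the roots of both q-numbers and of \<open>rho\<close> are
    exactly the gauge ratio.\<close>
  define g where "g l m e = - (q powr (m + l + 1 / 2) * alpha_num e l)" for l m e
  have "rcoef (\<lambda>i. g (fst i) (fst (snd i)) (snd (snd i)))"
    unfolding g_def
    by (intro rcoef_minus rcoef_mult rcoef_alpha rcoef_powr[of _ 1 1 "1 / 2"]) simp_all
  then show ?thesis
  proof (rule symbolic_entry[where c = "\<lambda>l m e. A_plus q e l m"])
    fix l m :: real and e and n x y :: nat
    assume l: "l = real n + 1 / 2" "l - m = real x" "l + m = real y" and xy: "x + y = 2 * n + 1"
    have args: "l - m + 1 = real (Suc x)" "l + m + 1 = real (Suc y)" "rho l = rho (real n + 1 / 2)"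
      using l by simp_all
    have "A_plus q e l m = g l m e * (gauge_at (Suc n) (Suc x) (Suc y) / gauge_at n x y)"
      unfolding A_plus_def alpha_plus_eq g_def gauge_at_def args real_sqrt_mult root_sqrt
          unfolding root_square
      using root_pos(1)[of "x"] root_pos(1)[of "y"] root_pos(3)[of x] root_pos(3)[of y]
          root_pos(2)[of n] Gam_pos[of n]
      by (simp add: field_simps)
    then show "entry_relation 1 0 l m n x y (A_plus q e l m) (g l m e)"
      by (rule entry_relationI) (use l in simp_all)
  qed
qed

lemma A_minus_symbolic:
  "symbolic (\<lambda>i. A_minus q (snd (snd i)) (fst i) (fst (snd i)) *\<^sub>R basis (shift (-1) 0 False i))"
proof -
  \<comment> \<open>A lowering entry: the gauge ratio holds the inverse roots, so the full q-numbers
    and the full reciprocal of \<open>rho\<close> appear.\<close>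
  define g where "g l m e = q powr (m - l - 1 / 2) * (qnum q (l - m) * qnum q (l + m)) *
      (- (q powr (2 * l) * alpha_num e (l - 1) * (1 / rho (l - 1))))" for l m e
  have "rcoef (\<lambda>i. g (fst i) (fst (snd i)) (snd (snd i)))"
    unfolding g_def
    by (intro rcoef_minus rcoef_mult rcoef_alpha rcoef_powr[of _ "-1" 1 "- 1 / 2"]
        rcoef_qnum[of _ 1 "-1" 0] rcoef_qnum[of _ 1 1 0] rcoef_powr[of _ 2 0 0]) simp_all
  then show ?thesis
  proof (rule symbolic_entry[where c = "\<lambda>l m e. A_minus q e l m"])
    fix l m :: real and e and n x y :: nat
    assume l: "l = real n + 1 / 2" "l - m = real x" "l + m = real y" and xy: "x + y = 2 * n + 1"
    show "entry_relation (-1) 0 l m n x y (A_minus q e l m) (g l m e)"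
    proof (cases "x = 0 \<or> y = 0")
      \<comment> \<open>At m = l or m = -l the label (l - 1, m) does not exist, and both entries
        vanish.\<close>
      case True
      then have z: "qnum q (l - m) = 0 \<or> qnum q (l + m) = 0"
        unfolding l(2,3) by auto
      show ?thesis
        unfolding entry_relation_def A_minus_def alpha_minus_eq g_def using z by auto
    next
      case False
      define x' where "x' = x - 1"
      define y' where "y' = y - 1"
      define n' where "n' = n - 1"
      \<comment> \<open>\<open>x\<close> and \<open>y\<close> are positive with odd sum, so the sum
        is at least 3 and \<open>n\<close> is positive.\<close>
      have S: "x = Suc x'" "y = Suc y'" "n = Suc n'"
        using xy False unfolding x'_def y'_def n'_def by arith+
      have args: "l - m = real (Suc x')" "l + m = real (Suc y')" "rho (l - 1) = rho (real n' + 1 / 2)"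
        using l S by (simp_all add: add.commute)
      have "A_minus q e l m = g l m e * (gauge_at n' x' y' / gauge_at n x y)"
        unfolding A_minus_def alpha_minus_eq g_def gauge_at_def args S real_sqrt_mult root_sqrt
            unfolding root_square
        using root_pos(1)[of "x'"] root_pos(1)[of "y'"] root_pos(3)[of x'] root_pos(3)[of y']
            root_pos(2)[of n'] Gam_pos[of n']
        by (simp add: field_simps)
      then show ?thesis
        by (rule entry_relationI) (use l S in simp_all)
    qed
  qed
qed

lemma B_plus_symbolic:
  "symbolic (\<lambda>i. B_plus q (snd (snd i)) (fst i) (fst (snd i)) *\<^sub>R basis (shift 1 1 False i))"
proof -
  define g where "g l m e = q powr m * alpha_num e l" for l m e
  have "rcoef (\<lambda>i. g (fst i) (fst (snd i)) (snd (snd i)))"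
    unfolding g_def
    by (intro rcoef_minus rcoef_mult rcoef_alpha rcoef_powr[of _ 0 1 0]) simp_all
  then show ?thesis
  proof (rule symbolic_entry[where c = "\<lambda>l m e. B_plus q e l m"])
    fix l m :: real and e and n x y :: nat
    assume l: "l = real n + 1 / 2" "l - m = real x" "l + m = real y" and xy: "x + y = 2 * n + 1"
    have args: "l + m + 1 = real (Suc y)" "l + m + 2 = real (Suc (Suc y))" "rho l =
        rho (real n + 1 / 2)"
      using l by simp_all
    have "B_plus q e l m = g l m e * (gauge_at (Suc n) x (Suc (Suc y)) / gauge_at n x y)"
      unfolding B_plus_def alpha_plus_eq g_def gauge_at_def args real_sqrt_mult root_sqrt
          unfolding root_square
      using root_pos(1)[of "y"] root_pos(1)[of "Suc y"] root_pos(3)[of x] root_pos(3)[of y]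
          root_pos(2)[of n] Gam_pos[of n]
      by (simp add: field_simps)
    then show "entry_relation 1 1 l m n x y (B_plus q e l m) (g l m e)"
      by (rule entry_relationI) (use l in simp_all)
  qed
qed

lemma B_zero_symbolic:
  "symbolic (\<lambda>i. B_zero q (snd (snd i)) (fst i) (fst (snd i)) *\<^sub>R basis (shift 0 1 False i))"
proof -
  \<comment> \<open>l + m is raised and l - m lowered: the first root is absorbed by the gauge, the
    second becomes a full q-number.\<close>
  define g where "g l m e = q powr m * qnum q (l - m) * alpha_zero q e l" for l m e
  have "rcoef (\<lambda>i. g (fst i) (fst (snd i)) (snd (snd i)))"
    unfolding g_def
    by (intro rcoef_minus rcoef_mult rcoef_alpha rcoef_powr[of _ 0 1 0]
        rcoef_qnum[of _ 1 "-1" 0]) simp_all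
  then show ?thesis
  proof (rule symbolic_entry[where c = "\<lambda>l m e. B_zero q e l m"])
    fix l m :: real and e and n x y :: nat
    assume l: "l = real n + 1 / 2" "l - m = real x" "l + m = real y" and xy: "x + y = 2 * n + 1"
    show "entry_relation 0 1 l m n x y (B_zero q e l m) (g l m e)"
    proof (cases "x = 0")
      case True
      then have z: "qnum q (l - m) = 0"
        unfolding l(2,3) by auto
      show ?thesis
        unfolding entry_relation_def B_zero_def g_def using z by auto
    next
      case False
      define x' where "x' = x - 1"
      have S: "x = Suc x'"
        using xy False unfolding x'_def by arith+
      have args: "l - m = real (Suc x')" "l + m + 1 = real (Suc y)"
        using l S by (simp_all add: add.commute)
      have "B_zero q e l m = g l m e * (gauge_at n x' (Suc y) / gauge_at n x y)"
        unfolding B_zero_def g_def gauge_at_def args S real_sqrt_mult root_sqrt unfolding root_square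
        using root_pos(1)[of "x'"] root_pos(1)[of "y"] root_pos(3)[of x'] root_pos(3)[of y]
            Gam_pos[of n]
        by (simp add: field_simps)
      then show ?thesis
        by (rule entry_relationI) (use l S in simp_all)
    qed
  qed
qed

lemma B_minus_symbolic:
  "symbolic (\<lambda>i. B_minus q (snd (snd i)) (fst i) (fst (snd i)) *\<^sub>R basis (shift (-1) 1 False i))"
proof -
  define g where "g l m e = q powr m * (qnum q (l - m) * qnum q (l - m - 1)) * (- (q powr (2 * l) *
      alpha_num e (l - 1) * (1 / rho (l - 1))))" for l m e
  have "rcoef (\<lambda>i. g (fst i) (fst (snd i)) (snd (snd i)))"
    unfolding g_def
    by (intro rcoef_minus rcoef_mult rcoef_alpha rcoef_powr[of _ 0 1 0] rcoef_qnum[of _ 1 "-1" 0]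
        rcoef_qnum[of _ 1 "-1" "-1"] rcoef_powr[of _ 2 0 0]) simp_all
  then show ?thesis
  proof (rule symbolic_entry[where c = "\<lambda>l m e. B_minus q e l m"])
    fix l m :: real and e and n x y :: nat
    assume l: "l = real n + 1 / 2" "l - m = real x" "l + m = real y" and xy: "x + y = 2 * n + 1"
    show "entry_relation (-1) 1 l m n x y (B_minus q e l m) (g l m e)"
    proof (cases "x = 0 \<or> x = 1")
      \<comment> \<open>l - m drops by two, which is impossible from 0 or 1; one of the two
        q-numbers is then \<open>qnum q 0\<close>.\<close>
      case True
      then have z: "qnum q (l - m) = 0 \<or> qnum q (l - m - 1) = 0"
        unfolding l(2,3) by auto
      show ?thesis
        unfolding entry_relation_def B_minus_def alpha_minus_eq g_def using z by auto
    next
      case False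
      define x' where "x' = x - 2"
      define n' where "n' = n - 1"
      have S: "x = Suc (Suc x')" "n = Suc n'"
        using xy False unfolding x'_def n'_def by arith+
      have args: "l - m - 1 = real (Suc x')" "l - m = real (Suc (Suc x'))" "real (Suc (Suc x')) - 1 =
          real (Suc x')" "rho (l - 1) = rho (real n' + 1 / 2)"
        using l S by (simp_all add: add.commute)
      have "B_minus q e l m = g l m e * (gauge_at n' x' y / gauge_at n x y)"
        unfolding B_minus_def alpha_minus_eq g_def gauge_at_def args S real_sqrt_mult root_sqrt
            unfolding root_square
        using root_pos(1)[of "x'"] root_pos(1)[of "Suc x'"] root_pos(3)[of x'] root_pos(3)[of y]
            root_pos(2)[of n'] Gam_pos[of n']
        by (simp add: field_simps)
      then show ?thesis
        by (rule entry_relationI) (use l S in simp_all)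
    qed
  qed
qed

text \<open>The adjoint of a raising part lowers: its entry from (l, m) to (l - 1, m - 1) is the
  real coefficient \<open>B_plus\<close> read at the target.\<close>

lemma B_plus_adj_symbolic:
  "symbolic (\<lambda>i. B_plus q (snd (snd i)) (fst i - 1) (fst (snd i) - 1) *\<^sub>R basis (shift (-1) (-1) False
      i))"
proof -
  define g where "g l m e = q powr (m - 1) * (qnum q (l + m) * qnum q (l + m - 1)) *
      (alpha_num e (l - 1) * (1 / rho (l - 1)))" for l m e
  have "rcoef (\<lambda>i. g (fst i) (fst (snd i)) (snd (snd i)))"
    unfolding g_def
    by (intro rcoef_minus rcoef_mult rcoef_alpha rcoef_powr[of _ 0 1 "-1"] rcoef_qnum[of _ 1 1 0]
        rcoef_qnum[of _ 1 1 "-1"]) simp_all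
  then show ?thesis
  proof (rule symbolic_entry[where c = "\<lambda>l m e. B_plus q e (l - 1) (m - 1)"])
    fix l m :: real and e and n x y :: nat
    assume l: "l = real n + 1 / 2" "l - m = real x" "l + m = real y" and xy: "x + y = 2 * n + 1"
    show "entry_relation (-1) (-1) l m n x y (B_plus q e (l - 1) (m - 1)) (g l m e)"
    proof (cases "y = 0 \<or> y = 1")
      case True
      then have z: "qnum q (l + m) = 0 \<or> qnum q (l + m - 1) = 0"
        unfolding l(2,3) by auto
      have a0: "l - 1 + (m - 1) + 1 = l + m - 1" "l - 1 + (m - 1) + 2 = l + m"
        by simp_all
      show ?thesis
        unfolding entry_relation_def B_plus_def alpha_plus_eq g_def a0 using z by auto
    next
      case False
      define y' where "y' = y - 2"
      define n' where "n' = n - 1"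
      have S: "y = Suc (Suc y')" "n = Suc n'"
        using xy False unfolding y'_def n'_def by arith+
      have args: "l - 1 + (m - 1) + 1 = real (Suc y')" "l - 1 + (m - 1) + 2 =
          real (Suc (Suc y'))" "l + m - 1 = real (Suc y')" "l + m =
              real (Suc (Suc y'))" "real (Suc (Suc y')) - 1 = real (Suc y')" "rho (l - 1) =
                  rho (real n' + 1 / 2)"
        using l S by (simp_all add: add.commute)
      have "B_plus q e (l - 1) (m - 1) = g l m e * (gauge_at n' x y' / gauge_at n x y)"
        unfolding B_plus_def alpha_plus_eq g_def gauge_at_def args S real_sqrt_mult root_sqrt
            unfolding root_square
        using root_pos(1)[of "y'"] root_pos(1)[of "Suc y'"] root_pos(3)[of x] root_pos(3)[of y']
            root_pos(2)[of n'] Gam_pos[of n']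
        by (simp add: field_simps)
      then show ?thesis
        by (rule entry_relationI) (use l S in simp_all)
    qed
  qed
qed

lemma B_zero_adj_symbolic:
  "symbolic (\<lambda>i. B_zero q (snd (snd i)) (fst i) (fst (snd i) - 1) *\<^sub>R basis (shift 0 (-1) False i))"
proof -
  define g where "g l m e = q powr (m - 1) * qnum q (l + m) * alpha_zero q e l" for l m e
  have "rcoef (\<lambda>i. g (fst i) (fst (snd i)) (snd (snd i)))"
    unfolding g_def
    by (intro rcoef_minus rcoef_mult rcoef_alpha rcoef_powr[of _ 0 1 "-1"]
        rcoef_qnum[of _ 1 1 0]) simp_all
  then show ?thesis
  proof (rule symbolic_entry[where c = "\<lambda>l m e. B_zero q e l (m - 1)"])
    fix l m :: real and e and n x y :: nat
    assume l: "l = real n + 1 / 2" "l - m = real x" "l + m = real y" and xy: "x + y = 2 * n + 1"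
    show "entry_relation 0 (-1) l m n x y (B_zero q e l (m - 1)) (g l m e)"
    proof (cases "y = 0")
      case True
      then have z: "qnum q (l + m) = 0"
        unfolding l(2,3) by auto
      have a0: "l + (m - 1) + 1 = l + m"
        by simp_all
      show ?thesis
        unfolding entry_relation_def B_zero_def g_def a0 using z by auto
    next
      case False
      define y' where "y' = y - 1"
      have S: "y = Suc y'"
        using xy False unfolding y'_def by arith+
      have args: "l + (m - 1) + 1 = real (Suc y')" "l - (m - 1) = real (Suc x)" "l + m = real (Suc y')"
        using l S by (simp_all add: add.commute)
      have "B_zero q e l (m - 1) = g l m e * (gauge_at n (Suc x) y' / gauge_at n x y)"
        unfolding B_zero_def g_def gauge_at_def args S real_sqrt_mult root_sqrt unfolding root_square
        using root_pos(1)[of "x"] root_pos(1)[of "y'"] root_pos(3)[of x] root_pos(3)[of y']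
            Gam_pos[of n]
        by (simp add: field_simps)
      then show ?thesis
        by (rule entry_relationI) (use l S in simp_all)
    qed
  qed
qed

text \<open>The adjoint of the lowering part raises \<open>l\<close>, so the gauge removes all roots
  from its entries.\<close>

lemma B_minus_adj_symbolic:
  "symbolic (\<lambda>i. B_minus q (snd (snd i)) (fst i +
      1) (fst (snd i) - 1) *\<^sub>R basis (shift 1 (-1) False i))"
proof -
  define g where "g l m e = - (q powr (m - 1) * q powr (2 * (l + 1)) * alpha_num e l)" for l m e
  have "rcoef (\<lambda>i. g (fst i) (fst (snd i)) (snd (snd i)))"
    unfolding g_def
    by (intro rcoef_minus rcoef_mult rcoef_alpha rcoef_powr[of _ 0 1 "-1"]
        rcoef_powr[of _ 2 0 2]) simp_all
  then show ?thesis
  proof (rule symbolic_entry[where c = "\<lambda>l m e. B_minus q e (l + 1) (m - 1)"])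
    fix l m :: real and e and n x y :: nat
    assume l: "l = real n + 1 / 2" "l - m = real x" "l + m = real y" and xy: "x + y = 2 * n + 1"
    have args: "l + 1 - (m - 1) - 1 = real (Suc x)" "l + 1 - (m - 1) =
        real (Suc (Suc x))" "real (Suc (Suc x)) - 1 = real (Suc x)" "l + 1 - 1 = l" "rho l =
            rho (real n + 1 / 2)"
      using l by simp_all
    have "B_minus q e (l + 1) (m - 1) = g l m e * (gauge_at (Suc n) (Suc (Suc x)) y / gauge_at n x y)"
      unfolding B_minus_def alpha_minus_eq g_def gauge_at_def args real_sqrt_mult root_sqrt
          unfolding root_square
      using root_pos(1)[of "x"] root_pos(1)[of "Suc x"] root_pos(3)[of x] root_pos(3)[of y]
          root_pos(2)[of n] Gam_pos[of n]
      by (simp add: field_simps)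
    then show "entry_relation 1 (-1) l m n x y (B_minus q e (l + 1) (m - 1)) (g l m e)"
      by (rule entry_relationI) (use l in simp_all)
  qed
qed

section \<open>All differential operators are banded\<close>

text \<open>\<open>gauge\<close> does not depend on the sign, so operators that keep
  \<open>l\<close> and \<open>m\<close> have gauge ratio one; \<open>s = True\<close> serves
  \<open>dirac\<close>.\<close>

lemma symbolic_level:
  assumes "f \<in> coefficient" shows "symbolic (\<lambda>i. f i *\<^sub>C basis (shift 0 0 s i))"
proof -
  have v: "(\<lambda>i. (f i * of_real (gauge (shift 0 0 s i) / gauge i)) *\<^sub>C basis (shift 0 0 s i)) \<in> symbols"
    by (rule symbols.single[OF assms]) (auto simp: shift_def labels_def)
  have g: "gauge (shift 0 0 s i) = gauge i" for i
    by (simp add: gauge_def shift_def)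
  have "gauge (shift 0 0 s i) / gauge i = 1" for i
    using gauge_pos[of i] unfolding g by simp
  then have "f i *\<^sub>C basis (shift 0 0 s i) = (f i * of_real (gauge (shift 0 0 s i) /
      gauge i)) *\<^sub>C basis (shift 0 0 s i)" for i
    by (simp only: of_real_1 mult_1_right)
  then show ?thesis unfolding symbolic_def by (intro bexI[OF _ v] ballI)
qed

lemma symbolic_level_real:
  assumes "rcoef f" shows "symbolic (\<lambda>i. f i *\<^sub>R basis (shift 0 0 s i))"
  using symbolic_level[of "\<lambda>i. of_real (f i)" s] assms unfolding rcoef_def scaleC_algebra(8) by blast

lemma rcoef_A_zero: "rcoef (\<lambda>i. A_zero q (snd (snd i)) (fst i) (fst (snd i)))"
proof -
  have "rcoef (\<lambda>i. q powr (-1/2) / (1 + q\<^sup>2) *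
     (qnum q (fst i - fst (snd i) + 1) * qnum q (fst i + fst (snd i)) +
       (- q\<^sup>2) * (qnum q (fst i - fst (snd i)) * qnum q (fst i + fst (snd i) + 1)))
     * alpha_zero q (snd (snd i)) (fst i) + 1 / (1 + q\<^sup>2))"
    by (intro rcoef_add rcoef_mult rcoef_alpha rcoef_const rcoef_qnum[of _ 1 "-1" 1]
        rcoef_qnum[of _ 1 1 0]
        rcoef_qnum[of _ 1 "-1" 0] rcoef_qnum[of _ 1 1 1]) simp_all
  then show ?thesis by (simp add: A_zero_def mult.assoc)
qed

lemma banded_op_A: "banded (op_A q)"
proof -
  let ?u = "\<lambda>i. A_plus q (snd (snd i)) (fst i) (fst (snd i)) *\<^sub>R basis (shift 1 0 False i)
      + A_zero q (snd (snd i)) (fst i) (fst (snd i)) *\<^sub>R basis (shift 0 0 False i)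
      + A_minus q (snd (snd i)) (fst i) (fst (snd i)) *\<^sub>R basis (shift (-1) 0 False i)"
  have "symbolic ?u"
    by (intro symbolic_add A_plus_symbolic A_minus_symbolic symbolic_level_real rcoef_A_zero)
  moreover have "op_A q = basis_op ?u"
    unfolding op_A_def by (rule basis_op_cong) (auto simp: shift_def)
  ultimately show ?thesis by (simp add: banded_symbolic)
qed

definition B_action :: "label \<Rightarrow> hilb" where
  "B_action i = B_plus q (snd (snd i)) (fst i) (fst (snd i)) *\<^sub>R basis (shift 1 1 False i)
      + B_zero q (snd (snd i)) (fst i) (fst (snd i)) *\<^sub>R basis (shift 0 1 False i)
      + B_minus q (snd (snd i)) (fst i) (fst (snd i)) *\<^sub>R basis (shift (-1) 1 False i)"

definition B_adjoint_action :: "label \<Rightarrow> hilb" where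
  "B_adjoint_action i = B_plus q (snd (snd i)) (fst i - 1) (fst (snd i) - 1) *\<^sub>R basis (shift (-1)
      (-1) False i)
      + B_zero q (snd (snd i)) (fst i) (fst (snd i) - 1) *\<^sub>R basis (shift 0 (-1) False i)
      + B_minus q (snd (snd i)) (fst i + 1) (fst (snd i) - 1) *\<^sub>R basis (shift 1 (-1) False i)"

lemma op_B_eq: "op_B q = basis_op B_action"
  unfolding op_B_def by (rule basis_op_cong) (auto simp: shift_def B_action_def)

lemma symbolic_B: "symbolic B_action" "symbolic B_adjoint_action"
  unfolding B_action_def B_adjoint_action_def
  by (intro symbolic_add B_plus_symbolic B_zero_symbolic B_minus_symbolic
      B_plus_adj_symbolic B_zero_adj_symbolic B_minus_adj_symbolic)+

lemma hcoeff_B_adjoint_action: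
  assumes "i \<in> labels" "j \<in> labels"
  shows "hcoeff (B_adjoint_action i) j = cnj (hcoeff (B_action j) i)"
proof -
  have e: "j = shift (-1) (-1) False i \<longleftrightarrow> i = shift 1 1 False j" "j = shift 0 (-1) False i \<longleftrightarrow> i =
      shift 0 1 False j"
    "j = shift 1 (-1) False i \<longleftrightarrow> i = shift (-1) 1 False j"
    by (cases i; cases j; auto simp: shift_def)+
  have s: "fst (shift a b False j) = fst j + a" "fst (snd (shift a b False j)) = fst (snd j) + b"
    "snd (snd (shift a b False j)) = snd (snd j)" for a b
    by (simp_all add: shift_def)
  have d: "shift 1 1 False j \<noteq> shift 0 1 False j" "shift 1 1 False j \<noteq> shift (-1) 1 False j"
    "shift 0 1 False j \<noteq> shift (-1) 1 False j"
    by (simp_all add: shift_def)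
  show ?thesis
    unfolding B_adjoint_action_def B_action_def hcoeff_simps hcoeff_basis e
    using assms d d[symmetric]
    by (cases "i = shift 1 1 False j"; cases "i = shift 0 1 False j"; cases "i =
        shift (-1) 1 False j") (simp_all add: s)
qed

lemma finlin_cong:
  assumes "\<And>x. finsupp x \<Longrightarrow> S x = T x" "finlin T" shows "finlin S"
proof -
  have "S (x + y) = T (x + y)" "S (c *\<^sub>C x) = T (c *\<^sub>C x)" if "finsupp x" "finsupp y" for x y c
    using that by (simp_all add: assms(1) finsupp_add finsupp_scale)
  then show ?thesis using assms unfolding finlin_def by simp
qed

text \<open>The adjoint is identified with an explicit operator on finitely supported vectors, which
  is where \<open>banded\<close> looks.\<close>

lemma banded_op_B_adj: "banded (op_adj (op_B q))"
proof -
  have eq: "op_adj (op_B q) x = basis_op B_adjoint_action x" if "finsupp x" for x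
    unfolding op_B_eq using hcoeff_B_adjoint_action that by (rule op_adj_basis_op)
  obtain v where v: "finlin (basis_op B_adjoint_action)" "v \<in> symbols"
    "\<And>i. i \<in> labels \<Longrightarrow> basis_op B_adjoint_action (basis i) = Some (v i)"
    using banded_symbolic[OF symbolic_B(2)] by (rule bandedE) blast
  show ?thesis
    by (rule bandedI[OF finlin_cong[OF eq v(1)] v(2)]) (simp_all add: eq v(3))
qed

lemma banded_podles: "T \<in> podles_alg q \<Longrightarrow> banded T"
  unfolding podles_alg_def
  by (erule banded_alg_gen) (use banded_op_A banded_op_B_adj banded_symbolic[OF symbolic_B(1)]
      in \<open>auto simp: op_B_eq\<close>)

lemma expansion_qnum_half: "expansion (\<lambda>l. of_real (qnum q (l + 1 / 2)))"
  using expansion_qnum[of 1 "1 / 2"] by simp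

lemma banded_dirac: "banded (dirac q w)"
proof -
  let ?f = "\<lambda>i. (\<lambda>e l. (if e then w else cnj w) * of_real (qnum q (l + 1 / 2))) (snd (snd i)) (fst i)"
  have "?f \<in> coefficient"
    by (rule coefficient_expansion) (intro expansion_mult expansion_const expansion_qnum_half)
  then have "symbolic (\<lambda>i. ?f i *\<^sub>C basis (shift 0 0 True i))" by (rule symbolic_level)
  moreover have "dirac q w = basis_op (\<lambda>i. ?f i *\<^sub>C basis (shift 0 0 True i))"
    unfolding dirac_def by (rule basis_op_cong) (auto simp: shift_def)
  ultimately show ?thesis by (simp add: banded_symbolic)
qed

lemma banded_abs_dirac: "banded (abs_dirac q w)"
proof -
  have "rcoef (\<lambda>i. abs_dirac_eigenvalue q w (fst i))"
  proof -
    have "expansion (\<lambda>l. of_real (cmod w) * of_real (qnum q (l + 1 / 2)))"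
      by (intro expansion_mult expansion_const expansion_qnum_half)
    then show ?thesis
      using rcoef_expansion[of "\<lambda>e l. abs_dirac_eigenvalue q w l"]
          by (simp add: abs_dirac_eigenvalue_def)
  qed
  then have "symbolic (\<lambda>i. abs_dirac_eigenvalue q w (fst i) *\<^sub>R basis (shift 0 0 False i))"
    by (rule symbolic_level_real)
  moreover have "abs_dirac q w = basis_op (\<lambda>i. abs_dirac_eigenvalue q w (fst i) *\<^sub>R basis (shift 0 0
      False i))"
    unfolding abs_dirac_def by (rule basis_op_cong) (auto simp: shift_def)
  ultimately show ?thesis by (simp add: banded_symbolic)
qed

lemma banded_diff_ops:
  assumes "T \<in> diff_ops q w" shows "banded T"
  using assms unfolding diff_ops_def
  by (rule banded_alg_gen) (auto intro: banded_podles banded_conj_J banded_dirac banded_abs_dirac)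

end


subsection \<open>The zeta functions\<close>

locale podles_dirac = podles_param +
  fixes w :: complex
  assumes w_nonzero: "w \<noteq> 0"
begin

abbreviation lam :: "label \<Rightarrow> real" where
  "lam i \<equiv> abs_dirac_eigenvalue q w (fst i)"

text \<open>Chosen so that |w| [nu] = kappa q^(-nu) (1 - q^(2 nu)).\<close>

definition kappa :: real where
  "kappa = cmod w / (1 / q - q)"

lemma kappa_pos: "kappa > 0"
  unfolding kappa_def using w_nonzero q_gap by simp

lemma eigenvalue_eq:
  "abs_dirac_eigenvalue q w (real n + 1 / 2) = kappa * (q powr (- real (Suc n)) * (1 - q ^ (2 *
      Suc n)))"
proof -
  have "real n + 1 / 2 + 1 / 2 = real (Suc n)" by simp
  moreover have "q powr (2 * real (Suc n)) = q ^ (2 * Suc n)"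
    unfolding q_power_eq_powr by simp
  ultimately show ?thesis
    unfolding abs_dirac_eigenvalue_def kappa_def qnum_eq by (simp only:) simp
qed

lemma eigenvalue_bounds:
  "abs_dirac_eigenvalue q w (real n + 1 / 2) > 0"
  "kappa * (1 - q\<^sup>2) * q powr (- real (Suc n)) \<le> abs_dirac_eigenvalue q w (real n + 1 / 2)"
proof -
  show "abs_dirac_eigenvalue q w (real n + 1 / 2) > 0"
    unfolding eigenvalue_eq using kappa_pos q_power_bound(3)[of n] q_pos by simp
  have "q powr (- real (Suc n)) * (1 - q\<^sup>2) \<le> q powr (- real (Suc n)) * (1 - q ^ (2 * Suc n))"
    using q_power_bound(2)[of n] by (intro mult_left_mono) auto
  then have "kappa * (q powr (- real (Suc n)) * (1 - q\<^sup>2)) \<le>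
      kappa * (q powr (- real (Suc n)) * (1 - q ^ (2 * Suc n)))"
    by (rule mult_left_mono) (use kappa_pos in simp)
  then show "kappa * (1 - q\<^sup>2) * q powr (- real (Suc n)) \<le> abs_dirac_eigenvalue q w (real n + 1 / 2)"
    unfolding eigenvalue_eq by (simp only: mult_ac)
qed

text \<open>This is q |w|, smaller than the lowest eigenvalue |w|: the constant for which lam_min
  q^(-nu) is a lower bound at every level.\<close>

definition lam_min :: real where
  "lam_min = kappa * (1 - q\<^sup>2)"

lemma lam_min_pos: "lam_min > 0"
  unfolding lam_min_def using kappa_pos q_sq by simp

lemma lam_lower:
  assumes "i \<in> labels" shows "lam_min \<le> lam i" "0 < lam i"
proof -
  have "(fst i, fst (snd i), snd (snd i)) \<in> labels" using assms by simp
  then obtain n x y :: nat where n: "fst i = real n + 1 / 2" by (rule labels_cases)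
  have "q powr 0 \<le> q powr (- real (Suc n))" using q_pos q_less_1 by (intro powr_mono') auto
  then have "lam_min * 1 \<le> lam_min * q powr (- real (Suc n))"
    using lam_min_pos q_pos by (intro mult_left_mono) auto
  then show "lam_min \<le> lam i"
    using eigenvalue_bounds(2)[of n] unfolding n lam_min_def by simp
  then show "0 < lam i" using lam_min_pos by simp
qed

text \<open>Separates the zero-free entire factor kappa^(-s) from the terms of the series continued
  above.\<close>

lemma eigenvalue_powr:
  "of_real (abs_dirac_eigenvalue q w (real n + 1 / 2)) powr (- s) =
     of_real kappa powr (- s) * (qexp (of_nat (Suc n) * s) * weight n s)"
proof -
  have p: "1 - q ^ (2 * Suc n) > 0" "q powr (- real (Suc n)) > 0"
    using q_power_bound(3)[of n] q_pos by auto
  have L: "ln (abs_dirac_eigenvalue q w (real n + 1 / 2)) =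
      ln kappa + (- real (Suc n) * ln q + ln (1 - q ^ (2 * Suc n)))"
    unfolding eigenvalue_eq using kappa_pos p q_pos by (simp add: ln_mult ln_powr del: of_nat_Suc)
  have "- s * of_real (ln (abs_dirac_eigenvalue q w (real n + 1 / 2))) =
      - s * of_real (ln kappa) + (of_real (ln q) * (of_nat (Suc n) * s) + - s *
          of_real (ln (1 - q ^ (2 * Suc n))))"
    unfolding L by (simp add: algebra_simps del: of_nat_Suc power_Suc mult_Suc_right)
  then show ?thesis
    unfolding powr_def qexp_def weight_def using eigenvalue_bounds(1)[of n] kappa_pos
    by (simp add: Ln_of_real exp_add[symmetric] del: of_nat_Suc)
qed

lemma norm_lam_powr: "i \<in> labels \<Longrightarrow> cmod (of_real (lam i) powr z) = lam i powr Re z"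
  using lam_lower(2)[of i] by (simp add: norm_powr_real_powr)

lemma abs_dirac_pow_eq: "abs_dirac_pow q w z = diag_op (\<lambda>i. of_real (lam i) powr z)"
  unfolding abs_dirac_pow_def diag_op_def by (rule basis_op_cong) auto

lemma bessel_pot_eq: "bessel_pot q w s = diag_op (\<lambda>i. of_real ((1 + (lam i)\<^sup>2) powr (s / 2)))"
  unfolding bessel_pot_def diag_op_def by (rule basis_op_cong) (auto simp: scaleC_algebra)

lemma H_infty_iff: "x \<in> H_infty q w \<longleftrightarrow> (\<forall>s::real. s \<ge> 0 \<longrightarrow>
    ell2 (\<lambda>i. of_real (lam i) powr of_real s * hcoeff x i))"
  unfolding H_infty_def abs_dirac_pow_eq by (auto simp: dom_diag_op)

lemma finsupp_H_infty: "finsupp x \<Longrightarrow> x \<in> H_infty q w"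
  unfolding H_infty_def abs_dirac_pow_eq using finlinD(3)[OF finlin_diag_op] by blast

lemma H_infty_diff:
  assumes "x \<in> H_infty q w" "y \<in> H_infty q w" shows "x - y \<in> H_infty q w"
  using assms clinear_op_simps(6)[OF clinear_diag_op] unfolding H_infty_def abs_dirac_pow_eq by blast

lemma sobolev_norm_0: "sobolev_norm q w 0 x = sqrt 2 * norm x"
proof -
  have d: "(1 + (lam i)\<^sup>2) powr (0 / 2) = 1" for i
  proof -
    have "1 + (lam i)\<^sup>2 \<noteq> 0" by (metis add_pos_nonneg less_irrefl zero_le_power2 zero_less_one)
    then show ?thesis by simp
  qed
  have "bessel_pot q w 0 = diag_op (\<lambda>i. 1)"
    unfolding bessel_pot_eq d by simp
  moreover have "diag_op (\<lambda>i. 1) x = Some x"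
    unfolding diag_op_def by (rule basis_op_eqI) (use diag_op_has_sum[of x "\<lambda>i. 1"] in simp)
  ultimately have "sobolev_norm q w 0 x = sqrt (2 * (norm x)\<^sup>2)"
    unfolding sobolev_norm_def by simp
  then show ?thesis by (simp add: real_sqrt_mult)
qed

text \<open>At s = 0 the Sobolev estimate is one in the Hilbert norm and yields an extension. It is
  unique because \<open>H_infty\<close> contains the basis vectors, so the definite description in
  \<open>bounded_ext\<close> is meaningful.\<close>

lemma bounded_ext_props:
  assumes "P \<in> op_class q w 0"
  shows "bounded_op (bounded_ext q w P)" "x \<in> H_infty q w \<Longrightarrow> bounded_ext q w P x = P x"
proof -
  have P: "clinear_op P" "H_infty q w \<subseteq> dom P"
    and bd: "\<And>s. s \<ge> 0 \<Longrightarrow> \<exists>C. \<forall>x\<in>H_infty q w. sobolev_norm q w (s - 0) (the (P x)) \<le>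
        C * sobolev_norm q w s x"
    using assms unfolding op_class_def by blast+
  obtain C where "\<And>x. x \<in> H_infty q w \<Longrightarrow> sobolev_norm q w (0 - 0) (the (P x)) \<le> C * sobolev_norm q w 0 x"
    using bd[of 0] by blast
  then have C: "norm (the (P x)) \<le> C * norm x" if "x \<in> H_infty q w" for x
    using that[THEN \<open>\<And>x. x \<in> H_infty q w \<Longrightarrow> _\<close>] by (simp add: sobolev_norm_0)
  have C': "norm (the (P x)) \<le> \<bar>C\<bar> * norm x" if "x \<in> H_infty q w" for x
    using order_trans[OF C[OF that] mult_right_mono[OF abs_ge_self norm_ge_zero]] .
  obtain S where S: "bounded_op S" "\<forall>x\<in>H_infty q w. S x = P x"
    using bounded_extension_exists[OF P finsupp_H_infty H_infty_diff C' abs_ge_zero] by blast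
  have "S' = S" if S': "bounded_op S' \<and> (\<forall>x\<in>H_infty q w. S' x = P x)" for S'
  proof (rule bounded_op_eqI)
    show "S' (basis i) = S (basis i)" for i
      using S' S(2) finsupp_H_infty[OF finsupp_ket] by simp
  qed (use S' S in auto)
  then have "bounded_ext q w P = S"
    unfolding bounded_ext_def using S by (intro the_equality) blast+
  then show "bounded_op (bounded_ext q w P)" "x \<in> H_infty q w \<Longrightarrow> bounded_ext q w P x = P x"
    using S by auto
qed

section \<open>Traces, level by level\<close>

lemma has_sum_labels_imp_sums:
  fixes f :: "label \<Rightarrow> complex"
  assumes "f summable_on labels"
  shows "(\<lambda>n. \<Sum>k<2 * n + 2. \<Sum>e\<in>UNIV. f (real n + 1 / 2, real k - (real n + 1 / 2), e)) sums
      (\<Sum>\<^sub>\<infinity>i\<in>labels. f i)"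
proof -
  have "((\<lambda>x. f (label_of x)) has_sum (\<Sum>\<^sub>\<infinity>i\<in>labels. f i)) (SIGMA n:UNIV. {..<2 * n + 2} \<times> UNIV)"
    using has_sum_reindex_bij_betw[OF label_of_bij, of f] has_sum_infsum[OF assms]
        unfolding label_index_def by blast
  moreover have "((\<lambda>y. f (label_of (n, y))) has_sum (\<Sum>y\<in>{..<2 * n + 2} \<times> UNIV. f (label_of (n,
      y)))) ({..<2 * n + 2} \<times> UNIV)" for n
    by (rule has_sum_finite) simp
  ultimately have "((\<lambda>n. \<Sum>y\<in>{..<2 * n + 2} \<times> UNIV. f (label_of (n, y))) has_sum
      (\<Sum>\<^sub>\<infinity>i\<in>labels. f i)) UNIV"
    by (rule has_sum_SigmaD)
  then have "(\<lambda>n. \<Sum>y\<in>{..<2 * n + 2} \<times> UNIV. f (label_of (n, y))) sums (\<Sum>\<^sub>\<infinity>i\<in>labels. f i)"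
    by (rule has_sum_imp_sums)
  then show ?thesis
    by (simp only: sum.cartesian_product label_of_def case_prod_unfold fst_conv snd_conv)
qed

lemma eigenvalue_powr_upper:
  assumes "\<sigma> \<ge> 0"
  shows "abs_dirac_eigenvalue q w (real n + 1 / 2) powr (- \<sigma>) \<le> lam_min powr (- \<sigma>) * (q powr \<sigma>) ^ Suc n"
proof -
  have "abs_dirac_eigenvalue q w (real n + 1 / 2) powr (- \<sigma>) \<le>
      (lam_min * q powr (- real (Suc n))) powr (- \<sigma>)"
    using assms eigenvalue_bounds(2)[of n] lam_min_pos q_pos unfolding lam_min_def[symmetric]
    by (intro powr_mono2') auto
  also have "\<dots> = lam_min powr (- \<sigma>) * (q powr (- real (Suc n))) powr (- \<sigma>)"
    using lam_min_pos by (simp add: powr_mult)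
  also have "(q powr (- real (Suc n))) powr (- \<sigma>) = q powr (\<sigma> * real (Suc n))"
    by (simp add: powr_powr mult.commute del: of_nat_Suc)
  finally show ?thesis unfolding q_powr_power .
qed

text \<open>Level \<open>n\<close> has 2 (2n + 2) = 4 (n + 1) labels with one eigenvalue, of size
  q^(-(n+1)); the sum is dominated by terms (n + 1) q^((n+1) Re s), which are summable for every
  positive real part.\<close>

lemma summable_lam_powr:
  assumes s: "Re s > 0"
  shows "(\<lambda>i. cmod (of_real (lam i) powr (- s))) summable_on labels"
proof -
  define c where "c n = abs_dirac_eigenvalue q w (real n + 1 / 2) powr (- Re s)" for n
  have nm: "cmod (of_real (lam (label_of (n, y))) powr (- s)) = c n" for n y
    using eigenvalue_bounds(1)[of n] by (simp add: label_of_def c_def split_beta norm_powr_real_powr)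
  define r where "r = q powr Re s"
  have r: "0 < r" "r < 1" using q_powr_less_1[OF s] q_pos by (auto simp: r_def)
  have "summable (\<lambda>n. real (Suc n) * r ^ n)"
    using geometric_deriv_sums[of r] r by (auto simp: sums_iff)
  then have "summable (\<lambda>n. 4 * lam_min powr (- Re s) * r * (real (Suc n) * r ^ n))"
    by (rule summable_mult)
  then have "summable (\<lambda>n. real (4 * Suc n) * c n)"
  proof (rule summable_comparison_test')
    fix n
    have "real (4 * Suc n) * c n \<le> real (4 * Suc n) * (lam_min powr (- Re s) * r ^ Suc n)"
      unfolding c_def r_def using s by (intro mult_left_mono eigenvalue_powr_upper) auto
    also have "\<dots> = 4 * lam_min powr (- Re s) * r * (real (Suc n) * r ^ n)"
      by (simp add: algebra_simps)
    also have "real (4 * Suc n) * c n = norm (real (4 * Suc n) * c n)"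
      by (simp add: c_def)
    finally show "norm (real (4 * Suc n) * c n) \<le> 4 * lam_min powr (- Re s) * r * (real (Suc n) *
        r ^ n)" .
  qed
  then have "(\<lambda>n. real (4 * Suc n) * c n) summable_on UNIV"
    by (subst summable_on_UNIV_nonneg_real_iff) (auto simp: c_def)
  then have sm: "(\<lambda>n. norm (real (4 * Suc n) * c n)) summable_on UNIV"
    by (simp add: c_def)
  define F where "F x = cmod (of_real (lam (label_of x)) powr (- s))" for x
  have inf: "(\<Sum>\<^sub>\<infinity>y\<in>{..<2 * n + 2} \<times> (UNIV :: bool set). norm (F (n, y))) = real (4 * Suc n) * c n" for n
    unfolding F_def nm by (simp add: c_def card_cartesian_product)
  have "(\<lambda>x. norm (F x)) summable_on (SIGMA n:UNIV. {..<2 * n + 2} \<times> UNIV)"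
  proof (rule Infinite_Sum.abs_summable_on_Sigma_iff[THEN iffD2], intro conjI ballI)
    show "(\<lambda>y. norm (F (n, y))) summable_on {..<2 * n + 2} \<times> UNIV" for n
      by (rule summable_on_finite) simp
    show "(\<lambda>n. norm (\<Sum>\<^sub>\<infinity>y\<in>{..<2 * n + 2} \<times> (UNIV :: bool set). norm (F (n, y)))) summable_on UNIV"
      unfolding inf by (rule sm)
  qed
  then have "(\<lambda>x. cmod (of_real (lam (label_of x)) powr (- s))) summable_on label_index"
    unfolding label_index_def by (simp add: F_def)
  then show ?thesis
    using summable_on_reindex_bij_betw[OF label_of_bij, of "\<lambda>i. cmod (of_real (lam i) powr (- s))"]
        by simp
qed

text \<open>The partial trace of \<open>P\<close> over the eigenspace of |D| with l = n +
  1/2.\<close>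

definition diag_sum :: "oper \<Rightarrow> nat \<Rightarrow> complex" where
  "diag_sum P n = (\<Sum>k<2 * n + 2. \<Sum>e\<in>UNIV.
     (let i = (real n + 1 / 2, real k - (real n + 1 / 2), e) in hcoeff (the (P (basis i))) i))"

lemma diagonal_bound:
  assumes P: "P \<in> op_class q w 0"
  shows "\<exists>C\<ge>0. \<forall>i. cmod (hcoeff (the (P (basis i))) i) \<le> C"
proof -
  obtain C where C: "C \<ge> 0" "\<And>x. norm (the (bounded_ext q w P x)) \<le> C * norm x"
    using bounded_ext_props(1)[OF P] by (rule bounded_opE) blast
  have "cmod (hcoeff (the (P (basis i))) i) \<le> C" for i
  proof -
    have "bounded_ext q w P (basis i) = P (basis i)"
      by (rule bounded_ext_props(2)[OF P finsupp_H_infty[OF finsupp_ket]])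
    then have "norm (the (P (basis i))) \<le> C * norm (basis i)" using C(2)[of "basis i"] by simp
    also have "\<dots> \<le> C * 1" by (rule mult_left_mono[OF norm_basis_le C(1)])
    finally show ?thesis using hcoeff_le_norm[of "the (P (basis i))" i] by linarith
  qed
  then show ?thesis using C(1) by blast
qed

text \<open>The eigenvalue is constant on a level, so the diagonal of \<open>P\<close> enters only
  through \<open>diag_sum\<close>.\<close>

lemma trace_sums:
  assumes P: "P \<in> op_class q w 0" and s: "Re s > 0"
  shows "trace_class (bounded_ext q w P \<circ>\<^sub>m abs_dirac_pow q w (- s))"
    "(\<lambda>n. diag_sum P n * (of_real kappa powr (- s) * (qexp (of_nat (Suc n) * s) * weight n s))) sums
      op_trace (bounded_ext q w P \<circ>\<^sub>m abs_dirac_pow q w (- s))"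
proof -
  let ?S = "bounded_ext q w P"
  have S: "bounded_op ?S" by (rule bounded_ext_props(1)[OF P])
  have sb: "?S (basis i) = P (basis i)" for i
    by (rule bounded_ext_props(2)[OF P finsupp_H_infty[OF finsupp_ket]])
  note T = trace_class_diag[OF S summable_lam_powr[OF s]]
  show "trace_class (?S \<circ>\<^sub>m abs_dirac_pow q w (- s))"
    unfolding abs_dirac_pow_eq by (rule T(1))
  obtain C where d: "C \<ge> 0" "\<And>i. cmod (hcoeff (the (P (basis i))) i) \<le> C"
    using diagonal_bound[OF P] by blast
  define f where "f i = of_real (lam i) powr (- s) * hcoeff (the (P (basis i))) i" for i
  have "(\<lambda>i. C * cmod (of_real (lam i) powr (- s))) summable_on labels"
    by (rule summable_on_cmult_right[OF summable_lam_powr[OF s]])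
  then have "(\<lambda>i. norm (f i)) summable_on labels"
  proof (rule summable_on_comparison_test)
    show "norm (f i) \<le> C * cmod (of_real (lam i) powr (- s))" for i
      unfolding f_def norm_mult using mult_left_mono[OF d(2) norm_ge_zero] by (simp only: mult.commute)
  qed simp
  then have "f summable_on labels" by (rule abs_summable_summable)
  from has_sum_labels_imp_sums[OF this]
  have "(\<lambda>n. \<Sum>k<2 * n + 2. \<Sum>e\<in>UNIV. f (real n + 1 / 2, real k - (real n + 1 / 2), e)) sums
      op_trace (?S \<circ>\<^sub>m abs_dirac_pow q w (- s))"
    unfolding abs_dirac_pow_eq T(2) f_def sb .
  moreover have "(\<Sum>k<2 * n + 2. \<Sum>e\<in>UNIV. f (real n + 1 / 2, real k - (real n + 1 / 2), e)) =
     diag_sum P n * (of_real kappa powr (- s) * (qexp (of_nat (Suc n) * s) * weight n s))" for n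
    unfolding diag_sum_def f_def fst_conv snd_conv eigenvalue_powr Let_def sum_distrib_right
    by (intro sum.cong refl) (simp only: mult_ac)
  ultimately show "(\<lambda>n. diag_sum P n * (of_real kappa powr (- s) * (qexp (of_nat (Suc n) * s) *
      weight n s))) sums
      op_trace (?S \<circ>\<^sub>m abs_dirac_pow q w (- s))" by simp
qed

text \<open>There are 4 (n + 1) entries, uniformly bounded; this linear growth is what keeps poles
  out of Re s > 0.\<close>

lemma diag_sum_bound:
  assumes P: "P \<in> op_class q w 0"
  shows "\<exists>C. \<forall>n. cmod (diag_sum P n) \<le> C * real (Suc n)"
proof -
  obtain C where d: "\<And>i. cmod (hcoeff (the (P (basis i))) i) \<le> C"
    using diagonal_bound[OF P] by blast
  have "cmod (diag_sum P n) \<le> (\<Sum>k<2 * n + 2. \<Sum>e\<in>(UNIV :: bool set). C)" for n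
    unfolding diag_sum_def Let_def by (intro sum_norm_le d)
  then show ?thesis by (intro exI[of _ "4 * C"]) (simp add: algebra_simps)
qed

lemma label_in: "k < 2 * n + 2 \<Longrightarrow> (real n + 1 / 2, real k - (real n + 1 / 2), e) \<in> labels"
  using bij_betwE[OF label_of_bij] unfolding label_index_def label_of_def by force

lemma lam_powr_of_nat:
  assumes "i \<in> labels"
  shows "complex_of_real (lam i) powr (- of_nat p) =
      (of_real (1 / cmod w) * of_real (1 / qnum q (fst i + 1 / 2))) ^ p"
proof -
  have "of_real (lam i) powr (- of_nat p) = complex_of_real (1 / lam i) ^ p"
    using lam_lower(2)[OF assms] by (simp add: powr_minus powr_nat' inverse_eq_divide power_one_over)
  then show ?thesis by (simp add: abs_dirac_eigenvalue_def)
qed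

section \<open>Zeta functions of pseudodifferential operators of order zero\<close>

text \<open>The diagonal of T |D|^-p is a \<open>coefficient\<close>, as \<open>T\<close> is banded
  and |D|^-p is an expandable function of l. Boundedness of |D|^M R makes the diagonal of
  \<open>R\<close> of size lam^(-M), that is q^(M nu).\<close>

lemma log_expansion_diag_sum:
  assumes "P \<in> pseudo_diff_zero q w"
  shows "log_expansion (diag_sum P)"
proof (rule log_expansion_approx)
  fix N :: nat
  \<comment> \<open>One order more than \<open>N\<close>: the spare power of q absorbs the 4 (n + 1)
    labels of a level.\<close>
  define M where "M = Suc N"
  obtain T R p where T: "T \<in> diff_ops q w" and R: "R \<in> OP_minus q w M"
    and P: "\<And>x. x \<in> H_infty q w \<Longrightarrow> P x = op_add (T \<circ>\<^sub>m abs_dirac_pow q w (- of_nat p)) R x"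
    using assms unfolding pseudo_diff_zero_def pseudo_diff_def by blast
  obtain v where v: "finlin T" "v \<in> symbols" "\<And>i. i \<in> labels \<Longrightarrow> T (basis i) = Some (v i)"
    using banded_diff_ops[OF T] by (rule bandedE) blast
  obtain f where f: "f \<in> coefficient" "\<And>i. i \<in> labels \<Longrightarrow> hcoeff (v i) i = f i"
    using symbols_diagonal[OF v(2)] by blast
  define c where "c i = complex_of_real (lam i) powr (- of_nat p)" for i
  define g where "g i = (complex_of_real (1 / cmod w) * of_real (1 / qnum q (fst i + 1 / 2))) ^ p *
      f i" for i
  have "expansion (\<lambda>l. (complex_of_real (1 / cmod w) * of_real (1 / qnum q (of_nat 1 * l + 1 /
      2))) ^ p)"
    by (intro expansion_power expansion_mult expansion_const expansion_inverse_qnum) simp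
  then have "g \<in> coefficient"
    unfolding g_def
    using coefficient_mult[OF coefficient_expansion[of "\<lambda>e l. (of_real (1 / cmod w) * of_real (1 /
        qnum q (l + 1 / 2))) ^ p"] f(1)]
    by simp
  then have lg: "log_expansion (\<lambda>n. \<Sum>k<2 * n + 2. \<Sum>e\<in>UNIV. g (real n + 1 / 2,
      real k - (real n + 1 / 2), e))"
    by (rule log_expansion_coefficient_sum)
  have "bounded_op (abs_dirac_pow q w (of_nat M) \<circ>\<^sub>m R)"
    using R unfolding OP_minus_def OP_zero_def by (auto dest: spec[of _ 0])
  then obtain C where C: "C \<ge> 0" "\<And>x. norm (the ((abs_dirac_pow q w (of_nat M) \<circ>\<^sub>m R) x)) \<le> C * norm x"
    "dom (abs_dirac_pow q w (of_nat M) \<circ>\<^sub>m R) = UNIV"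
    by (rule bounded_opE) blast
  have diag: "cmod (hcoeff (the (P (basis i))) i - g i) \<le> C * lam i powr (- real M)" if i: "i \<in>
      labels" for i
  proof -
    have "(abs_dirac_pow q w (of_nat M) \<circ>\<^sub>m R) (basis i) \<noteq> None" using C(3) by blast
    then obtain r y where r: "R (basis i) = Some r" "abs_dirac_pow q w (of_nat M) r = Some y"
      by (auto simp: map_comp_def split: option.splits)
    have "r \<in> dom (diag_op (\<lambda>i. of_real (lam i) powr (of_nat M)))"
      using r(2) unfolding abs_dirac_pow_eq by blast
    from hcoeff_diag_op[OF this, of i] have "hcoeff y i = of_real (lam i) powr (of_nat M) * hcoeff r i"
      using r(2) unfolding abs_dirac_pow_eq by simp
    then have "lam i powr real M * cmod (hcoeff r i) = cmod (hcoeff y i)"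
      using norm_lam_powr[OF i, of "of_nat M"] by (simp add: norm_mult)
    also have "\<dots> \<le> norm y" by (rule hcoeff_le_norm)
    also have "\<dots> \<le> C * norm (basis i)" using C(2)[of "basis i"] r by (simp add: map_comp_def)
    also have "\<dots> \<le> C * 1" by (rule mult_left_mono[OF norm_basis_le C(1)])
    finally have rb: "cmod (hcoeff r i) \<le> C * lam i powr (- real M)"
      using lam_lower(2)[OF i] by (simp add: powr_minus field_simps)
    have "abs_dirac_pow q w (- of_nat p) (basis i) = Some (c i *\<^sub>C basis i)"
      unfolding abs_dirac_pow_eq c_def by (rule diag_op_basis[OF i])
    then have "(T \<circ>\<^sub>m abs_dirac_pow q w (- of_nat p)) (basis i) = T (c i *\<^sub>C basis i)"
      by (simp add: map_comp_def)
    also have "\<dots> = Some (c i *\<^sub>C v i)"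
      using finlinD(1)[OF v(1) finsupp_scale[OF finsupp_ket]] finlinD(5)[OF v(1) finsupp_ket]
          v(3)[OF i] by (metis option.sel)
    finally have "P (basis i) = Some (c i *\<^sub>C v i + r)"
      unfolding P[OF finsupp_H_infty[OF finsupp_ket]] op_add_def using r(1) by (simp add: domI)
    then have "hcoeff (the (P (basis i))) i - g i = hcoeff r i"
      using f(2)[OF i] lam_powr_of_nat[OF i, of p] by (simp add: c_def g_def)
    then show ?thesis using rb by simp
  qed
  obtain K where K: "K \<ge> 0" "\<And>n. real (Suc n) * q ^ Suc n \<le> K"
    using nat_times_power_bounded by blast
  define D where "D = 4 * C * lam_min powr (- real M) * K"
  have "cmod (diag_sum P n - (\<Sum>k<2 * n + 2. \<Sum>e\<in>UNIV. g (real n + 1 / 2, real k - (real n + 1 / 2),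
      e))) \<le> D * q ^ (N * Suc n)" for n
  proof -
    define E where "E = C * (lam_min powr (- real M) * (q powr real M) ^ Suc n)"
    have "cmod (hcoeff (the (P (basis i))) i - g i) \<le> E" if i: "i = (real n + 1 / 2,
        real k - (real n + 1 / 2), e)" "k < 2 * n + 2" for i k e
    proof -
      have "i \<in> labels" using label_in i by simp
      then have "cmod (hcoeff (the (P (basis i))) i - g i) \<le> C * lam i powr (- real M)" by (rule diag)
      also have "\<dots> \<le> E"
        unfolding E_def i(1) fst_conv using eigenvalue_powr_upper[of "real M" n] C(1)
            by (intro mult_left_mono) auto
      finally show ?thesis .
    qed
    then have "cmod (diag_sum P n - (\<Sum>k<2 * n + 2. \<Sum>e\<in>UNIV. g (real n + 1 / 2,
        real k - (real n + 1 / 2), e)))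
       \<le> (\<Sum>k<2 * n + 2. \<Sum>e\<in>(UNIV :: bool set). E)"
      unfolding diag_sum_def Let_def sum_subtractf[symmetric] by (intro sum_norm_le) simp
    also have "\<dots> = 4 * real (Suc n) * E" by simp
    also have "(q powr real M) ^ Suc n = q ^ (N * Suc n) * q ^ Suc n"
      by (simp only: q_power_eq_powr[symmetric] power_mult[symmetric] power_add[symmetric]
          M_def mult_Suc add.commute)
    then have "4 * real (Suc n) * E = 4 * C * lam_min powr (- real M) * (real (Suc n) * q ^ Suc n) *
        q ^ (N * Suc n)"
      unfolding E_def by (simp only: mult_ac)
    also have "\<dots> \<le> D * q ^ (N * Suc n)"
      unfolding D_def using C(1) q_pos by (intro mult_right_mono mult_left_mono K) auto
    finally show ?thesis .
  qed
  then show "\<exists>v C. log_expansion v \<and> (\<forall>n. cmod (diag_sum P n - v n) \<le> C * q ^ (N * Suc n))"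
    using lg by blast
qed

lemma kappa_powr_analytic: "(\<lambda>s. of_real kappa powr (a * s)) analytic_on S"
  unfolding powr_def using kappa_pos by (auto intro!: analytic_intros)

lemma kappa_powr_nonzero: "complex_of_real kappa powr s \<noteq> 0"
  using kappa_pos by simp

text \<open>The factor kappa^(-s) is analytic without zeros and changes neither the poles nor their
  orders.\<close>

lemma zeta_continuation_exists:
  assumes P: "P \<in> pseudo_diff_zero q w"
  shows "\<exists>Z. zeta_continuation q w P Z \<and> (\<forall>z. is_pole Z z \<longrightarrow> Re z \<le> 0 \<and> z \<in> pole_lattice \<and>
      zorder Z z \<ge> -2)"
proof -
  have P0: "P \<in> op_class q w 0" using P by (simp add: pseudo_diff_zero_def)
  obtain C where C: "\<And>n. cmod (diag_sum P n) \<le> C * real (Suc n)"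
    using diag_sum_bound[OF P0] by blast
  obtain Y where Y: "Y meromorphic_on UNIV"
    "\<And>s. 0 < Re s \<Longrightarrow> (\<lambda>n. diag_sum P n * qexp (of_nat (Suc n) * s) * weight n s) sums Y s"
    "\<And>z. is_pole Y z \<Longrightarrow> Re z \<le> 0 \<and> z \<in> pole_lattice \<and> zorder Y z \<ge> -2"
    using meromorphic_continuation_exists[OF log_expansion_diag_sum[OF P] C] by blast
  define k where "k s = complex_of_real kappa powr (- s)" for s
  have k: "k analytic_on S" "k z \<noteq> 0" for S z
    using kappa_powr_analytic[of "-1" S] kappa_powr_nonzero unfolding k_def by simp_all
  define Z where "Z s = k s * Y s" for s
  have "Z meromorphic_on UNIV"
    unfolding Z_def by (rule meromorphic_on_mult[OF analytic_on_imp_meromorphic_on[OF k(1)] Y(1)])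
  moreover have "Z s = op_trace (bounded_ext q w P \<circ>\<^sub>m abs_dirac_pow q w (- s))" if "0 < Re s" for s
  proof -
    have "(\<lambda>n. k s * (diag_sum P n * qexp (of_nat (Suc n) * s) * weight n s)) sums Z s"
      unfolding Z_def by (intro sums_mult Y that)
    moreover have "(\<lambda>n. k s * (diag_sum P n * qexp (of_nat (Suc n) * s) * weight n s)) sums
       op_trace (bounded_ext q w P \<circ>\<^sub>m abs_dirac_pow q w (- s))"
      using trace_sums(2)[OF P0 that] unfolding k_def by (simp only: mult_ac)
    ultimately show ?thesis by (rule sums_unique2)
  qed
  ultimately have "zeta_continuation q w P Z"
    unfolding zeta_continuation_def using trace_sums(1)[OF P0] by blast
  moreover have "Re z \<le> 0 \<and> z \<in> pole_lattice \<and> zorder Z z \<ge> -2" if p: "is_pole Z z" for z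
  proof -
    have pY: "is_pole Y z"
      using p is_pole_mult_analytic_nonzero1_iff[OF k] unfolding Z_def by blast
    have "\<forall>\<^sub>F s in at z. Y s \<noteq> 0"
      using pY by (rule non_zero_neighbour_pole)
    then have fY: "\<exists>\<^sub>F s in at z. Y s \<noteq> 0" by (rule eventually_frequently[rotated]) simp
    have fk: "\<exists>\<^sub>F s in at z. k s \<noteq> 0" using k by (intro eventually_frequently) simp_all
    have "zorder Z z = zorder k z + zorder Y z"
      unfolding Z_def using fY fk
      by (intro zorder_mult analytic_on_imp_meromorphic_on k meromorphic_on_subset[OF Y(1)]) auto
    also have "zorder k z = 0" by (rule zorder_eq_0I[OF k])
    finally show ?thesis using Y(3)[OF pY] by simp
  qed
  ultimately show ?thesis by blast
qed

text \<open>\<open>dimension_spectrum\<close> admits any continuation \<open>Z\<close>; this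
  transfers what is known of one of them to all.\<close>

lemma zeta_continuation_unique:
  assumes "zeta_continuation q w P Y" "zeta_continuation q w P Z"
  shows "\<forall>\<^sub>F s in at z. Y s = Z s"
proof -
  obtain c where c: "\<And>s. c < Re s \<Longrightarrow> Y s = op_trace (bounded_ext q w P \<circ>\<^sub>m abs_dirac_pow q w (- s))"
    using assms(1) unfolding zeta_continuation_def by blast
  obtain d where d: "\<And>s. d < Re s \<Longrightarrow> Z s = op_trace (bounded_ext q w P \<circ>\<^sub>m abs_dirac_pow q w (- s))"
    using assms(2) unfolding zeta_continuation_def by blast
  show ?thesis
  proof (rule meromorphic_on_eqI[where U = UNIV and V = "{s. \<bar>c\<bar> + \<bar>d\<bar> < Re s}"])
    show "Y meromorphic_on UNIV" "Z meromorphic_on UNIV"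
      using assms unfolding zeta_continuation_def by blast+
    have "complex_of_real (\<bar>c\<bar> + \<bar>d\<bar> + 1) \<in> {s. \<bar>c\<bar> + \<bar>d\<bar> < Re s}" by simp
    then show "{s. \<bar>c\<bar> + \<bar>d\<bar> < Re s} \<noteq> {}" by blast
    show "Y s = Z s" if "s \<in> {s. \<bar>c\<bar> + \<bar>d\<bar> < Re s}" for s
    proof -
      have "c < Re s" "d < Re s" using that by auto
      then show ?thesis using c d by simp
    qed
  qed (auto simp: open_halfspace_Re_gt)
qed

lemma zeta_pole:
  assumes "P \<in> pseudo_diff_zero q w" "zeta_continuation q w P Z" "is_pole Z z"
  shows "Re z \<le> 0" "z \<in> pole_lattice" "zorder Z z \<ge> -2"
proof -
  obtain Y where Y: "zeta_continuation q w P Y"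
    "\<And>z. is_pole Y z \<Longrightarrow> Re z \<le> 0 \<and> z \<in> pole_lattice \<and> zorder Y z \<ge> -2"
    using zeta_continuation_exists[OF assms(1)] by blast
  have ev: "\<forall>\<^sub>F s in at z. Z s = Y s" by (rule zeta_continuation_unique[OF assms(2) Y(1)])
  have "is_pole Y z" using is_pole_cong[OF ev refl] assms(3) by simp
  moreover have "zorder Z z = zorder Y z" by (rule zorder_cong[OF ev refl])
  ultimately show "Re z \<le> 0" "z \<in> pole_lattice" "zorder Z z \<ge> -2" using Y(2)[of z] by simp_all
qed

section \<open>Negative powers of |D| attain the poles\<close>

text \<open>The remainder for P = |D|^-k, which is the identity times |D|^-k plus zero, for every
  \<open>N\<close>.\<close>

lemma zero_op_OP: "(\<lambda>x. Some 0) \<in> OP_minus q w N"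
proof -
  let ?O = "\<lambda>x :: hilb. Some (0 :: hilb)"
  have z: "the (basis_op v 0) = 0" "0 \<in> dom (basis_op v)" for v
    using clinear_basis_op[of v] by (auto simp: clinear_op_def)
  have "bounded_op ?O"
    unfolding bounded_op_def clinear_op_def by (auto simp: scaleC_algebra intro!: exI[of _ 0])
  then have "delta_rel q w ?O ?O"
    using z unfolding delta_rel_def abs_dirac_def by simp
  then have "?O \<in> dom_delta q w n" for n
    using \<open>bounded_op ?O\<close> by (induction n) auto
  moreover have "abs_dirac_pow q w (of_nat N) \<circ>\<^sub>m ?O = ?O"
    using clinear_diag_op unfolding abs_dirac_pow_eq clinear_op_def
        by (simp add: map_comp_def fun_eq_iff)
  ultimately show ?thesis unfolding OP_minus_def OP_zero_def by simp
qed

lemma abs_dirac_pow_bound: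
  "i \<in> labels \<Longrightarrow> cmod (of_real (lam i) powr (- of_nat k)) \<le> lam_min powr (- real k)"
  using lam_lower[of i] lam_min_pos by (simp add: norm_lam_powr powr_mono2')

text \<open>The eigenvalues stay away from zero, so 1 + lam^2 and lam^2 are comparable and |D|^s
  controls the Sobolev weight.\<close>

lemma dom_bessel_pot:
  assumes x: "x \<in> H_infty q w" and s: "s \<ge> 0"
  shows "x \<in> dom (bessel_pot q w s)"
  unfolding bessel_pot_eq dom_diag_op
proof (rule ell2_mono)
  show "ell2 (\<lambda>i. of_real (lam i) powr of_real s * hcoeff x i)"
    using x s unfolding H_infty_iff by blast
  \<comment> \<open>From 1 + lam^2 <= (1 + 1 / lam_min^2) lam^2, raised to the power s/2.\<close>
  define B where "B = (1 + 1 / lam_min\<^sup>2) powr (s / 2)"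
  fix i assume i: "i \<in> labels"
  have l: "0 < lam i" "lam_min \<le> lam i" using lam_lower i by auto
  have "lam_min\<^sup>2 \<le> (lam i)\<^sup>2" using l lam_min_pos by (intro power_mono) auto
  then have "1 \<le> 1 / lam_min\<^sup>2 * (lam i)\<^sup>2" using lam_min_pos by (simp add: field_simps)
  then have "1 + (lam i)\<^sup>2 \<le> (1 + 1 / lam_min\<^sup>2) * (lam i)\<^sup>2" by (simp add: distrib_right)
  then have "(1 + (lam i)\<^sup>2) powr (s / 2) \<le> ((1 + 1 / lam_min\<^sup>2) * (lam i)\<^sup>2) powr (s / 2)"
    using s by (intro powr_mono2) auto
  also have "\<dots> = B * ((lam i)\<^sup>2) powr (s / 2)"
    unfolding B_def by (rule powr_mult)
  also have "((lam i)\<^sup>2) powr (s / 2) = lam i powr s"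
    using l by (simp add: powr_powr flip: powr_numeral)
  finally have b: "(1 + (lam i)\<^sup>2) powr (s / 2) \<le> B * lam i powr s" .
  have "cmod (of_real ((1 + (lam i)\<^sup>2) powr (s / 2)) * hcoeff x i) =
      (1 + (lam i)\<^sup>2) powr (s / 2) * cmod (hcoeff x i)"
    by (simp add: norm_mult)
  also have "\<dots> \<le> B * lam i powr s * cmod (hcoeff x i)" using b by (rule mult_right_mono) simp
  finally show "cmod (of_real ((1 + (lam i)\<^sup>2) powr (s / 2)) * hcoeff x i) \<le>
      B * cmod (of_real (lam i) powr of_real s * hcoeff x i)"
    using norm_lam_powr[OF i, of "of_real s"] by (simp add: norm_mult mult.assoc)
qed (simp add: hcoeff_outside)

text \<open>A bounded diagonal operator acts coordinatewise just like the Sobolev weights, so the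
  bound on its eigenvalues is the constant in every Sobolev estimate.\<close>

lemma abs_dirac_pow_pseudo_diff_zero: "abs_dirac_pow q w (- of_nat k) \<in> pseudo_diff_zero q w"
proof -
  let ?P = "abs_dirac_pow q w (- of_nat k)"
  define d where "d i = complex_of_real (lam i) powr (- of_nat k)" for i :: label
  define M where "M = lam_min powr (- real k)"
  have P: "?P = diag_op d" unfolding abs_dirac_pow_eq d_def ..
  have M: "M \<ge> 0" by (simp add: M_def)
  have d: "cmod (d i) \<le> M" if "i \<in> labels" for i
    unfolding d_def M_def by (rule abs_dirac_pow_bound[OF that])
  have dom: "dom ?P = UNIV" and nP: "norm (the (?P x)) \<le> M * norm x" for x
    unfolding P using bounded_diag_op[of d M, OF d M] by blast+
  have hP: "hcoeff (the (?P x)) i = d i * hcoeff x i" for x i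
    using hcoeff_diag_op[of x d i] dom unfolding P by blast
  have cl: "clinear_op ?P" unfolding P by (rule clinear_diag_op)
  have HP: "the (?P x) \<in> H_infty q w" if x: "x \<in> H_infty q w" for x
    unfolding H_infty_iff hP
  proof (intro allI impI)
    fix s :: real assume s: "s \<ge> 0"
    show "ell2 (\<lambda>i. of_real (lam i) powr of_real s * (d i * hcoeff x i))"
    proof (rule ell2_mono)
      show "ell2 (\<lambda>i. of_real (lam i) powr of_real s * hcoeff x i)"
        using x s unfolding H_infty_iff by blast
      show "cmod (of_real (lam i) powr of_real s * (d i * hcoeff x i)) \<le>
          M * cmod (of_real (lam i) powr of_real s * hcoeff x i)"
        if "i \<in> labels" for i
        using mult_right_mono[OF d[OF that], of "cmod (of_real (lam i) powr of_real s * hcoeff x i)"]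
        by (simp add: norm_mult mult_ac)
    qed (simp add: hcoeff_outside)
  qed
  have sob: "sobolev_norm q w (s - 0) (the (?P x)) \<le> M * sobolev_norm q w s x" if s: "s \<ge> 0"
      and x: "x \<in> H_infty q w" for s x
  proof -
    have "norm (the (bessel_pot q w s (the (?P x)))) \<le> M * norm (the (bessel_pot q w s x))"
    proof (rule norm_le_coeff[OF _ M])
      fix i assume i: "i \<in> labels"
      have "hcoeff (the (bessel_pot q w s (the (?P x)))) i =
          of_real ((1 + (lam i)\<^sup>2) powr (s / 2)) * (d i * hcoeff x i)"
        using hcoeff_diag_op[OF dom_bessel_pot[OF HP[OF x] s, unfolded bessel_pot_eq], of i]
            unfolding bessel_pot_eq hP .
      moreover have "hcoeff (the (bessel_pot q w s x)) i =
          of_real ((1 + (lam i)\<^sup>2) powr (s / 2)) * hcoeff x i"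
        using hcoeff_diag_op[OF dom_bessel_pot[OF x s, unfolded bessel_pot_eq], of i]
            unfolding bessel_pot_eq .
      ultimately show "cmod (hcoeff (the (bessel_pot q w s (the (?P x)))) i) \<le>
          M * cmod (hcoeff (the (bessel_pot q w s x)) i)"
        using mult_right_mono[OF d[OF i], of "cmod (of_real ((1 + (lam i)\<^sup>2) powr (s / 2)) *
            hcoeff x i)"]
        by (simp add: norm_mult mult_ac)
    qed
    then have "(norm (the (?P x)))\<^sup>2 + (norm (the (bessel_pot q w s (the (?P x)))))\<^sup>2 \<le>
        (M * norm x)\<^sup>2 + (M * norm (the (bessel_pot q w s x)))\<^sup>2"
      by (intro add_mono power_mono nP) auto
    also have "\<dots> = M\<^sup>2 * ((norm x)\<^sup>2 + (norm (the (bessel_pot q w s x)))\<^sup>2)"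
      by (simp add: power_mult_distrib distrib_left)
    finally have "sobolev_norm q w s (the (?P x)) \<le>
        sqrt (M\<^sup>2 * ((norm x)\<^sup>2 + (norm (the (bessel_pot q w s x)))\<^sup>2))"
      unfolding sobolev_norm_def by (rule real_sqrt_le_mono)
    then show ?thesis unfolding sobolev_norm_def using M by (simp add: real_sqrt_mult)
  qed
  have "?P \<in> op_class q w 0"
    unfolding op_class_def using cl dom HP sob by blast
  moreover have "?P x = op_add (Some \<circ>\<^sub>m abs_dirac_pow q w (- of_nat k)) (\<lambda>x. Some 0) x" for x
  proof -
    obtain y where "?P x = Some y" using dom by blast
    then show ?thesis by (simp add: op_add_def map_comp_def dom_def)
  qed
  then have "?P \<in> pseudo_diff q w"
    unfolding pseudo_diff_def diff_ops_def using cl dom zero_op_OP alg_gen.one by blast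
  ultimately show ?thesis unfolding pseudo_diff_zero_def by blast
qed

lemma diag_sum_abs_dirac_pow:
  "diag_sum (abs_dirac_pow q w (- of_nat k)) n =
     4 * of_nat (Suc n) * (of_real kappa powr (- of_nat k) * (qexp (of_nat (Suc n) * of_nat k) *
         weight n (of_nat k)))"
proof -
  have "(let i = (real n + 1 / 2, real j - (real n + 1 / 2),
      e) in hcoeff (the (abs_dirac_pow q w (- of_nat k) (basis i))) i)
      = of_real (abs_dirac_eigenvalue q w (real n + 1 / 2)) powr (- of_nat k)" if "j < 2 * n + 2"
          for j e
  proof -
    define i where "i = (real n + 1 / 2, real j - (real n + 1 / 2), e)"
    have i: "i \<in> labels" unfolding i_def by (rule label_in[OF that])
    have "hcoeff (the (abs_dirac_pow q w (- of_nat k) (basis i))) i = of_real (lam i) powr (- of_nat k)"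
      unfolding abs_dirac_pow_eq diag_op_basis[OF i] using i hcoeff_basis[of i i] by simp
    then show ?thesis unfolding Let_def i_def[symmetric] by (simp add: i_def)
  qed
  then have "diag_sum (abs_dirac_pow q w (- of_nat k)) n =
     (\<Sum>j<2 * n + 2. \<Sum>e\<in>(UNIV :: bool set). of_real (abs_dirac_eigenvalue q w (real n + 1 /
         2)) powr (- of_nat k))"
    unfolding diag_sum_def by (intro sum.cong refl) simp
  then show ?thesis unfolding eigenvalue_powr by simp
qed

text \<open>Tr (|D|^-k |D|^-s) depends on s + k only: it is 4 kappa^(-s-k) times the series with
  coefficients nu at s + k. Shifting and normalising reduces the claim to
  \<open>continuation_pole\<close>.\<close>

lemma zeta_abs_dirac_pow_pole:
  assumes Z: "zeta_continuation q w (abs_dirac_pow q w (- of_nat k)) Z" and z: "qexp (z + of_nat k) = 1"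
  shows "is_pole Z z"
proof -
  let ?P = "abs_dirac_pow q w (- of_nat k)"
  have P0: "?P \<in> op_class q w 0"
    using abs_dirac_pow_pseudo_diff_zero by (simp add: pseudo_diff_zero_def)
  obtain c where c: "\<And>s. c < Re s \<Longrightarrow> Z s = op_trace (bounded_ext q w ?P \<circ>\<^sub>m abs_dirac_pow q w (- s))"
    using Z unfolding zeta_continuation_def by blast
  have Zm: "Z meromorphic_on UNIV" using Z unfolding zeta_continuation_def by blast
  \<comment> \<open>Cancels the factor 4 kappa^(-s) of the shifted zeta function.\<close>
  define h where "h s = complex_of_real kappa powr s / 4" for s
  have h: "h analytic_on S" "h s \<noteq> 0" for S s
    using kappa_powr_analytic[of 1 S] kappa_powr_nonzero unfolding h_def
        by (auto intro!: analytic_intros)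
  define W where "W s = h s * Z (s - of_nat k)" for s
  have Zk: "(\<lambda>s. Z (s - of_nat k)) meromorphic_on UNIV"
    by (rule meromorphic_on_compose[OF Zm]) (auto intro!: analytic_intros)
  have Wm: "W meromorphic_on UNIV"
    unfolding W_def by (rule meromorphic_on_mult[OF analytic_on_imp_meromorphic_on[OF h(1)] Zk])
  have sums: "(\<lambda>n. of_nat (Suc n) * qexp (of_nat (Suc n) * s) * weight n s) sums W s"
      if s: "\<bar>c\<bar> + real k < Re s" for s
  proof -
    define t where "t = s - of_nat k"
    have t: "0 < Re t" "c < Re t" using s by (auto simp: t_def)
    have st: "s = t + of_nat k" by (simp add: t_def)
    have kp: "of_real kappa powr (- of_nat k) * (of_real kappa powr (- t)) * of_real kappa powr s =
        (1 :: complex)"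
      using kappa_pos unfolding st by (simp add: powr_add[symmetric])
    have "(\<lambda>n. h s * (diag_sum ?P n * (of_real kappa powr (- t) * (qexp (of_nat (Suc n) * t) *
        weight n t)))) sums W s"
      unfolding W_def t_def[symmetric] c[OF t(2)] by (intro sums_mult trace_sums(2)[OF P0 t(1)])
    moreover have "h s * (diag_sum ?P n * (of_real kappa powr (- t) * (qexp (of_nat (Suc n) * t) *
        weight n t)))
      = of_nat (Suc n) * qexp (of_nat (Suc n) * s) * weight n s" for n
    proof -
      have q: "qexp (of_nat (Suc n) * s) = qexp (of_nat (Suc n) * of_nat k) * qexp (of_nat (Suc n) * t)"
        unfolding st distrib_left qexp_add by (rule mult.commute)
      have wt: "weight n s = weight n (of_nat k) * weight n t"
        unfolding st weight_def exp_add[symmetric] by (simp add: algebra_simps)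
      have "h s * (diag_sum ?P n * (of_real kappa powr (- t) * (qexp (of_nat (Suc n) * t) *
          weight n t)))
        = (of_real kappa powr (- of_nat k) * (of_real kappa powr (- t)) * of_real kappa powr s) *
          (of_nat (Suc n) * (qexp (of_nat (Suc n) * of_nat k) * qexp (of_nat (Suc n) * t)) *
              (weight n (of_nat k) * weight n t))"
        unfolding diag_sum_abs_dirac_pow h_def by simp
      then show ?thesis unfolding kp q wt by simp
    qed
    ultimately show ?thesis by simp
  qed
  have "is_pole W (z + of_nat k)"
    by (rule continuation_pole[OF Wm sums z])
  then have "is_pole (\<lambda>s. Z (s - of_nat k)) (z + of_nat k)"
    unfolding W_def using is_pole_mult_analytic_nonzero1_iff[OF h] by blast
  then have "is_pole (Z \<circ> (+) (- of_nat k)) (z + of_nat k)" by (simp add: o_def)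
  then show ?thesis unfolding is_pole_shift_iff by simp
qed

end

theorem corollary3p10:
  fixes q :: real and w :: complex
  assumes "0 < q" and "q < 1" and "w \<noteq> 0"
  shows "(\<forall>P\<in>pseudo_diff_zero q w. \<exists>Z. zeta_continuation q w P Z) \<and>
    dimension_spectrum q w =
      {- of_nat k + \<i> * complex_of_real (2 * pi / ln q) * of_int n | (k :: nat) (n :: int). True} \<and>
    (\<forall>P\<in>pseudo_diff_zero q w. \<forall>Z z.
      zeta_continuation q w P Z \<and> is_pole Z z \<longrightarrow> zorder Z z \<ge> -2)"
proof -
  interpret podles_dirac q w by unfold_locales (use assms in auto)
  have "z \<in> {- of_nat k + \<i> * complex_of_real (2 * pi / ln q) * of_int n | (k :: nat) (n :: int). True}"
    if z: "z \<in> dimension_spectrum q w" for z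
  proof -
    obtain P Z where PZ: "P \<in> pseudo_diff_zero q w" "zeta_continuation q w P Z" "is_pole Z z"
      using z unfolding dimension_spectrum_def by blast
    obtain j where "qexp (z + of_int j) = 1"
      using zeta_pole(2)[OF PZ] unfolding pole_lattice_def by blast
    then obtain n :: int where n: "z + of_int j = \<i> * complex_of_real (2 * pi / ln q) * of_int n"
      unfolding qexp_eq_1_iff by blast
    have "Re (z + of_int j) = 0" unfolding n by simp
    \<comment> \<open>Here Re z = -j, and a pole has nonpositive real part.\<close>
    then have "j \<ge> 0" using zeta_pole(1)[OF PZ] by simp
    then have "z = - of_nat (nat j) + \<i> * complex_of_real (2 * pi / ln q) * of_int n"
      using n by (simp add: algebra_simps)
    then show ?thesis by blast
  qed
  moreover have "z \<in> dimension_spectrum q w"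
    if z: "z = - of_nat k + \<i> * complex_of_real (2 * pi / ln q) * of_int n" for z and k :: nat
        and n :: int
  proof -
    \<comment> \<open>The witness is |D|^-k, whose zeta function has a pole at \<open>z\<close>
      because q^(z + k) = 1.\<close>
    have "qexp (z + of_nat k) = 1" unfolding qexp_eq_1_iff z by auto
    moreover obtain Z where "zeta_continuation q w (abs_dirac_pow q w (- of_nat k)) Z"
      using zeta_continuation_exists[OF abs_dirac_pow_pseudo_diff_zero] by blast
    ultimately show ?thesis
      unfolding dimension_spectrum_def using zeta_abs_dirac_pow_pole abs_dirac_pow_pseudo_diff_zero
          by blast
  qed
  ultimately have "dimension_spectrum q w =
      {- of_nat k + \<i> * complex_of_real (2 * pi / ln q) * of_int n | (k :: nat) (n :: int). True}"
    by blast
  then show ?thesis using zeta_continuation_exists zeta_pole(3) by blast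
qed

end
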